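(* Let $\mathcal M$ be a finite, finally connected, finally aperiodic Markov chain with two output functions $k_1,k_2\colon\mathcal E\to\mathbb R$ and output sums $K_n^{(1)},K_n^{(2)}$. Then for $i=1,2$, $K_n^{(i)}$ has expected value $e_in+\mathcal O(1)$ and variance $v_in+\mathcal O(1)$, where $$e_i=\frac{k_i(\mathcal D_1)}{\mathbb{1}(\mathcal D_1)},\qquad v_i=\frac{1}{\mathbb{1}(\mathcal D_1)}\Big((k_i-e_i\mathbb{1},k_i-e_i\mathbb{1})(\mathcal D_1)-(k_i-e_i\mathbb{1},k_i-e_i\mathbb{1})(\mathcal D_2)\Big).$$ The covariance of $K_n^{(1)}$ and $K_n^{(2)}$ is $cn+\mathcal O(1)$ with $$c=\frac{1}{\mathbb{1}(\mathcal D_1)}\Big((k_1-e_1\mathbb{1},k_2-e_2\mathbb{1})(\mathcal D_1)-(k_1-e_1\mathbb{1},k_2-e_2\mathbb{1})(\mathcal D_2)\Big).$$ The random variables $K_n^{(1)}$ and $K_n^{(2)}$ are asymptotically independent if and only if $$(k_1-e_1\mathbb{1},k_2-e_2\mathbb{1})(\mathcal D_1)=(k_1-e_1\mathbb{1},k_2-e_2\mathbb{1})(\mathcal D_2).$$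
   Context: A finite Markov chain here consists of a finite state space $\{1,\dots,M\}$, a finite set $\mathcal E$ of transitions between states (multiple transitions and loops allowed), each transition $e$ having probability $p_e>0$ such that for every state the probabilities of its outgoing transitions sum to $1$, and a unique initial state $1$ from which all states are accessible. The chain is finally connected if the condensation of its underlying digraph has exactly one vertex of out-degree $0$; the corresponding strongly connected component is the final component. It is finally aperiodic if the gcd of the cycle lengths of the final component is $1$. $X_n$ is a random path of length $n$ from state $1$, a path $P$ having probability $\prod_{e\in P}p_e$. The output sum $K_n^{(i)}$ is the sum of $k_i(e)$ over the transitions $e$ of $X_n$. $\mathbb{1}$ is the constant function $\mathbb{1}(e)=1$. For a subgraph $D$, $p_D=\prod_{e\in D}p_e$; for a cycle $C$ and $g\colon\mathcal E\to\mathbb R$, $g(C)=\sum_{e\in C}g(e)$. A functional digraph is a digraph in which every vertex has out-degree $1$ (each component consists of one directed cycle with trees rooted on it); $\mathcal C_D$ is the set of cycles of a functional digraph $D$. $\mathcal D_1$ and $\mathcal D_2$ are the sets of spanning subgraphs of the final component that are functional digraphs with exactly one and exactly two components, respectively. For $g,h\colon\mathcal E\to\mathbb R$: $g(\mathcal D_1)=\sum_{D\in\mathcal D_1}p_D\sum_{C\in\mathcal C_D}g(C)$, $(g,h)(\mathcal D_1)=\sum_{D\in\mathcal D_1}p_D\sum_{C\in\mathcal C_D}g(C)h(C)$, $(g,h)(\mathcal D_2)=\sum_{D\in\mathcal D_2}p_D\sum_{C_1\in\mathcal C_D}\sum_{C_2\in\mathcal C_D,\,C_2\neq C_1}g(C_1)h(C_2)$.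 *)

theory Defs
  imports
    "HOL-Probability.Probability"
    "HOL-Library.Landau_Symbols"
    "Graph_Theory.Digraph_Component"
begin

locale finite_markov_chain = fin_digraph G
  for G :: "(nat, 'e) pre_digraph" +
  fixes M :: nat and p :: "'e \<Rightarrow> real"
  assumes states: "verts G = {1..M}"
    and initial: "1 \<in> verts G"
    and p_pos: "\<And>e. e \<in> arcs G \<Longrightarrow> 0 < p e"
    and p_sum: "\<And>v. v \<in> verts G \<Longrightarrow> (\<Sum>e\<in>out_arcs G v. p e) = 1"
    and accessible: "\<And>v. v \<in> verts G \<Longrightarrow> 1 \<rightarrow>\<^sup>*\<^bsub>G\<^esub> v"

definition condensation :: "('a, 'e) pre_digraph \<Rightarrow> ('a set, 'a set \<times> 'a set) pre_digraph" where
  "condensation G =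
    \<lparr> verts = pre_digraph.sccs_verts G,
      arcs = {(S, T). S \<in> pre_digraph.sccs_verts G \<and> T \<in> pre_digraph.sccs_verts G \<and> S \<noteq> T \<and>
                (\<exists>e\<in>arcs G. tail G e \<in> S \<and> head G e \<in> T)},
      tail = fst, head = snd \<rparr>"

definition finally_connected :: "('a, 'e) pre_digraph \<Rightarrow> bool" where
  "finally_connected G \<longleftrightarrow>
    (\<exists>!S. S \<in> verts (condensation G) \<and> out_degree (condensation G) S = 0)"

text \<open>The following is meaningful only if \<open>G\<close> is finally connected.\<close>

definition final_component :: "('a, 'e) pre_digraph \<Rightarrow> ('a, 'e) pre_digraph" where
  "final_component G =
    induce_subgraph G (THE S. S \<in> verts (condensation G) \<and> out_degree (condensation G) S = 0)"

definition finally_aperiodic :: "('a, 'e) pre_digraph \<Rightarrow> bool" where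
  "finally_aperiodic G \<longleftrightarrow> Gcd {length w | w. pre_digraph.cycle (final_component G) w} = 1"

text \<open>Paths are lists of arcs, so parallel arcs give different paths.\<close>

definition path_measure :: "(nat, 'e) pre_digraph \<Rightarrow> ('e \<Rightarrow> real) \<Rightarrow> nat \<Rightarrow> 'e list measure" where
  "path_measure G p n =
    point_measure {w. length w = n \<and> (\<exists>v. pre_digraph.awalk G 1 w v)}
      (\<lambda>w. ennreal (\<Prod>e\<leftarrow>w. p e))"

definition output_sum :: "('e \<Rightarrow> real) \<Rightarrow> 'e list \<Rightarrow> real" where
  "output_sum k w = (\<Sum>e\<leftarrow>w. k e)"

definition covariance :: "'a measure \<Rightarrow> ('a \<Rightarrow> real) \<Rightarrow> ('a \<Rightarrow> real) \<Rightarrow> real" where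
  "covariance P X Y =
    prob_space.expectation P
      (\<lambda>\<omega>. (X \<omega> - prob_space.expectation P X) * (Y \<omega> - prob_space.expectation P Y))"

definition functional_digraph :: "('a, 'e) pre_digraph \<Rightarrow> bool" where
  "functional_digraph D \<longleftrightarrow> fin_digraph D \<and> (\<forall>v\<in>verts D. out_degree D v = 1)"

text \<open>Weakly connected components; \<open>Digraph_Component.connected\<close> is connectedness of the
  underlying undirected graph.\<close>

definition components :: "('a, 'e) pre_digraph \<Rightarrow> ('a, 'e) pre_digraph set" where
  "components D = {H. pre_digraph.max_subgraph D Digraph_Component.connected H}"

text \<open>A cycle is identified with its set of arcs, so that the rotations of a closed arc list
  count as one cycle.\<close>

definition cycles :: "('a, 'e) pre_digraph \<Rightarrow> 'e set set" where
  "cycles D = {set w | w. pre_digraph.cycle D w}"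

definition functional_spanning :: "nat \<Rightarrow> ('a, 'e) pre_digraph \<Rightarrow> ('a, 'e) pre_digraph set" where
  "functional_spanning m F =
    {D. spanning D F \<and> functional_digraph D \<and> card (components D) = m}"

definition D1_sum :: "('a, 'e) pre_digraph \<Rightarrow> ('e \<Rightarrow> real) \<Rightarrow> ('e \<Rightarrow> real) \<Rightarrow> real" where
  "D1_sum F p g =
    (\<Sum>D\<in>functional_spanning 1 F. (\<Prod>e\<in>arcs D. p e) * (\<Sum>C\<in>cycles D. \<Sum>e\<in>C. g e))"

definition D1_pair ::
  "('a, 'e) pre_digraph \<Rightarrow> ('e \<Rightarrow> real) \<Rightarrow> ('e \<Rightarrow> real) \<Rightarrow> ('e \<Rightarrow> real) \<Rightarrow> real" where
  "D1_pair F p g h =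
    (\<Sum>D\<in>functional_spanning 1 F. (\<Prod>e\<in>arcs D. p e) *
      (\<Sum>C\<in>cycles D. (\<Sum>e\<in>C. g e) * (\<Sum>e\<in>C. h e)))"

definition D2_pair ::
  "('a, 'e) pre_digraph \<Rightarrow> ('e \<Rightarrow> real) \<Rightarrow> ('e \<Rightarrow> real) \<Rightarrow> ('e \<Rightarrow> real) \<Rightarrow> real" where
  "D2_pair F p g h =
    (\<Sum>D\<in>functional_spanning 2 F. (\<Prod>e\<in>arcs D. p e) *
      (\<Sum>C1\<in>cycles D. \<Sum>C2\<in>cycles D - {C1}. (\<Sum>e\<in>C1. g e) * (\<Sum>e\<in>C2. h e)))"

definition weak_conv_2d :: "(nat \<Rightarrow> (real \<times> real) measure) \<Rightarrow> (real \<times> real) measure \<Rightarrow> bool" where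
  "weak_conv_2d N L \<longleftrightarrow>
    (\<forall>f :: real \<times> real \<Rightarrow> real. continuous_on UNIV f \<and> bounded (range f) \<longrightarrow>
      (\<lambda>n. integral\<^sup>L (N n) f) \<longlonglongrightarrow> integral\<^sup>L L f)"

text \<open>The random variables, centred at their means and rescaled by \<open>sqrt n\<close>, converge jointly in
  distribution to a pair of independent random variables, i.e. to a product measure. The scale is
  \<open>sqrt n\<close> and not the standard deviation because the variances may be bounded; the corresponding
  factor of the limit is then a Dirac measure.\<close>

definition asymptotically_independent ::
  "(nat \<Rightarrow> 'a measure) \<Rightarrow> (nat \<Rightarrow> 'a \<Rightarrow> real) \<Rightarrow> (nat \<Rightarrow> 'a \<Rightarrow> real) \<Rightarrow> bool" where
  "asymptotically_independent P X Y \<longleftrightarrow>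
    (\<exists>\<mu> \<nu>. real_distribution \<mu> \<and> real_distribution \<nu> \<and>
      weak_conv_2d
        (\<lambda>n. distr (P n) borel
          (\<lambda>\<omega>. ((X n \<omega> - prob_space.expectation (P n) (X n)) / sqrt (real n),
                (Y n \<omega> - prob_space.expectation (P n) (Y n)) / sqrt (real n))))
        (\<mu> \<Otimes>\<^sub>M \<nu>))"

end

theory Submission
  imports Defs "HOL-Combinatorics.Orbits" "HOL-Computational_Algebra.Group_Closure"
    "HOL-Real_Asymp.Real_Asymp"
begin

text \<open>
  For every output function \<open>k\<close> the Poisson equation has a solution: there is a potential \<open>h\<close> on the
  states such that \<open>k\<close> plus the coboundary of \<open>h\<close> has the same conditional mean \<open>e\<close> in every state.
  Subtracting \<open>e\<close> makes the output sum a martingale up to a bounded error, so that covariances,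
  and by a first-step recursion also the joint characteristic function, are governed by
  the mean of the product of two corrected outputs.

  A coboundary does not change cycle sums, so the functionals on \<open>\<D>\<^sub>1\<close> and \<open>\<D>\<^sub>2\<close> may be evaluated
  on the corrected outputs. A functional digraph is a choice of one outgoing arc per
  vertex; resampling the arcs chosen at two fixed vertices \<open>u \<noteq> v\<close>, whose corrected outputs average
  to zero, shows that the terms with \<open>u\<close> and \<open>v\<close> on a common cycle cancel against those with \<open>u\<close>
  and \<open>v\<close> on two different cycles. What is left is the diagonal, i.e. the mean of the product.

  The limit law of the rescaled pair is Gaussian with this covariance matrix, and a Gaussian law is
  a product measure exactly if its covariance vanishes.
\<close>

section \<open>Iterating a self-map\<close>

abbreviation periodic :: "('a \<Rightarrow> 'a) \<Rightarrow> 'a \<Rightarrow> bool" where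
  "periodic s x \<equiv> x \<in> orbit s x"

definition reaches :: "('a \<Rightarrow> 'a) \<Rightarrow> 'a \<Rightarrow> 'a \<Rightarrow> bool" where
  "reaches s x y \<longleftrightarrow> (\<exists>n. (s ^^ n) x = y)"

definition merges :: "('a \<Rightarrow> 'a) \<Rightarrow> 'a \<Rightarrow> 'a \<Rightarrow> bool" where
  "merges s x y \<longleftrightarrow> (\<exists>z. reaches s x z \<and> reaches s y z)"

lemma reaches_funpow: "reaches s x ((s ^^ n) x)"
  unfolding reaches_def by blast

lemma reaches_refl [simp]: "reaches s x x"
  using reaches_funpow[of s x 0] by simp

lemma reaches_step [simp]: "reaches s x (s x)"
  using reaches_funpow[of s x 1] by simp

lemma reaches_trans: "reaches s x y \<Longrightarrow> reaches s y z \<Longrightarrow> reaches s x z"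
  unfolding reaches_def by (metis comp_apply funpow_add)

lemma in_orbit_iff_reaches: "y \<in> orbit s x \<longleftrightarrow> reaches s (s x) y"
proof -
  have "y \<in> orbit s x \<longleftrightarrow> (\<exists>n. (s ^^ Suc n) x = y)" unfolding orbit_altdef by (force simp: gr0_conv_Suc)
  then show ?thesis unfolding reaches_def by (simp only: funpow_Suc_right comp_apply)
qed

lemma reaches_iff_orbit: "reaches s x y \<longleftrightarrow> x = y \<or> y \<in> orbit s x"
proof -
  have "reaches s x y \<longleftrightarrow> (s ^^ 0) x = y \<or> (\<exists>n. (s ^^ Suc n) x = y)"
    unfolding reaches_def by (metis not0_implies_Suc)
  then show ?thesis
    unfolding in_orbit_iff_reaches reaches_def[of s "s x"] by (simp only: funpow_Suc_right comp_apply funpow_0)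
qed

lemma reaches_unfold: "reaches s x y \<longleftrightarrow> x = y \<or> reaches s (s x) y"
  unfolding reaches_iff_orbit[of s x] in_orbit_iff_reaches ..

lemma reaches_linear:
  assumes "reaches s x y" "reaches s x z"
  shows "reaches s y z \<or> reaches s z y"
proof -
  obtain m n where m: "(s ^^ m) x = y" and n: "(s ^^ n) x = z"
    using assms unfolding reaches_def by auto
  have "reaches s ((s ^^ i) x) ((s ^^ j) x)" if "i \<le> j" for i j
  proof -
    have "(s ^^ j) x = (s ^^ (j - i + i)) x" using that by simp
    also have "\<dots> = (s ^^ (j - i)) ((s ^^ i) x)" by (simp only: funpow_add comp_apply)
    finally show ?thesis by (simp add: reaches_funpow)
  qed
  then show ?thesis using m n nat_le_linear by blast
qed

lemma reaches_closed:
  assumes "reaches s x y" "x \<in> A" "\<And>x. x \<in> A \<Longrightarrow> s x \<in> A"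
  shows "y \<in> A"
proof -
  have "(s ^^ n) x \<in> A" for n by (induction n) (use assms in auto)
  then show ?thesis using assms(1) unfolding reaches_def by auto
qed

lemma reaches_periodic:
  assumes "periodic s x" "reaches s x y"
  shows "periodic s y" "reaches s y x"
  using assms self_in_orbit_trans[of x s y] orbit_swap[of x s y] unfolding reaches_iff_orbit by auto

lemma reaches_imp_merges: "reaches s x y \<Longrightarrow> merges s x y"
  unfolding merges_def using reaches_refl by metis

lemma merges_refl [simp]: "merges s x x"
  by (simp add: reaches_imp_merges)

lemma merges_sym: "merges s x y \<Longrightarrow> merges s y x"
  unfolding merges_def by auto

lemma merges_trans:
  assumes "merges s x y" "merges s y z"
  shows "merges s x z"
proof -
  obtain a b where "reaches s x a" "reaches s y a" "reaches s y b" "reaches s z b"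
    using assms unfolding merges_def by auto
  then show ?thesis unfolding merges_def using reaches_linear reaches_trans by metis
qed

lemma merges_periodic_iff_reaches:
  assumes "periodic s y"
  shows "merges s x y \<longleftrightarrow> reaches s x y"
  unfolding merges_def using reaches_periodic(2)[OF assms] reaches_trans[of s x _ y] reaches_refl by metis

definition absorb :: "'a set \<Rightarrow> ('a \<Rightarrow> 'a) \<Rightarrow> 'a \<Rightarrow> 'a" where
  "absorb A s x = (if x \<in> A then x else s x)"

lemma absorb_cong: "(\<And>x. x \<notin> A \<Longrightarrow> s x = t x) \<Longrightarrow> absorb A s = absorb A t"
  unfolding absorb_def by auto

lemma reaches_absorb_imp_reaches:
  assumes "reaches (absorb A s) x y"
  shows "reaches s x y"
proof -
  have "reaches s x ((absorb A s ^^ n) x)" for n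
  proof (induction n)
    case (Suc n)
    have "reaches s z (absorb A s z)" for z unfolding absorb_def by simp
    then show ?case using Suc reaches_trans by (metis comp_apply funpow.simps(2))
  qed simp
  then show ?thesis using assms unfolding reaches_def[of "absorb A s"] by auto
qed

lemma reaches_imp_ex_reaches_absorb:
  assumes "reaches s x u" "u \<in> A"
  shows "\<exists>a\<in>A. reaches (absorb A s) x a"
proof -
  have "\<exists>a\<in>A. reaches (absorb A s) x a" if "(s ^^ n) x = u" for n
    using that
  proof (induction n arbitrary: x)
    case 0
    then show ?case using assms(2) by (intro bexI[of _ u]) auto
  next
    case (Suc n)
    show ?case
    proof (cases "x \<in> A")
      case False
      have "\<exists>a\<in>A. reaches (absorb A s) (s x) a" using Suc by (simp add: funpow_swap1)
      moreover have "absorb A s x = s x" using False by (simp add: absorb_def)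
      ultimately show ?thesis using reaches_unfold[of "absorb A s" x] by metis
    qed (use reaches_refl in metis)
  qed
  then show ?thesis using assms(1) unfolding reaches_def[of s] by blast
qed

lemma reaches_absorb_fixed:
  assumes "reaches (absorb A s) a b" "a \<in> A"
  shows "b = a"
  using reaches_closed[OF assms(1), of "{a}"] assms(2) by (simp add: absorb_def)

lemma reaches_absorb_unique:
  assumes "reaches (absorb A s) x a" "reaches (absorb A s) x b" "a \<in> A" "b \<in> A"
  shows "a = b"
  using reaches_linear[OF assms(1,2)] reaches_absorb_fixed assms(3,4) by metis

lemma reaches_absorb_return:
  assumes "reaches (absorb A s) (s a) a" "a \<in> A" "reaches s a b" "b \<in> A"
  shows "b = a"
proof -
  have step: "reaches (absorb A s) (s x) a" if "reaches (absorb A s) x a" for x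
  proof (cases "x \<in> A")
    case True
    then show ?thesis using that assms(1) reaches_absorb_fixed[of A s x a] by simp
  next
    case False
    then have "absorb A s x = s x" "x \<noteq> a" using assms(2) by (auto simp: absorb_def)
    then show ?thesis using that reaches_unfold[of "absorb A s" x a] by simp
  qed
  have "b \<in> {x. reaches (absorb A s) x a}"
    by (rule reaches_closed[OF assms(3)]) (use step in auto)
  then show ?thesis using reaches_absorb_fixed[of A s b a] assms(4) by simp
qed

definition on_unique_cycle :: "'a set \<Rightarrow> ('a \<Rightarrow> 'a) \<Rightarrow> 'a \<Rightarrow> 'a \<Rightarrow> bool" where
  "on_unique_cycle S s u v \<longleftrightarrow> (\<forall>x\<in>S. reaches s x u \<and> reaches s x v)"

definition on_two_cycles :: "'a set \<Rightarrow> ('a \<Rightarrow> 'a) \<Rightarrow> 'a \<Rightarrow> 'a \<Rightarrow> bool" where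
  "on_two_cycles S s u v \<longleftrightarrow> periodic s u \<and> periodic s v \<and> \<not> reaches s u v \<and> \<not> reaches s v u \<and>
     (\<forall>x\<in>S. reaches s x u \<or> reaches s x v)"

lemma not_on_two_cycles_refl: "\<not> on_two_cycles S s u u"
  unfolding on_two_cycles_def by simp

lemma on_unique_cycle_refl_iff_absorb:
  "on_unique_cycle S s u u \<longleftrightarrow> (\<forall>x\<in>S. reaches (absorb {u} s) x u)"
  unfolding on_unique_cycle_def
  using reaches_absorb_imp_reaches reaches_imp_ex_reaches_absorb by fast

lemma on_unique_cycle_iff_absorb:
  assumes "u \<in> S" "v \<in> S" "u \<noteq> v" "s \<in> S \<rightarrow> S"
  defines "r \<equiv> reaches (absorb {u, v} s)"
  shows "on_unique_cycle S s u v \<longleftrightarrow> (\<forall>x\<in>S. r x u \<or> r x v) \<and> r (s u) v \<and> r (s v) u"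
proof
  assume cycle: "on_unique_cycle S s u v"
  then have reach: "reaches s x u" "reaches s x v" if "x \<in> S" for x
    using that unfolding on_unique_cycle_def by auto
  then have absorbed: "\<forall>x\<in>S. r x u \<or> r x v"
    using reaches_imp_ex_reaches_absorb[of s _ u "{u, v}"] unfolding r_def by fast
  have "\<not> r (s u) u" "\<not> r (s v) v"
    using reaches_absorb_return[of "{u, v}" s u v] reaches_absorb_return[of "{u, v}" s v u]
      reach assms(1-3) unfolding r_def by auto
  then show "(\<forall>x\<in>S. r x u \<or> r x v) \<and> r (s u) v \<and> r (s v) u"
    using absorbed assms(1,2) funcset_mem[OF assms(4)] by blast
next
  assume r: "(\<forall>x\<in>S. r x u \<or> r x v) \<and> r (s u) v \<and> r (s v) u"
  have r_imp: "reaches s x y" if "r x y" for x y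
    using that reaches_absorb_imp_reaches unfolding r_def by metis
  then have "reaches s u v" "reaches s v u"
    using r reaches_unfold[of s u v] reaches_unfold[of s v u] by blast+
  moreover have "reaches s x u \<or> reaches s x v" if "x \<in> S" for x
    using that r r_imp by blast
  ultimately show "on_unique_cycle S s u v"
    unfolding on_unique_cycle_def using reaches_trans[of s _ u v] reaches_trans[of s _ v u] by blast
qed

lemma on_two_cycles_iff_absorb:
  assumes "u \<in> S" "v \<in> S" "u \<noteq> v" "s \<in> S \<rightarrow> S"
  defines "r \<equiv> reaches (absorb {u, v} s)"
  shows "on_two_cycles S s u v \<longleftrightarrow> (\<forall>x\<in>S. r x u \<or> r x v) \<and> r (s u) u \<and> r (s v) v"
proof
  assume cycles: "on_two_cycles S s u v"
  then have absorbed: "r x u \<or> r x v" if "x \<in> S" for x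
    using that reaches_imp_ex_reaches_absorb[of s x _ "{u, v}"]
    unfolding r_def on_two_cycles_def by fast
  have "\<not> r (s u) v" "\<not> r (s v) u"
    using cycles reaches_absorb_imp_reaches[of "{u, v}" s] reaches_unfold[of s u v] reaches_unfold[of s v u]
    unfolding r_def on_two_cycles_def by blast+
  then show "(\<forall>x\<in>S. r x u \<or> r x v) \<and> r (s u) u \<and> r (s v) v"
    using absorbed assms(1,2) funcset_mem[OF assms(4)] by blast
next
  assume r: "(\<forall>x\<in>S. r x u \<or> r x v) \<and> r (s u) u \<and> r (s v) v"
  then have "\<not> reaches s u v" "\<not> reaches s v u"
    using reaches_absorb_return[of "{u, v}" s u v] reaches_absorb_return[of "{u, v}" s v u] assms(3)
    unfolding r_def by auto
  then show "on_two_cycles S s u v"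
    unfolding on_two_cycles_def in_orbit_iff_reaches
    using r reaches_absorb_imp_reaches[of "{u, v}" s] unfolding r_def by blast
qed

lemma of_bool_unique_minus_two_cycles:
  assumes "u \<in> S" "v \<in> S" "u \<noteq> v" "s \<in> S \<rightarrow> S"
  defines "r \<equiv> reaches (absorb {u, v} s)"
  shows "(of_bool (on_unique_cycle S s u v) - of_bool (on_two_cycles S s u v) :: real) =
    of_bool (\<forall>x\<in>S. r x u \<or> r x v) * (of_bool (r (s u) v) + of_bool (r (s v) u) - 1)"
proof -
  have "\<not> (r x u \<and> r x v)" for x
    using reaches_absorb_unique[of "{u, v}" s x u v] assms(3) unfolding r_def by blast
  then have "r (s u) u \<longleftrightarrow> \<not> r (s u) v" "r (s v) v \<longleftrightarrow> \<not> r (s v) u" if "\<forall>x\<in>S. r x u \<or> r x v"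
    using that assms(1,2) funcset_mem[OF assms(4)] by blast+
  then show ?thesis
    using on_unique_cycle_iff_absorb[OF assms(1-4), folded r_def]
      on_two_cycles_iff_absorb[OF assms(1-4), folded r_def]
    by (cases "\<forall>x\<in>S. r x u \<or> r x v") simp_all
qed

section \<open>Components and cycles of functional digraphs\<close>

lemma (in wf_digraph) with_proj_mk_symmetric_induce_subgraph:
  "with_proj (mk_symmetric (G \<restriction> C)) = with_proj (mk_symmetric G) \<restriction> C"
  by (rule pre_digraph.equality) (auto simp: parcs_mk_symmetric)

lemma (in wf_digraph) reachable_mk_symmetric_if_connected_subgraph:
  assumes "subgraph H G" "Digraph_Component.connected H" "x \<in> verts H" "y \<in> verts H"
  shows "x \<rightarrow>\<^sup>*\<^bsub>mk_symmetric G\<^esub> y"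
proof -
  have "x \<rightarrow>\<^sup>*\<^bsub>mk_symmetric H\<^esub> y"
    using assms(2-4) unfolding Digraph_Component.connected_def by auto
  then show ?thesis
    using subgraph_mk_symmetric[OF assms(1)] by (rule pre_digraph.reachable_mono)
qed

lemma (in wf_digraph) symmetric_scc_induces_connected_subgraph:
  assumes "C \<in> pre_digraph.sccs_verts (mk_symmetric G)"
  shows "subgraph (G \<restriction> C) G" "Digraph_Component.connected (G \<restriction> C)"
proof -
  interpret sym: wf_digraph "with_proj (mk_symmetric G)"
    using wellformed_mk_symmetric wf_digraph_wp_iff by blast
  show "subgraph (G \<restriction> C) G"
    using sym.sccs_verts_subsets[OF assms] by (intro subgraph_induce_subgraphI) simp
  show "Digraph_Component.connected (G \<restriction> C)"
    unfolding Digraph_Component.connected_def with_proj_mk_symmetric_induce_subgraph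
    using sym.in_verts_sccsD_sccs[OF assms] by auto
qed

lemma (in wf_digraph) induce_subgraph_symmetric_scc_in_components:
  assumes C: "C \<in> pre_digraph.sccs_verts (mk_symmetric G)"
  shows "G \<restriction> C \<in> components G"
proof -
  have "H = G \<restriction> C"
    if H: "subgraph (G \<restriction> C) H" "subgraph H G" "Digraph_Component.connected H" for H
  proof -
    have "C \<subseteq> verts H" "C \<noteq> {}" using H(1) C by (auto simp: subgraph_def pre_digraph.sccs_verts_def)
    then have "verts H = C"
      using reachable_mk_symmetric_if_connected_subgraph[OF H(2,3)] C
      unfolding pre_digraph.sccs_verts_def by blast
    then show ?thesis
      using H(1,2) by (intro pre_digraph.equality) (auto simp: subgraph_def compatible_def wf_digraph_def)
  qed
  then show ?thesis
    unfolding components_def max_subgraph_def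
    using symmetric_scc_induces_connected_subgraph[OF C] by blast
qed

lemma (in wf_digraph) components_conv_sccs_verts:
  "components G = induce_subgraph G ` pre_digraph.sccs_verts (mk_symmetric G)"
proof
  interpret sym: wf_digraph "with_proj (mk_symmetric G)"
    using wellformed_mk_symmetric wf_digraph_wp_iff by blast
  show "components G \<subseteq> induce_subgraph G ` sym.sccs_verts"
  proof
    fix H assume "H \<in> components G"
    then have H: "subgraph H G" "Digraph_Component.connected H"
      and max: "\<And>H'. subgraph H H' \<Longrightarrow> subgraph H' G \<Longrightarrow> Digraph_Component.connected H' \<Longrightarrow> H' = H"
      unfolding components_def max_subgraph_def by auto
    obtain x where x: "x \<in> verts H"
      using H(2) unfolding Digraph_Component.connected_def strongly_connected_def by auto
    let ?C = "sym.scc_of x"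
    have C: "?C \<in> sym.sccs_verts"
      using x H(1) by (intro sym.scc_of_in_sccs_verts) (auto simp: subgraph_def)
    have "verts H \<subseteq> ?C"
      using reachable_mk_symmetric_if_connected_subgraph[OF H] x unfolding sym.scc_of_def by auto
    then have "subgraph H (G \<restriction> ?C)"
      using H(1) wellformed_induce_subgraph[of ?C] by (auto simp: subgraph_def compatible_def wf_digraph_def)
    then have "G \<restriction> ?C = H" using max symmetric_scc_induces_connected_subgraph[OF C] by blast
    then show "H \<in> induce_subgraph G ` sym.sccs_verts" using C by auto
  qed
qed (use induce_subgraph_symmetric_scc_in_components in blast)

definition arc_choices :: "('a, 'e) pre_digraph \<Rightarrow> ('a \<Rightarrow> 'e) set" where
  "arc_choices F = (\<Pi>\<^sub>E v\<in>verts F. out_arcs F v)"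

definition choice_digraph :: "('a, 'e) pre_digraph \<Rightarrow> ('a \<Rightarrow> 'e) \<Rightarrow> ('a, 'e) pre_digraph" where
  "choice_digraph F f = F\<lparr>arcs := f ` verts F\<rparr>"

lemma choice_digraph_simps [simp]:
  "verts (choice_digraph F f) = verts F" "arcs (choice_digraph F f) = f ` verts F"
  "tail (choice_digraph F f) = tail F" "head (choice_digraph F f) = head F"
  unfolding choice_digraph_def by simp_all

definition choice_succ :: "('a, 'e) pre_digraph \<Rightarrow> ('a \<Rightarrow> 'e) \<Rightarrow> 'a \<Rightarrow> 'a" where
  "choice_succ F f v = head F (f v)"

locale arc_choice = fin_digraph F for F :: "('a, 'e) pre_digraph" +
  fixes f :: "'a \<Rightarrow> 'e"
  assumes choice: "f \<in> arc_choices F"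
begin

abbreviation (input) D where "D \<equiv> choice_digraph F f"

abbreviation (input) succ where "succ \<equiv> choice_succ F f"

lemma choice_arc: "v \<in> verts F \<Longrightarrow> f v \<in> arcs F"
  and tail_choice [simp]: "v \<in> verts F \<Longrightarrow> tail F (f v) = v"
  using choice by (auto simp: arc_choices_def PiE_iff)

lemma head_choice [simp]: "head F (f v) = succ v"
  unfolding choice_succ_def ..

lemma succ_closed: "succ \<in> verts F \<rightarrow> verts F"
  using choice_arc by (simp add: choice_succ_def del: head_choice)

lemma funpow_succ_in_verts: "x \<in> verts F \<Longrightarrow> (succ ^^ n) x \<in> verts F"
  by (rule reaches_closed[OF reaches_funpow]) (use succ_closed in auto)

lemma inj_on_choice: "inj_on f (verts F)"
  by (rule inj_on_inverseI[of _ "tail F"]) simp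

sublocale D: wf_digraph D
  by unfold_locales (auto simp: choice_arc simp del: head_choice)

lemma spanning_choice_digraph: "spanning D F"
  unfolding spanning_def using D.wf_digraph_axioms wf_digraph_axioms
  by (auto simp: subgraph_def compatible_def choice_arc)

lemma functional_choice_digraph: "functional_digraph D"
proof -
  have "out_arcs D v = {f v}" if "v \<in> verts F" for v
    using that by (auto simp: out_arcs_def)
  then show ?thesis
    unfolding functional_digraph_def out_degree_def by (auto intro!: D.fin_digraphI)
qed

lemma reachable_mk_symmetric_iff_merges:
  assumes "x \<in> verts F" "y \<in> verts F"
  shows "x \<rightarrow>\<^sup>*\<^bsub>mk_symmetric D\<^esub> y \<longleftrightarrow> merges succ x y"
proof
  assume "x \<rightarrow>\<^sup>*\<^bsub>mk_symmetric D\<^esub> y"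
  then show "merges succ x y" unfolding reachable_def
  proof (induction rule: rtrancl_on_induct)
    case (step y z)
    then obtain v where "(y, z) = (v, succ v) \<or> (y, z) = (succ v, v)"
      by (auto simp: parcs_mk_symmetric)
    then have "merges succ y z" using reaches_imp_merges[OF reaches_step] merges_sym by fastforce
    then show ?case using step merges_trans by metis
  qed simp
next
  interpret sym: wf_digraph "with_proj (mk_symmetric D)"
    using D.wellformed_mk_symmetric wf_digraph_wp_iff by blast
  have reach: "x \<rightarrow>\<^sup>*\<^bsub>mk_symmetric D\<^esub> (succ ^^ n) x" if "x \<in> verts F" for x n
  proof (induction n)
    case (Suc n)
    have "f ((succ ^^ n) x) \<in> arcs D" using funpow_succ_in_verts[OF that] by simp
    then have "(succ ^^ n) x \<rightarrow>\<^bsub>mk_symmetric D\<^esub> succ ((succ ^^ n) x)"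
      using funpow_succ_in_verts[OF that] by (force simp: parcs_mk_symmetric)
    with Suc have "x \<rightarrow>\<^sup>*\<^bsub>mk_symmetric D\<^esub> succ ((succ ^^ n) x)" by (rule sym.reachable_adj_trans)
    then show ?case by simp
  qed (use that in simp)
  assume "merges succ x y"
  then obtain m n where "(succ ^^ m) x = (succ ^^ n) y" unfolding merges_def reaches_def by metis
  then have "y \<rightarrow>\<^sup>*\<^bsub>mk_symmetric D\<^esub> (succ ^^ m) x" using reach[OF assms(2), of n] by simp
  with symmetric_mk_symmetric have "(succ ^^ m) x \<rightarrow>\<^sup>*\<^bsub>mk_symmetric D\<^esub> y" by (rule symmetric_reachable)
  with reach[OF assms(1)] show "x \<rightarrow>\<^sup>*\<^bsub>mk_symmetric D\<^esub> y" by (rule sym.reachable_trans)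
qed

definition merge_rel :: "('a \<times> 'a) set" where
  "merge_rel = {(x, y). x \<in> verts F \<and> y \<in> verts F \<and> merges succ x y}"

lemma equiv_merge_rel: "equiv (verts F) merge_rel"
proof (rule equivI)
  show "sym merge_rel" unfolding merge_rel_def by (rule symI) (simp add: merges_sym)
  show "trans merge_rel" unfolding merge_rel_def using merges_trans[of succ] by (intro transI) blast
qed (auto simp: merge_rel_def refl_on_def)

lemma card_components_choice_digraph: "card (components D) = card (verts F // merge_rel)"
proof -
  interpret sym: wf_digraph "with_proj (mk_symmetric D)"
    using D.wellformed_mk_symmetric wf_digraph_wp_iff by blast
  have "sym.scc_of x = merge_rel `` {x}" if x: "x \<in> verts F" for x
  proof -
    have "y \<in> verts F" if "x \<rightarrow>\<^sup>*\<^bsub>mk_symmetric D\<^esub> y" for y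
      using sym.reachable_in_verts(2)[OF that] by simp
    then show ?thesis
      using reachable_mk_symmetric_iff_merges[OF x] reachable_mk_symmetric_iff_merges[OF _ x]
        merges_sym[of succ] x
      unfolding sym.scc_of_def merge_rel_def by blast
  qed
  then have "sym.sccs_verts = verts F // merge_rel"
    unfolding sym.sccs_verts_conv_scc_of quotient_def by auto
  moreover have "inj_on (induce_subgraph D) (verts F // merge_rel)"
    by (rule inj_on_inverseI[of _ verts]) simp
  ultimately show ?thesis
    unfolding D.components_conv_sccs_verts by (simp add: card_image)
qed

definition orbit_walk :: "'a \<Rightarrow> nat \<Rightarrow> 'e list" where
  "orbit_walk x n = map (\<lambda>i. f ((succ ^^ i) x)) [0..<n]"

lemma awalk_imp_orbit_walk:
  assumes "D.awalk x w y"
  shows "w = orbit_walk x (length w) \<and> y = (succ ^^ length w) x"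
  using assms
proof (induction w arbitrary: x)
  case Nil
  then show ?case by (simp add: D.awalk_Nil_iff orbit_walk_def)
next
  case (Cons e w)
  have e: "e = f x" and w: "D.awalk (succ x) w y"
    using Cons.prems by (auto simp: D.awalk_Cons_iff)
  have "e # orbit_walk (succ x) (length w) = map (\<lambda>i. f ((succ ^^ i) x)) (0 # map Suc [0..<length w])"
    using e unfolding orbit_walk_def by (simp add: funpow_swap1)
  also have "0 # map Suc [0..<length w] = [0..<length (e # w)]"
    using upt_conv_Cons[of 0 "Suc (length w)"] by (simp add: map_Suc_upt del: upt_Suc)
  finally show ?case using Cons.IH[OF w] by (simp add: orbit_walk_def funpow_swap1)
qed

lemma awalk_orbit_walk:
  assumes "x \<in> verts F"
  shows "D.awalk x (orbit_walk x n) ((succ ^^ n) x)"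
proof (induction n)
  case 0
  then show ?case using assms by (simp add: orbit_walk_def D.awalk_Nil_iff)
next
  case (Suc n)
  let ?y = "(succ ^^ n) x"
  have "?y \<in> verts F" "succ ?y \<in> verts F"
    using funpow_succ_in_verts[OF assms, of "Suc n"] funpow_succ_in_verts[OF assms] by simp_all
  then have "D.awalk ?y [f ?y] (succ ?y)" by (simp add: D.awalk_simps)
  with Suc have "D.awalk x (orbit_walk x n @ [f ?y]) (succ ?y)" by (rule D.awalk_appendI)
  then show ?case by (simp add: orbit_walk_def)
qed

lemma set_orbit_walk:
  assumes "(succ ^^ n) x = x" "0 < n"
  shows "set (orbit_walk x n) = f ` orbit succ x"
  unfolding orbit_altdef_bounded[OF assms] orbit_walk_def by (force simp: image_iff)

lemma cycle_orbit_walk: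
  assumes "u \<in> verts F" "periodic succ u"
  shows "D.cycle (orbit_walk u (funpow_dist1 succ u u))"
proof -
  define n where "n = funpow_dist1 succ u u"
  have return: "(succ ^^ n) u = u" and "0 < n"
    using funpow_dist1_prop[OF assms(2)] unfolding n_def by simp_all
  have walk: "D.awalk u (orbit_walk u n) u" using awalk_orbit_walk[OF assms(1), of n] return by simp
  then have "tl (D.awalk_verts u (orbit_walk u n)) = map (head D) (orbit_walk u n)"
    using \<open>0 < n\<close> by (auto simp: D.awalk_verts_conv' D.awalk_def orbit_walk_def)
  also have "\<dots> = map (\<lambda>i. (succ ^^ i) (succ u)) [0..<n]"
    by (simp add: orbit_walk_def funpow_swap1)
  finally have verts: "tl (D.awalk_verts u (orbit_walk u n)) = \<dots>" .
  have "(\<lambda>i. (succ ^^ i) (succ u)) ` {0..<n} = orbit succ (succ u)"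
    using return \<open>0 < n\<close> by (subst orbit_altdef_bounded[of n]) (auto simp: funpow_swap1[symmetric])
  also have "\<dots> = (\<lambda>i. (succ ^^ i) u) ` {0..<n}"
    unfolding self_in_orbit_step[OF assms(2)] n_def by (rule orbit_conv_funpow_dist1[OF assms(2)])
  also have "card \<dots> = n"
    using inj_on_funpow_dist1[OF assms(2)] unfolding n_def[symmetric] by (simp add: card_image)
  finally have "distinct (map (\<lambda>i. (succ ^^ i) (succ u)) [0..<n])"
    by (intro card_distinct) simp
  then show ?thesis
    unfolding D.cycle_def n_def[symmetric] verts[symmetric] using walk \<open>0 < n\<close>
    by (intro exI[of _ u]) (simp add: orbit_walk_def)
qed

lemma cycles_choice_digraph:
  "cycles D = (\<lambda>u. f ` orbit succ u) ` (verts F \<inter> {u. periodic succ u})"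
proof
  show "cycles D \<subseteq> (\<lambda>u. f ` orbit succ u) ` (verts F \<inter> {u. periodic succ u})"
  proof
    fix C assume "C \<in> cycles D"
    then obtain w x where w: "C = set w" "D.awalk x w x" "w \<noteq> []"
      unfolding cycles_def D.cycle_def by auto
    have return: "(succ ^^ length w) x = x" "0 < length w" and set: "C = set (orbit_walk x (length w))"
      using awalk_imp_orbit_walk[OF w(2)] w(1,3) by auto
    have "x \<in> verts F" using D.awalk_hd_in_verts[OF w(2)] by simp
    moreover have "periodic succ x" unfolding orbit_altdef mem_Collect_eq using return by metis
    ultimately show "C \<in> (\<lambda>u. f ` orbit succ u) ` (verts F \<inter> {u. periodic succ u})"
      unfolding set set_orbit_walk[OF return] by blast
  qed
  show "(\<lambda>u. f ` orbit succ u) ` (verts F \<inter> {u. periodic succ u}) \<subseteq> cycles D"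
  proof clarify
    fix u assume u: "u \<in> verts F" "periodic succ u"
    have "f ` orbit succ u = set (orbit_walk u (funpow_dist1 succ u u))"
      by (rule set_orbit_walk[symmetric, OF funpow_dist1_prop[OF u(2)]]) simp
    then show "f ` orbit succ u \<in> cycles D" unfolding cycles_def using cycle_orbit_walk[OF u] by blast
  qed
qed

lemma orbit_succ_subset: "u \<in> verts F \<Longrightarrow> orbit succ u \<subseteq> verts F"
  using funpow_succ_in_verts unfolding orbit_altdef by auto

lemma orbit_succ_eq:
  assumes "periodic succ u" "v \<in> orbit succ u"
  shows "orbit succ v = orbit succ u"
  using assms orbit_cyclic_eq3[of succ "orbit succ u" v] cyclic_on_def by metis

lemma sum_cycles_choice_digraph:
  fixes \<phi> :: "'e \<Rightarrow> real"
  shows "(\<Sum>C\<in>cycles D. \<Sum>e\<in>C. \<phi> e) = (\<Sum>u\<in>verts F. of_bool (periodic succ u) * \<phi> (f u))"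
proof -
  let ?V = "verts F \<inter> {u. periodic succ u}"
  have "\<Union> (cycles D) = f ` ?V"
    unfolding cycles_choice_digraph using orbit_succ_subset self_in_orbit_trans by fast
  moreover have "A \<inter> B = {}" if AB: "A \<in> cycles D" "B \<in> cycles D" "A \<noteq> B" for A B
  proof -
    obtain a b where ab: "A = f ` orbit succ a" "B = f ` orbit succ b"
      "a \<in> verts F" "periodic succ a" "b \<in> verts F" "periodic succ b"
      using AB(1,2) unfolding cycles_choice_digraph by auto
    then have "orbit succ a \<inter> orbit succ b = {}"
      using AB(3) orbit_succ_eq[of a] orbit_succ_eq[of b] by blast
    then show ?thesis
      unfolding ab using inj_on_image_Int[OF inj_on_choice orbit_succ_subset orbit_succ_subset] ab by blast
  qed
  moreover have "\<forall>A\<in>cycles D. finite A"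
    unfolding cycles_choice_digraph by (auto intro: finite_orbit)
  ultimately have "(\<Sum>C\<in>cycles D. \<Sum>e\<in>C. \<phi> e) = sum \<phi> (f ` ?V)"
    using sum.Union_disjoint[of "cycles D" \<phi>] by simp
  also have "\<dots> = (\<Sum>u\<in>?V. \<phi> (f u))"
    by (rule sum.reindex[unfolded comp_def]) (rule inj_on_subset[OF inj_on_choice], simp)
  finally show ?thesis by simp
qed

lemma sum_cycles_mult:
  fixes g h :: "'e \<Rightarrow> real"
  shows "(\<Sum>C\<in>cycles D. (\<Sum>e\<in>C. g e) * (\<Sum>e\<in>C. h e)) =
    (\<Sum>u\<in>verts F. \<Sum>v\<in>verts F. of_bool (periodic succ u \<and> v \<in> orbit succ u) * (g (f u) * h (f v)))"
proof -
  let ?H = "\<lambda>u. \<Sum>v\<in>orbit succ u. h (f v)"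
  have sum_h: "(\<Sum>e\<in>f ` orbit succ u. h e) = ?H u" if "u \<in> verts F" for u
    by (rule sum.reindex[unfolded comp_def]) (rule inj_on_subset[OF inj_on_choice orbit_succ_subset[OF that]])
  have "(\<Sum>e\<in>C. g e) * (\<Sum>e\<in>C. h e) = (\<Sum>e\<in>C. g e * ?H (tail F e))" if cycle: "C \<in> cycles D" for C
  proof -
    obtain u where u: "u \<in> verts F" "periodic succ u" and C: "C = f ` orbit succ u"
      using cycle unfolding cycles_choice_digraph by auto
    have "tail F e \<in> orbit succ u" if "e \<in> C" for e
      using that orbit_succ_subset[OF u(1)] unfolding C by auto
    then show ?thesis
      unfolding sum_distrib_right by (intro sum.cong refl) (simp add: C sum_h[OF u(1)] orbit_succ_eq[OF u(2)])
  qed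
  then have "(\<Sum>C\<in>cycles D. (\<Sum>e\<in>C. g e) * (\<Sum>e\<in>C. h e)) =
      (\<Sum>u\<in>verts F. of_bool (periodic succ u) * (g (f u) * ?H u))"
    by (simp add: sum_cycles_choice_digraph)
  also have "\<dots> = (\<Sum>u\<in>verts F. of_bool (periodic succ u) *
      (g (f u) * (\<Sum>v\<in>verts F. of_bool (v \<in> orbit succ u) * h (f v))))"
    by (intro sum.cong refl) (simp add: Int_absorb1 orbit_succ_subset)
  also have "\<dots> = (\<Sum>u\<in>verts F. \<Sum>v\<in>verts F.
      of_bool (periodic succ u \<and> v \<in> orbit succ u) * (g (f u) * h (f v)))"
    unfolding sum_distrib_left by (intro sum.cong refl) simp
  finally show ?thesis .
qed

lemma sum_distinct_cycles_mult:
  fixes g h :: "'e \<Rightarrow> real"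
  shows "(\<Sum>C1\<in>cycles D. \<Sum>C2\<in>cycles D - {C1}. (\<Sum>e\<in>C1. g e) * (\<Sum>e\<in>C2. h e)) =
    (\<Sum>u\<in>verts F. \<Sum>v\<in>verts F. of_bool (periodic succ u \<and> periodic succ v \<and> v \<notin> orbit succ u) *
      (g (f u) * h (f v)))"
proof -
  have "finite (cycles D)" unfolding cycles_choice_digraph by simp
  then have "(\<Sum>C1\<in>cycles D. \<Sum>C2\<in>cycles D - {C1}. (\<Sum>e\<in>C1. g e) * (\<Sum>e\<in>C2. h e)) =
      (\<Sum>C\<in>cycles D. \<Sum>e\<in>C. g e) * (\<Sum>C\<in>cycles D. \<Sum>e\<in>C. h e) -
      (\<Sum>C\<in>cycles D. (\<Sum>e\<in>C. g e) * (\<Sum>e\<in>C. h e))"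
    by (simp add: sum_diff1 sum_subtractf sum_product)
  also have "\<dots> = (\<Sum>u\<in>verts F. \<Sum>v\<in>verts F.
      of_bool (periodic succ u) * g (f u) * (of_bool (periodic succ v) * h (f v)) -
      of_bool (periodic succ u \<and> v \<in> orbit succ u) * (g (f u) * h (f v)))"
    unfolding sum_cycles_mult unfolding sum_cycles_choice_digraph sum_product sum_subtractf ..
  also have "\<dots> = (\<Sum>u\<in>verts F. \<Sum>v\<in>verts F.
      of_bool (periodic succ u \<and> periodic succ v \<and> v \<notin> orbit succ u) * (g (f u) * h (f v)))"
    using self_in_orbit_trans[of _ succ] by (intro sum.cong refl) auto
  finally show ?thesis .
qed

end

lemma card_quotient_eq_1_iff:
  assumes "equiv A r" "u \<in> A"
  shows "card (A // r) = 1 \<longleftrightarrow> (\<forall>x\<in>A. (x, u) \<in> r)"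
proof
  assume "card (A // r) = 1"
  then obtain X where "A // r = {X}" by (rule card_1_singletonE)
  then have "r `` {x} = r `` {u}" if "x \<in> A" for x
    using that assms(2) quotientI[of _ A r] by (metis singletonD)
  then show "\<forall>x\<in>A. (x, u) \<in> r" using assms eq_equiv_class_iff by metis
next
  assume "\<forall>x\<in>A. (x, u) \<in> r"
  then have "A // r = {r `` {u}}"
    using assms(2) equiv_class_eq[OF assms(1)] unfolding quotient_def by blast
  then show "card (A // r) = 1" by simp
qed

lemma card_quotient_eq_2_iff:
  assumes "equiv A r" "u \<in> A" "v \<in> A" "(u, v) \<notin> r"
  shows "card (A // r) = 2 \<longleftrightarrow> (\<forall>x\<in>A. (x, u) \<in> r \<or> (x, v) \<in> r)"
proof -
  have distinct: "r `` {u} \<noteq> r `` {v}" using assms eq_equiv_class_iff by metis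
  show ?thesis
  proof
    assume "card (A // r) = 2"
    then have two: "A // r = {r `` {u}, r `` {v}}"
      using distinct assms(2,3)
      by (intro card_subset_eq[symmetric] card_ge_0_finite) (auto intro: quotientI)
    have "r `` {x} = r `` {u} \<or> r `` {x} = r `` {v}" if "x \<in> A" for x
      using quotientI[OF that, of r] unfolding two by simp
    then show "\<forall>x\<in>A. (x, u) \<in> r \<or> (x, v) \<in> r" using assms(1-3) eq_equiv_class_iff by metis
  next
    assume "\<forall>x\<in>A. (x, u) \<in> r \<or> (x, v) \<in> r"
    then have "A // r = {r `` {u}, r `` {v}}"
      using assms(2,3) equiv_class_eq[OF assms(1)] unfolding quotient_def by blast
    then show "card (A // r) = 2" using distinct by simp
  qed
qed

context arc_choice
begin

lemma unique_component_iff_on_unique_cycle: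
  assumes "u \<in> verts F" "v \<in> verts F"
  shows "card (components D) = 1 \<and> periodic succ u \<and> v \<in> orbit succ u \<longleftrightarrow>
    on_unique_cycle (verts F) succ u v"
proof -
  have "card (components D) = 1 \<longleftrightarrow> (\<forall>x\<in>verts F. merges succ x u)"
    unfolding card_components_choice_digraph card_quotient_eq_1_iff[OF equiv_merge_rel assms(1)]
    using assms(1) by (simp add: merge_rel_def)
  then have "card (components D) = 1 \<longleftrightarrow> (\<forall>x\<in>verts F. reaches succ x u)" if "periodic succ u"
    using merges_periodic_iff_reaches[OF that] by simp
  moreover have "periodic succ u \<and> v \<in> orbit succ u" if "on_unique_cycle (verts F) succ u v"
    using that funcset_mem[OF succ_closed assms(1)] unfolding on_unique_cycle_def in_orbit_iff_reaches by blast
  moreover have "reaches succ x v" if "reaches succ x u" "v \<in> orbit succ u" for x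
    using that reaches_trans[of succ x u v] unfolding reaches_iff_orbit[of succ u] by blast
  ultimately show ?thesis unfolding on_unique_cycle_def by blast
qed

lemma two_components_iff_on_two_cycles:
  assumes "u \<in> verts F" "v \<in> verts F"
  shows "card (components D) = 2 \<and> periodic succ u \<and> periodic succ v \<and> v \<notin> orbit succ u \<longleftrightarrow>
    on_two_cycles (verts F) succ u v"
proof (cases "periodic succ u \<and> periodic succ v \<and> v \<notin> orbit succ u")
  case True
  then have not_reaches: "\<not> reaches succ u v" "\<not> reaches succ v u"
    using orbit_swap[of v succ u] unfolding reaches_iff_orbit by auto
  then have "(u, v) \<notin> merge_rel"
    using merges_periodic_iff_reaches[of v succ] True unfolding merge_rel_def by simp
  then have "card (components D) = 2 \<longleftrightarrow> (\<forall>x\<in>verts F. merges succ x u \<or> merges succ x v)"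
    unfolding card_components_choice_digraph using assms
    by (simp add: card_quotient_eq_2_iff[OF equiv_merge_rel assms]) (simp add: merge_rel_def)
  also have "\<dots> \<longleftrightarrow> (\<forall>x\<in>verts F. reaches succ x u \<or> reaches succ x v)"
    using True by (simp add: merges_periodic_iff_reaches)
  finally show ?thesis unfolding on_two_cycles_def using True not_reaches by simp
next
  case False
  then show ?thesis unfolding on_two_cycles_def reaches_iff_orbit by auto
qed

end

section \<open>Sums over spanning functional digraphs\<close>

context fin_digraph
begin

lemma arc_choiceI: "f \<in> arc_choices G \<Longrightarrow> arc_choice G f"
  by unfold_locales

lemma finite_arc_choices [simp]: "finite (arc_choices G)"
  unfolding arc_choices_def by (intro finite_PiE) auto

lemma spanning_functional_imp_choice_digraph:
  assumes "spanning D G" "functional_digraph D"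
  shows "D \<in> choice_digraph G ` arc_choices G"
proof -
  interpret D: fin_digraph D using assms(2) unfolding functional_digraph_def by auto
  have sub: "verts D = verts G" "arcs D \<subseteq> arcs G" "tail D = tail G" "head D = head G"
    using assms(1) by (auto simp: spanning_def subgraph_def compatible_def)
  have "\<forall>v\<in>verts G. \<exists>e. out_arcs D v = {e}"
    using assms(2) sub(1) unfolding functional_digraph_def out_degree_def by (auto simp: card_1_singleton_iff)
  then obtain f where f: "\<And>v. v \<in> verts G \<Longrightarrow> out_arcs D v = {f v}" by metis
  then have f_arc: "f v \<in> arcs D \<and> tail G (f v) = v" if "v \<in> verts G" for v
    using that sub(3) by (metis in_out_arcs_conv singletonI)
  have "arcs D \<subseteq> f ` verts G"
  proof
    fix e assume "e \<in> arcs D"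
    then have "e \<in> out_arcs D (tail D e)" "tail D e \<in> verts G" using sub(1) D.tail_in_verts by auto
    then show "e \<in> f ` verts G" using f by auto
  qed
  then have "D = choice_digraph G (restrict f (verts G))"
    using sub f_arc by (intro pre_digraph.equality) auto
  moreover have "restrict f (verts G) \<in> arc_choices G"
    unfolding arc_choices_def using f_arc sub(2) by (auto simp: subset_iff)
  ultimately show ?thesis by blast
qed

lemma bij_betw_choice_digraph:
  "bij_betw (choice_digraph G) (arc_choices G) {D. spanning D G \<and> functional_digraph D}"
proof (rule bij_betw_imageI)
  show "inj_on (choice_digraph G) (arc_choices G)"
  proof (rule inj_onI)
    fix f g assume fg: "f \<in> arc_choices G" "g \<in> arc_choices G"
      and eq: "choice_digraph G f = choice_digraph G g"
    interpret f: arc_choice G f by (rule arc_choiceI[OF fg(1)])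
    interpret g: arc_choice G g by (rule arc_choiceI[OF fg(2)])
    have image: "f ` verts G = g ` verts G" using arg_cong[OF eq, of arcs] by simp
    show "f = g"
    proof (rule PiE_ext[OF fg[unfolded arc_choices_def]])
      fix v assume v: "v \<in> verts G"
      then obtain w where "w \<in> verts G" "f v = g w" using image by blast
      then show "f v = g v" using f.tail_choice[OF v] g.tail_choice by metis
    qed
  qed
  show "choice_digraph G ` arc_choices G = {D. spanning D G \<and> functional_digraph D}"
    using arc_choice.spanning_choice_digraph[OF arc_choiceI]
      arc_choice.functional_choice_digraph[OF arc_choiceI] spanning_functional_imp_choice_digraph
    by blast
qed

lemma sum_functional_spanning:
  fixes \<phi> :: "('a, 'b) pre_digraph \<Rightarrow> real"
  shows "(\<Sum>D\<in>functional_spanning m G. \<phi> D) =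
    (\<Sum>f\<in>arc_choices G. of_bool (card (components (choice_digraph G f)) = m) * \<phi> (choice_digraph G f))"
proof -
  let ?D = "{D. spanning D G \<and> functional_digraph D}"
  have "finite ?D" using bij_betw_finite[OF bij_betw_choice_digraph] by simp
  moreover have "functional_spanning m G = ?D \<inter> {D. card (components D) = m}"
    unfolding functional_spanning_def by auto
  ultimately have "(\<Sum>D\<in>functional_spanning m G. \<phi> D) = (\<Sum>D\<in>?D. of_bool (card (components D) = m) * \<phi> D)"
    by simp
  then show ?thesis
    by (simp only: sum.reindex_bij_betw[OF bij_betw_choice_digraph, symmetric])
qed

text \<open>Following shortest walks to \<open>r\<close> gives a spanning tree directed towards \<open>r\<close>.\<close>

lemma ex_arc_choice_reaches:
  assumes reach: "\<And>x. x \<in> verts G \<Longrightarrow> x \<rightarrow>\<^sup>* r" and r: "out_arcs G r \<noteq> {}"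
  obtains f where "f \<in> arc_choices G" "\<And>x. x \<in> verts G \<Longrightarrow> reaches (choice_succ G f) x r"
proof -
  define d where "d x = (LEAST n. \<exists>w. awalk x w r \<and> length w = n)" for x
  have closer: "\<exists>e. e \<in> out_arcs G x \<and> (x \<noteq> r \<longrightarrow> d (head G e) < d x)" if x: "x \<in> verts G" for x
  proof (cases "x = r")
    case False
    have "\<exists>n w. awalk x w r \<and> length w = n" using reach[OF x] reachable_awalk by blast
    from LeastI_ex[OF this] obtain w where w: "awalk x w r" "length w = d x"
      unfolding d_def by auto
    then obtain e w' where "w = e # w'" using False by (cases w) (auto simp: awalk_Nil_iff)
    then have "awalk (head G e) w' r" "e \<in> out_arcs G x" "length w' < d x"
      using w by (auto simp: awalk_Cons_iff)
    moreover from this have "d (head G e) \<le> length w'" unfolding d_def by (intro Least_le) blast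
    ultimately show ?thesis by auto
  qed (use r in auto)
  then obtain f where f: "\<And>x. x \<in> verts G \<Longrightarrow> f x \<in> out_arcs G x"
    "\<And>x. x \<in> verts G \<Longrightarrow> x \<noteq> r \<Longrightarrow> d (head G (f x)) < d x" by metis
  let ?f = "restrict f (verts G)"
  have "reaches (choice_succ G ?f) x r" if "x \<in> verts G" for x
    using that
  proof (induction "d x" arbitrary: x rule: less_induct)
    case less
    show ?case
    proof (cases "x = r")
      case False
      have succ: "choice_succ G ?f x = head G (f x)" using less.prems by (simp add: choice_succ_def)
      then have "choice_succ G ?f x \<in> verts G" "d (choice_succ G ?f x) < d x"
        using f less.prems False by auto
      then have "reaches (choice_succ G ?f) (choice_succ G ?f x) r" using less.hyps by blast
      then show ?thesis using reaches_unfold by metis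
    qed simp
  qed
  moreover have "?f \<in> arc_choices G" unfolding arc_choices_def using f(1) by auto
  ultimately show ?thesis using that by blast
qed

end

context arc_choice
begin

lemma sum_cycles_if_unique_component:
  fixes g :: "'e \<Rightarrow> real"
  shows "of_bool (card (components D) = 1) * (\<Sum>C\<in>cycles D. \<Sum>e\<in>C. g e) =
    (\<Sum>u\<in>verts F. of_bool (on_unique_cycle (verts F) succ u u) * g (f u))"
  unfolding sum_cycles_choice_digraph sum_distrib_left
  by (intro sum.cong refl) (auto simp: unique_component_iff_on_unique_cycle[symmetric])

lemma sum_cycles_mult_if_unique_component:
  fixes g h :: "'e \<Rightarrow> real"
  shows "of_bool (card (components D) = 1) * (\<Sum>C\<in>cycles D. (\<Sum>e\<in>C. g e) * (\<Sum>e\<in>C. h e)) =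
    (\<Sum>u\<in>verts F. \<Sum>v\<in>verts F. of_bool (on_unique_cycle (verts F) succ u v) * (g (f u) * h (f v)))"
  unfolding sum_cycles_mult unfolding sum_distrib_left
  by (intro sum.cong refl) (auto simp: unique_component_iff_on_unique_cycle[symmetric])

lemma sum_distinct_cycles_mult_if_two_components:
  fixes g h :: "'e \<Rightarrow> real"
  shows "of_bool (card (components D) = 2) *
      (\<Sum>C1\<in>cycles D. \<Sum>C2\<in>cycles D - {C1}. (\<Sum>e\<in>C1. g e) * (\<Sum>e\<in>C2. h e)) =
    (\<Sum>u\<in>verts F. \<Sum>v\<in>verts F. of_bool (on_two_cycles (verts F) succ u v) * (g (f u) * h (f v)))"
  unfolding sum_distinct_cycles_mult unfolding sum_distrib_left
  by (intro sum.cong refl) (auto simp: two_components_iff_on_two_cycles[symmetric])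

end

locale stochastic_digraph = fin_digraph G for G :: "('a, 'e) pre_digraph" +
  fixes p :: "'e \<Rightarrow> real"
  assumes arc_prob_pos: "\<And>e. e \<in> arcs G \<Longrightarrow> 0 < p e"
    and out_prob_sum: "\<And>v. v \<in> verts G \<Longrightarrow> (\<Sum>e\<in>out_arcs G v. p e) = 1"
begin

lemma out_arcs_nonempty: "v \<in> verts G \<Longrightarrow> out_arcs G v \<noteq> {}"
  using out_prob_sum[of v] by auto

definition arc_mean :: "('e \<Rightarrow> 'b) \<Rightarrow> 'a \<Rightarrow> 'b::real_normed_vector" where
  "arc_mean g x = (\<Sum>e\<in>out_arcs G x. p e *\<^sub>R g e)"

lemma arc_mean_cong: "(\<And>e. e \<in> out_arcs G x \<Longrightarrow> g e = h e) \<Longrightarrow> arc_mean g x = arc_mean h x"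
  unfolding arc_mean_def by (intro sum.cong refl) simp

lemma arc_mean_const: "x \<in> verts G \<Longrightarrow> arc_mean (\<lambda>_. c) x = c"
  unfolding arc_mean_def by (simp add: scaleR_sum_left[symmetric] out_prob_sum)

lemma arc_mean_add: "arc_mean (\<lambda>e. g e + h e) x = arc_mean g x + arc_mean h x"
  unfolding arc_mean_def by (simp add: scaleR_add_right sum.distrib)

lemma arc_mean_diff: "arc_mean (\<lambda>e. g e - h e) x = arc_mean g x - arc_mean h x"
  unfolding arc_mean_def by (simp add: scaleR_diff_right sum_subtractf)

lemma arc_mean_mult_left: "arc_mean (\<lambda>e. c * g e) x = c * arc_mean g x"
  for c :: "'b::real_normed_algebra"
  unfolding arc_mean_def by (simp add: sum_distrib_left)

lemma arc_mean_of_real: "arc_mean (\<lambda>e. complex_of_real (g e)) x = complex_of_real (arc_mean g x)"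
  unfolding arc_mean_def by (simp add: scaleR_conv_of_real)

lemma norm_arc_mean_le:
  assumes "x \<in> verts G" "\<And>e. e \<in> out_arcs G x \<Longrightarrow> norm (g e) \<le> B"
  shows "norm (arc_mean g x) \<le> B"
proof -
  have "norm (arc_mean g x) \<le> (\<Sum>e\<in>out_arcs G x. norm (p e *\<^sub>R g e))"
    unfolding arc_mean_def by (rule norm_sum)
  also have "\<dots> \<le> (\<Sum>e\<in>out_arcs G x. p e * B)"
    using arc_prob_pos assms(2) by (intro sum_mono) (auto simp: less_imp_le intro!: mult_left_mono)
  also have "\<dots> = B" using out_prob_sum[OF assms(1)] by (simp add: sum_distrib_right[symmetric])
  finally show ?thesis .
qed

definition choice_weight :: "('a \<Rightarrow> 'e) \<Rightarrow> real" where
  "choice_weight f = (\<Prod>v\<in>verts G. p (f v))"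

lemma choice_weight_pos: "f \<in> arc_choices G \<Longrightarrow> 0 < choice_weight f"
  unfolding choice_weight_def by (intro prod_pos) (auto simp: arc_choices_def PiE_iff arc_prob_pos)

lemma prod_arcs_choice_digraph:
  assumes "f \<in> arc_choices G"
  shows "(\<Prod>e\<in>arcs (choice_digraph G f). p e) = choice_weight f"
  using arc_choice.inj_on_choice[OF arc_choiceI[OF assms]]
  by (simp add: choice_weight_def prod.reindex)

lemma weighted_sum_functional_spanning:
  "(\<Sum>D\<in>functional_spanning m G. (\<Prod>e\<in>arcs D. p e) * \<phi> D) =
    (\<Sum>f\<in>arc_choices G. choice_weight f *
      (of_bool (card (components (choice_digraph G f)) = m) * \<phi> (choice_digraph G f)))"
  unfolding sum_functional_spanning
  by (intro sum.cong refl) (simp only: prod_arcs_choice_digraph mult.left_commute)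

lemma D1_sum_eq_sum_arc_choices:
  "D1_sum G p g = (\<Sum>f\<in>arc_choices G. choice_weight f *
    (\<Sum>u\<in>verts G. of_bool (on_unique_cycle (verts G) (choice_succ G f) u u) * g (f u)))"
  unfolding D1_sum_def weighted_sum_functional_spanning
  by (intro sum.cong refl) (simp only: arc_choice.sum_cycles_if_unique_component[OF arc_choiceI])

lemma D1_pair_eq_sum_arc_choices:
  "D1_pair G p g h = (\<Sum>f\<in>arc_choices G. choice_weight f * (\<Sum>u\<in>verts G. \<Sum>v\<in>verts G.
    of_bool (on_unique_cycle (verts G) (choice_succ G f) u v) * (g (f u) * h (f v))))"
  unfolding D1_pair_def weighted_sum_functional_spanning
  by (intro sum.cong refl) (simp only: arc_choice.sum_cycles_mult_if_unique_component[OF arc_choiceI])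

lemma D2_pair_eq_sum_arc_choices:
  "D2_pair G p g h = (\<Sum>f\<in>arc_choices G. choice_weight f * (\<Sum>u\<in>verts G. \<Sum>v\<in>verts G.
    of_bool (on_two_cycles (verts G) (choice_succ G f) u v) * (g (f u) * h (f v))))"
  unfolding D2_pair_def weighted_sum_functional_spanning
  by (intro sum.cong refl) (simp only: arc_choice.sum_distinct_cycles_mult_if_two_components[OF arc_choiceI])

lemma D1_sum_linear:
  "D1_sum G p (\<lambda>e. a * g e + b * h e) = a * D1_sum G p g + b * D1_sum G p h"
  unfolding D1_sum_eq_sum_arc_choices sum_distrib_left sum.distrib[symmetric]
  by (intro sum.cong refl) (simp add: algebra_simps)

lemma D1_sum_nonneg:
  assumes "\<And>e. 0 \<le> g e"
  shows "0 \<le> D1_sum G p g"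
  unfolding D1_sum_eq_sum_arc_choices using assms choice_weight_pos
  by (intro sum_nonneg mult_nonneg_nonneg) (auto intro: less_imp_le)

lemma D1_sum_one_pos:
  assumes "strongly_connected G"
  shows "0 < D1_sum G p (\<lambda>_. 1)"
proof -
  obtain r where r: "r \<in> verts G" using assms unfolding strongly_connected_def by auto
  have "x \<rightarrow>\<^sup>*\<^bsub>G\<^esub> r" if "x \<in> verts G" for x using assms that r unfolding strongly_connected_def by auto
  then obtain f where f: "f \<in> arc_choices G" "\<And>x. x \<in> verts G \<Longrightarrow> reaches (choice_succ G f) x r"
    using ex_arc_choice_reaches[OF _ out_arcs_nonempty[OF r]] by blast
  define n where "n f = (\<Sum>u\<in>verts G. of_bool (on_unique_cycle (verts G) (choice_succ G f) u u) * 1 :: real)"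
      for f
  have "1 \<le> n f"
    using f(2) member_le_sum[OF r,
      of "\<lambda>u. of_bool (on_unique_cycle (verts G) (choice_succ G f) u u) * 1 :: real"]
    unfolding n_def by (simp add: on_unique_cycle_def)
  then have "0 < choice_weight f * n f" using choice_weight_pos[OF f(1)] by simp
  also have "\<dots> \<le> (\<Sum>f\<in>arc_choices G. choice_weight f * n f)"
    using choice_weight_pos
    by (intro member_le_sum[OF f(1)]) (auto simp: n_def less_imp_le intro!: mult_nonneg_nonneg sum_nonneg)
  also have "\<dots> = D1_sum G p (\<lambda>_. 1)" unfolding D1_sum_eq_sum_arc_choices n_def ..
  finally show ?thesis .
qed

lemma sum_arc_choices_split:
  assumes "v \<in> verts G"
  shows "(\<Sum>f\<in>arc_choices G. \<phi> f) =
    (\<Sum>e\<in>out_arcs G v. \<Sum>f\<in>(\<Pi>\<^sub>E w\<in>verts G - {v}. out_arcs G w). \<phi> (f(v := e)))"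
proof -
  let ?V = "verts G - {v}"
  have "insert v ?V = verts G" using assms by auto
  then have "arc_choices G = (\<lambda>(e, f). f(v := e)) ` (out_arcs G v \<times> (\<Pi>\<^sub>E w\<in>?V. out_arcs G w))"
    unfolding arc_choices_def using PiE_insert_eq[of v ?V "out_arcs G"] by simp
  moreover have "inj_on (\<lambda>(e, f). f(v := e)) (out_arcs G v \<times> (\<Pi>\<^sub>E w\<in>?V. out_arcs G w))"
    by (rule inj_combinator) simp
  ultimately show ?thesis
    by (simp add: sum.reindex sum.cartesian_product case_prod_unfold)
qed

lemma sum_arc_choices_resample:
  fixes Q :: "('a \<Rightarrow> 'e) \<Rightarrow> real"
  assumes v: "v \<in> verts G" and Q: "\<And>f e. Q (f(v := e)) = Q f"
  shows "(\<Sum>f\<in>arc_choices G. choice_weight f * (Q f * k (f v))) =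
    arc_mean k v * (\<Sum>f\<in>arc_choices G. choice_weight f * Q f)"
proof -
  let ?P = "\<Pi>\<^sub>E w\<in>verts G - {v}. out_arcs G w"
  define W where "W f = (\<Prod>w\<in>verts G - {v}. p (f w))" for f
  have "choice_weight (f(v := e)) = p e * W f" for f e
    unfolding choice_weight_def W_def using prod.remove[OF finite_verts v, of "\<lambda>w. p ((f(v := e)) w)"]
    by (auto intro: prod.cong)
  then have factor: "(\<Sum>f\<in>arc_choices G. choice_weight f * (Q f * k (f v))) =
      arc_mean k v * (\<Sum>f\<in>?P. W f * Q f)" for k
    unfolding sum_arc_choices_split[OF v] arc_mean_def
    by (simp add: Q sum_product algebra_simps)
  show ?thesis using factor[of k] factor[of "\<lambda>_. 1"] by (simp add: arc_mean_const[OF v])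
qed

theorem D1_sum_if_arc_mean_const:
  assumes "\<And>v. v \<in> verts G \<Longrightarrow> arc_mean k v = a"
  shows "D1_sum G p k = a * D1_sum G p (\<lambda>_. 1)"
proof -
  let ?Q = "\<lambda>u f. of_bool (on_unique_cycle (verts G) (choice_succ G f) u u) :: real"
  have Q: "?Q u (f(u := e)) = ?Q u f" for u f e
  proof -
    have "absorb {u} (choice_succ G (f(u := e))) = absorb {u} (choice_succ G f)"
      by (rule absorb_cong) (simp add: choice_succ_def)
    then show ?thesis unfolding on_unique_cycle_refl_iff_absorb by simp
  qed
  have swap: "D1_sum G p k = (\<Sum>u\<in>verts G. \<Sum>f\<in>arc_choices G. choice_weight f * (?Q u f * k (f u)))" for k
    unfolding D1_sum_eq_sum_arc_choices sum_distrib_left by (rule sum.swap)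
  have "D1_sum G p k = (\<Sum>u\<in>verts G. a * (\<Sum>f\<in>arc_choices G. choice_weight f * ?Q u f))"
    unfolding swap by (intro sum.cong refl) (subst sum_arc_choices_resample, simp_all add: Q assms)
  also have "\<dots> = a * D1_sum G p (\<lambda>_. 1)" unfolding swap by (simp only: sum_distrib_left mult_1_right)
  finally show ?thesis .
qed

text \<open>Whether the arcs chosen at \<open>u\<close> and \<open>v\<close> lead to the other one of the two vertices depends on one
  of these arcs only, so that the other one can be averaged out.\<close>

lemma sum_arc_choices_unique_minus_two_cycles:
  assumes uv: "u \<in> verts G" "v \<in> verts G" "u \<noteq> v" and mean: "arc_mean g u = 0" "arc_mean h v = 0"
  shows "(\<Sum>f\<in>arc_choices G. choice_weight f *
    ((of_bool (on_unique_cycle (verts G) (choice_succ G f) u v) -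
      of_bool (on_two_cycles (verts G) (choice_succ G f) u v)) * (g (f u) * h (f v)))) = 0"
proof -
  define r where "r f = reaches (absorb {u, v} (choice_succ G f))" for f
  define X where "X f = (of_bool (\<forall>x\<in>verts G. r f x u \<or> r f x v) :: real)" for f
  define A where "A f = (of_bool (r f (head G (f u)) v) :: real)" for f
  define B where "B f = (of_bool (r f (head G (f v)) u) :: real)" for f
  have "r (f(w := e)) = r f" if "w = u \<or> w = v" for f w e
    unfolding r_def by (rule arg_cong[OF absorb_cong]) (use that in \<open>auto simp: choice_succ_def\<close>)
  then have upd: "X (f(u := e)) = X f" "X (f(v := e)) = X f" "A (f(v := e)) = A f" "B (f(u := e)) = B f"
    for f e
    using uv(3) unfolding X_def A_def B_def by simp_all
  have difference: "of_bool (on_unique_cycle (verts G) (choice_succ G f) u v) -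
      of_bool (on_two_cycles (verts G) (choice_succ G f) u v) = X f * (A f + B f - 1)"
    if "f \<in> arc_choices G" for f
    using of_bool_unique_minus_two_cycles[OF uv arc_choice.succ_closed[OF arc_choiceI[OF that]]]
    unfolding X_def A_def B_def r_def choice_succ_def .
  have "(\<Sum>f\<in>arc_choices G. choice_weight f *
      ((of_bool (on_unique_cycle (verts G) (choice_succ G f) u v) -
        of_bool (on_two_cycles (verts G) (choice_succ G f) u v)) * (g (f u) * h (f v)))) =
      (\<Sum>f\<in>arc_choices G. choice_weight f * (X f * (A f - 1) * g (f u) * h (f v))) +
      (\<Sum>f\<in>arc_choices G. choice_weight f * (X f * B f * h (f v) * g (f u)))"
    unfolding sum.distrib[symmetric]
    by (intro sum.cong refl) (simp only: difference, simp add: algebra_simps)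
  also have "(\<Sum>f\<in>arc_choices G. choice_weight f * (X f * (A f - 1) * g (f u) * h (f v))) = 0"
    by (subst sum_arc_choices_resample[OF uv(2)]) (use uv(3) in \<open>simp_all add: upd mean\<close>)
  also have "(\<Sum>f\<in>arc_choices G. choice_weight f * (X f * B f * h (f v) * g (f u))) = 0"
    by (subst sum_arc_choices_resample[OF uv(1)]) (use uv(3) in \<open>simp_all add: upd mean\<close>)
  finally show ?thesis by simp
qed

theorem D1_pair_minus_D2_pair_if_arc_mean_0:
  assumes g: "\<And>v. v \<in> verts G \<Longrightarrow> arc_mean g v = 0" and h: "\<And>v. v \<in> verts G \<Longrightarrow> arc_mean h v = 0"
  shows "D1_pair G p g h - D2_pair G p g h = D1_sum G p (\<lambda>e. g e * h e)"
proof -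
  define d where "d u v f = (of_bool (on_unique_cycle (verts G) (choice_succ G f) u v) -
    of_bool (on_two_cycles (verts G) (choice_succ G f) u v) :: real)" for u v f
  have "D1_pair G p g h - D2_pair G p g h =
      (\<Sum>f\<in>arc_choices G. \<Sum>u\<in>verts G. \<Sum>v\<in>verts G. choice_weight f * (d u v f * (g (f u) * h (f v))))"
    unfolding D1_pair_eq_sum_arc_choices D2_pair_eq_sum_arc_choices d_def
    by (simp only: sum_distrib_left sum_subtractf[symmetric]
      right_diff_distrib[symmetric] left_diff_distrib[symmetric])
  also have "\<dots> = (\<Sum>u\<in>verts G. \<Sum>v\<in>verts G. \<Sum>f\<in>arc_choices G. choice_weight f * (d u v f * (g (f u) * h (f v))))"
    by (rule trans[OF sum.swap]) (intro sum.cong refl sum.swap)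
  also have "\<dots> = (\<Sum>u\<in>verts G. \<Sum>v\<in>verts G. if u = v then
      (\<Sum>f\<in>arc_choices G. choice_weight f * (d u u f * (g (f u) * h (f u)))) else 0)"
    unfolding d_def using sum_arc_choices_unique_minus_two_cycles g h by (intro sum.cong refl) auto
  also have "\<dots> = (\<Sum>f\<in>arc_choices G. \<Sum>u\<in>verts G. choice_weight f * (d u u f * (g (f u) * h (f u))))"
    by (simp add: sum.delta') (rule sum.swap)
  also have "\<dots> = D1_sum G p (\<lambda>e. g e * h e)"
    unfolding D1_sum_eq_sum_arc_choices sum_distrib_left d_def by (simp add: not_on_two_cycles_refl)
  finally show ?thesis .
qed

end

definition coboundary :: "('a, 'e) pre_digraph \<Rightarrow> ('a \<Rightarrow> real) \<Rightarrow> 'e \<Rightarrow> real" where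
  "coboundary G h e = h (head G e) - h (tail G e)"

lemma (in wf_digraph) sum_list_coboundary_awalk:
  "awalk u w v \<Longrightarrow> (\<Sum>e\<leftarrow>w. coboundary G h e) = h v - h u"
  by (induction w arbitrary: u) (auto simp: awalk_simps coboundary_def)

lemma (in wf_digraph) sum_coboundary_cycle:
  assumes "C \<in> cycles G"
  shows "(\<Sum>e\<in>C. coboundary G h e) = 0"
proof -
  obtain w u where "C = set w" "awalk u w u" "distinct w"
    using assms unfolding cycles_def cycle_conv by auto
  then show ?thesis
    using sum_list_coboundary_awalk[of u w u h] by (simp add: sum_list_distinct_conv_sum_set)
qed

lemma sum_cycle_add_coboundary:
  assumes "D \<in> functional_spanning m F" "C \<in> cycles D"
  shows "(\<Sum>e\<in>C. k e + coboundary F h e) = (\<Sum>e\<in>C. k e)"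
proof -
  have "wf_digraph D" "coboundary D h = coboundary F h"
    using assms(1) by (auto simp: functional_spanning_def spanning_def subgraph_def compatible_def
        coboundary_def fun_eq_iff)
  then show ?thesis using wf_digraph.sum_coboundary_cycle[of D C h] assms(2) by (simp add: sum.distrib)
qed

lemma D1_sum_add_coboundary: "D1_sum F p (\<lambda>e. k e + coboundary F h e) = D1_sum F p k"
  unfolding D1_sum_def by (simp only: sum_cycle_add_coboundary cong: sum.cong)

lemma D1_pair_add_coboundary:
  "D1_pair F p (\<lambda>e. k1 e + coboundary F h1 e) (\<lambda>e. k2 e + coboundary F h2 e) = D1_pair F p k1 k2"
  unfolding D1_pair_def by (simp only: sum_cycle_add_coboundary cong: sum.cong)

lemma D2_pair_add_coboundary:
  "D2_pair F p (\<lambda>e. k1 e + coboundary F h1 e) (\<lambda>e. k2 e + coboundary F h2 e) = D2_pair F p k1 k2"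
  unfolding D2_pair_def
  by (intro refl sum_cycle_add_coboundary sum.cong arg_cong2[where f = "(*)"]) (assumption | erule DiffD1)+

section \<open>The final component\<close>

lemma (in pre_digraph) verts_condensation: "verts (condensation G) = sccs_verts"
  by (simp add: condensation_def)

lemma (in fin_digraph) out_degree_condensation_eq_0_iff:
  assumes "S \<in> sccs_verts"
  shows "out_degree (condensation G) S = 0 \<longleftrightarrow> (\<forall>e\<in>arcs G. tail G e \<in> S \<longrightarrow> head G e \<in> S)"
proof -
  have out_arcs: "out_arcs (condensation G) S =
      {(S, T) | T. T \<in> sccs_verts \<and> S \<noteq> T \<and> (\<exists>e\<in>arcs G. tail G e \<in> S \<and> head G e \<in> T)}"
    using assms by (auto simp: condensation_def out_arcs_def)
  have "finite (out_arcs (condensation G) S)"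
    unfolding out_arcs by (rule finite_subset[of _ "{S} \<times> sccs_verts"]) (auto simp: finite_sccs_verts)
  then have "out_degree (condensation G) S = 0 \<longleftrightarrow>
      \<not> (\<exists>T\<in>sccs_verts. S \<noteq> T \<and> (\<exists>e\<in>arcs G. tail G e \<in> S \<and> head G e \<in> T))"
    unfolding out_degree_def by (subst card_0_eq) (auto simp: out_arcs)
  moreover have "(\<exists>T\<in>sccs_verts. S \<noteq> T \<and> head G e \<in> T) \<longleftrightarrow> head G e \<notin> S" if "e \<in> arcs G" for e
    using sccs_verts_disjoint[OF assms] scc_of_in_sccs_verts[of "head G e"] in_scc_of_self[of "head G e"] that
    by auto
  ultimately show ?thesis by blast
qed

lemma (in fin_digraph) ex_closed_scc_reachable:
  assumes "x \<in> verts G"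
  obtains y where "x \<rightarrow>\<^sup>*\<^bsub>G\<^esub> y" "\<forall>e\<in>arcs G. tail G e \<in> scc_of y \<longrightarrow> head G e \<in> scc_of y"
proof -
  define R where "R y = {z. y \<rightarrow>\<^sup>*\<^bsub>G\<^esub> z}" for y
  have finite: "finite (R y)" for y
    unfolding R_def by (rule finite_subset[OF _ finite_verts]) (auto dest: reachable_in_verts)
  obtain y where y: "x \<rightarrow>\<^sup>*\<^bsub>G\<^esub> y" and min: "\<And>z. x \<rightarrow>\<^sup>*\<^bsub>G\<^esub> z \<Longrightarrow> card (R y) \<le> card (R z)"
    using ex_has_least_nat[of "\<lambda>y. x \<rightarrow>\<^sup>*\<^bsub>G\<^esub> y" x "\<lambda>y. card (R y)"] assms by auto
  have "z \<rightarrow>\<^sup>*\<^bsub>G\<^esub> y" if "y \<rightarrow>\<^sup>*\<^bsub>G\<^esub> z" for z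
  proof -
    have sub: "R z \<subseteq> R y" unfolding R_def using that reachable_trans by blast
    have "x \<rightarrow>\<^sup>*\<^bsub>G\<^esub> z" using y that by (rule reachable_trans)
    then have "R z = R y" using card_seteq[OF finite sub] min by blast
    then show ?thesis using y reachable_in_verts by (auto simp: R_def)
  qed
  then have "scc_of y = R y" unfolding scc_of_def R_def by auto
  moreover have "head G e \<in> R y" if "e \<in> arcs G" "tail G e \<in> R y" for e
    using that reachable_adj_trans[of y "tail G e" "head G e"] in_arcs_imp_in_arcs_ends
    unfolding R_def by auto
  ultimately show ?thesis using y by (intro that) auto
qed

locale finally_connected_digraph = fin_digraph G for G :: "('a, 'e) pre_digraph" +
  assumes finally_connected: "finally_connected G"
begin

definition final_verts :: "'a set" where
  "final_verts = (THE S. S \<in> verts (condensation G) \<and> out_degree (condensation G) S = 0)"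

lemma final_component_eq: "final_component G = G \<restriction> final_verts"
  unfolding final_component_def final_verts_def ..

lemma closed_scc_iff_final_verts:
  "S \<in> sccs_verts \<and> (\<forall>e\<in>arcs G. tail G e \<in> S \<longrightarrow> head G e \<in> S) \<longleftrightarrow> S = final_verts"
proof -
  note unique_sink = finally_connected[unfolded finally_connected_def]
  have "S \<in> verts (condensation G) \<and> out_degree (condensation G) S = 0 \<longleftrightarrow> S = final_verts"
    unfolding final_verts_def
  proof
    assume "S = (THE S. S \<in> verts (condensation G) \<and> out_degree (condensation G) S = 0)"
    then show "S \<in> verts (condensation G) \<and> out_degree (condensation G) S = 0"
      using theI'[OF unique_sink] by simp
  qed (rule the1_equality[OF unique_sink, symmetric])
  then show ?thesis
    using out_degree_condensation_eq_0_iff[of S] by (auto simp: verts_condensation)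
qed

lemma final_verts_in_sccs_verts: "final_verts \<in> sccs_verts"
  and final_verts_closed: "e \<in> arcs G \<Longrightarrow> tail G e \<in> final_verts \<Longrightarrow> head G e \<in> final_verts"
  using closed_scc_iff_final_verts[of final_verts] by simp_all

lemma final_verts_subset: "final_verts \<subseteq> verts G"
  by (rule sccs_verts_subsets[OF final_verts_in_sccs_verts])

lemma strongly_connected_final: "strongly_connected (G \<restriction> final_verts)"
  using in_verts_sccsD_sccs[OF final_verts_in_sccs_verts] by auto

lemma final_verts_nonempty: "final_verts \<noteq> {}"
  using strongly_connected_final unfolding strongly_connected_def by simp

lemma reachable_final_verts:
  assumes "x \<in> verts G" "r \<in> final_verts"
  shows "x \<rightarrow>\<^sup>*\<^bsub>G\<^esub> r"
proof -
  obtain y where y: "x \<rightarrow>\<^sup>*\<^bsub>G\<^esub> y" "\<forall>e\<in>arcs G. tail G e \<in> scc_of y \<longrightarrow> head G e \<in> scc_of y"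
    using ex_closed_scc_reachable[OF assms(1)] .
  then have "scc_of y = final_verts"
    using closed_scc_iff_final_verts[of "scc_of y"] scc_of_in_sccs_verts reachable_in_verts by blast
  then have "y \<rightarrow>\<^sup>*\<^bsub>G\<^esub> r" using assms(2) unfolding scc_of_def by auto
  with y(1) show ?thesis by (rule reachable_trans)
qed

lemma out_arcs_final: "x \<in> final_verts \<Longrightarrow> out_arcs (G \<restriction> final_verts) x = out_arcs G x"
  using final_verts_closed by (auto simp: out_arcs_def)

lemma subgraph_final: "subgraph (G \<restriction> final_verts) G"
  by (rule subgraph_induce_subgraphI[OF final_verts_subset])

lemma fin_digraph_final: "fin_digraph (G \<restriction> final_verts)"
  by (rule fin_digraph_subgraph[OF subgraph_final])

end

lemma ex_consecutive_in_additive_set: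
  fixes A :: "nat set"
  assumes zero: "0 \<in> A" and add: "\<And>a b. a \<in> A \<Longrightarrow> b \<in> A \<Longrightarrow> a + b \<in> A" and "Gcd A = 1"
  obtains b where "b \<in> A" "Suc b \<in> A"
proof -
  have "\<exists>a\<in>A. \<exists>b\<in>A. s = int a - int b" if "s \<in> group_closure (int ` A)" for s
    using that
  proof induction
    case (base s)
    then show ?case using zero by force
  next
    case (diff s t)
    then obtain a b c d where "a \<in> A" "b \<in> A" "c \<in> A" "d \<in> A" "s = int a - int b" "t = int c - int d"
      by blast
    then have "a + d \<in> A" "b + c \<in> A" "s - t = int (a + d) - int (b + c)" using add by simp_all
    then show ?case by blast
  qed
  moreover have "1 \<in> group_closure (int ` A)"
    using Gcd_in_group_closure[of "int ` A"] assms(3) by (simp add: Gcd_int_eq)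
  ultimately obtain a b where "a \<in> A" "b \<in> A" "1 = int a - int b" by blast
  moreover from this have "a = Suc b" by linarith
  ultimately show ?thesis using that by blast
qed

lemma additive_set_eventually_all:
  fixes A :: "nat set"
  assumes zero: "0 \<in> A" and add: "\<And>a b. a \<in> A \<Longrightarrow> b \<in> A \<Longrightarrow> a + b \<in> A" and "Gcd A = 1"
  obtains N where "\<forall>n\<ge>N. n \<in> A"
proof -
  obtain b where b: "b \<in> A" "Suc b \<in> A" using ex_consecutive_in_additive_set[OF assms] .
  have multiple: "k * a \<in> A" if "a \<in> A" for k a
    by (induction k) (use that zero add in auto)
  have "n \<in> A" if n: "b * b \<le> n" for n
  proof (cases "b = 0")
    case True
    then show ?thesis using multiple[OF b(2), of n] by simp
  next
    case False
    have "n mod b \<le> b" using False by (simp add: less_imp_le)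
    also have "b \<le> n div b" using n False by (simp add: less_eq_div_iff_mult_less_eq)
    finally have "(n div b) * b + n mod b = (n div b - n mod b) * b + (n mod b) * Suc b"
      by (simp add: diff_mult_distrib)
    then have "n = (n div b - n mod b) * b + (n mod b) * Suc b" by simp
    then show ?thesis using add[OF multiple[OF b(1)] multiple[OF b(2)]] by metis
  qed
  then show ?thesis using that by blast
qed

locale finally_aperiodic_digraph = finally_connected_digraph +
  assumes finally_aperiodic: "finally_aperiodic G"
begin

lemma Gcd_closed_awalk_lengths:
  assumes r: "r \<in> final_verts"
  shows "Gcd {length w | w. awalk r w r} = 1"
proof -
  interpret final: fin_digraph "G \<restriction> final_verts" by (rule fin_digraph_final)
  let ?d = "Gcd {length w | w. awalk r w r}"
  have dvd: "?d dvd length w" if "awalk r w r" for w using that by (intro Gcd_dvd) auto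
  have "?d dvd length w" if cycle: "final.cycle w" for w
  proof -
    obtain u where walk: "final.awalk u w u" using cycle unfolding final.cycle_def by auto
    have w: "awalk u w u" using subgraph_awalk_imp_awalk[OF walk subgraph_final] .
    have "u \<in> final_verts" using final.awalk_hd_in_verts[OF walk] by simp
    then obtain a b where ab: "awalk r a u" "awalk u b r"
      using r final_verts_subset reachable_final_verts reachable_awalk by (meson subsetD)
    have "?d dvd length (a @ b)" "?d dvd length (a @ w @ b)"
      using dvd awalk_appendI ab w by blast+
    then have "?d dvd length (a @ b)" "?d dvd length w + length (a @ b)" by (simp_all add: ac_simps)
    then show ?thesis by (simp only: dvd_add_left_iff)
  qed
  then have "?d dvd Gcd {length w | w. final.cycle w}" by (auto intro: Gcd_greatest)
  then show ?thesis using finally_aperiodic unfolding finally_aperiodic_def final_component_eq by simp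
qed

lemma ex_awalks_of_common_length:
  obtains r N where "r \<in> verts G" "0 < N" "\<forall>x\<in>verts G. \<exists>w. awalk x w r \<and> length w = N"
proof -
  obtain r where r: "r \<in> final_verts" using final_verts_nonempty by auto
  then have "r \<in> verts G" using final_verts_subset by auto
  define A where "A = {length w | w. awalk r w r}"
  have "0 \<in> A" unfolding A_def using \<open>r \<in> verts G\<close> by (auto intro!: exI[of _ "[]"] simp: awalk_Nil_iff)
  moreover have "a + b \<in> A" if "a \<in> A" "b \<in> A" for a b
    using that awalk_appendI[of r _ r _ r] unfolding A_def by (force simp flip: length_append)
  moreover have "Gcd A = 1" unfolding A_def by (rule Gcd_closed_awalk_lengths[OF r])
  ultimately obtain N0 where N0: "\<forall>n\<ge>N0. n \<in> A" by (rule additive_set_eventually_all)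
  have "\<exists>w. awalk x w r" if "x \<in> verts G" for x
    using reachable_final_verts[OF that r] reachable_awalk by blast
  then obtain W where W: "\<And>x. x \<in> verts G \<Longrightarrow> awalk x (W x) r" by metis
  define N where "N = Suc N0 + (\<Sum>x\<in>verts G. length (W x))"
  have "\<exists>w. awalk x w r \<and> length w = N" if x: "x \<in> verts G" for x
  proof -
    have "length (W x) \<le> (\<Sum>x\<in>verts G. length (W x))" by (rule member_le_sum[OF x]) auto
    then have W_short: "length (W x) + N0 \<le> N" unfolding N_def by simp
    then have "N - length (W x) \<in> A" using N0 by simp
    then obtain v where v: "awalk r v r" "length v = N - length (W x)" unfolding A_def by auto
    have "awalk x (W x @ v) r" using awalk_appendI[OF W[OF x] v(1)] .
    moreover have "length (W x @ v) = N" using v(2) W_short by simp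
    ultimately show ?thesis by blast
  qed
  then show ?thesis using that[of r N] \<open>r \<in> verts G\<close> unfolding N_def by simp
qed

end

section \<open>Geometric ergodicity\<close>

lemma summable_power_div:
  fixes r :: real
  assumes "0 \<le> r" "r < 1" "0 < N"
  shows "summable (\<lambda>n. r ^ (n div N))"
proof (rule summableI_nonneg_bounded)
  show "0 \<le> r ^ (n div N)" for n using assms by simp
  fix n
  have "(\<Sum>i<n. r ^ (i div N)) \<le> (\<Sum>i<n * N. r ^ (i div N))"
    using assms by (intro sum_mono2) auto
  also have "\<dots> = (\<Sum>m<n. \<Sum>i = m * N..<m * N + N. r ^ (i div N))"
    by (rule sum.nat_group[symmetric])
  also have "\<dots> = (\<Sum>m<n. \<Sum>i = m * N..<m * N + N. r ^ m)"
  proof (intro sum.cong refl)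
    fix m i assume "i \<in> {m * N..<m * N + N}"
    then have "i div N = m" by (intro div_nat_eqI) (auto simp: algebra_simps)
    then show "r ^ (i div N) = r ^ m" by simp
  qed
  also have "\<dots> = real N * (\<Sum>m<n. r ^ m)" by (simp add: sum_distrib_left)
  also have "\<dots> \<le> real N * (1 / (1 - r))"
    using assms sum_le_suminf[OF summable_geometric[of r], of "{..<n}"] suminf_geometric[of r]
    by (intro mult_left_mono) auto
  finally show "(\<Sum>i<n. r ^ (i div N)) \<le> real N * (1 / (1 - r))" .
qed

context stochastic_digraph
begin

lemma arc_mean_mono:
  fixes g h :: "'e \<Rightarrow> real"
  assumes "\<And>e. e \<in> out_arcs G x \<Longrightarrow> g e \<le> h e"
  shows "arc_mean g x \<le> arc_mean h x"
  unfolding arc_mean_def using assms arc_prob_pos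
  by (intro sum_mono) (auto simp: less_imp_le intro!: mult_left_mono)

definition transition_op :: "('a \<Rightarrow> 'b) \<Rightarrow> 'a \<Rightarrow> 'b::real_normed_vector" where
  "transition_op f x = arc_mean (\<lambda>e. f (head G e)) x"

lemma transition_op_pow_Suc:
  "(transition_op ^^ Suc n) f x = arc_mean (\<lambda>e. (transition_op ^^ n) f (head G e)) x"
  unfolding funpow.simps comp_apply by (rule transition_op_def)

lemma transition_op_cong:
  assumes "\<And>x. x \<in> verts G \<Longrightarrow> f x = g x"
  shows "transition_op f x = transition_op g x"
  unfolding transition_op_def using assms by (intro arc_mean_cong) simp

lemma transition_op_pow_affine:
  fixes f :: "'a \<Rightarrow> real"
  assumes "x \<in> verts G"
  shows "(transition_op ^^ n) (\<lambda>y. b + c * f y) x = b + c * (transition_op ^^ n) f x"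
  using assms
proof (induction n arbitrary: x)
  case (Suc n)
  have "(transition_op ^^ Suc n) (\<lambda>y. b + c * f y) x = transition_op (\<lambda>y. b + c * (transition_op ^^ n) f y) x"
    using transition_op_cong[OF Suc.IH] by simp
  also have "\<dots> = b + c * (transition_op ^^ Suc n) f x"
    unfolding transition_op_pow_Suc unfolding transition_op_def[of "\<lambda>y. b + c * (transition_op ^^ n) f y"]
    by (simp add: arc_mean_add arc_mean_mult_left arc_mean_const[OF Suc.prems])
  finally show ?case .
qed simp

lemma transition_op_pow_nonneg:
  fixes f :: "'a \<Rightarrow> real"
  assumes "\<And>x. x \<in> verts G \<Longrightarrow> 0 \<le> f x" "x \<in> verts G"
  shows "0 \<le> (transition_op ^^ n) f x"
  using assms(2)
proof (induction n arbitrary: x)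
  case (Suc n)
  have "arc_mean (\<lambda>_. 0) x \<le> arc_mean (\<lambda>e. (transition_op ^^ n) f (head G e)) x"
    using Suc.IH by (intro arc_mean_mono) simp
  then show ?case unfolding transition_op_pow_Suc by (simp add: arc_mean_const[OF Suc.prems])
qed (use assms in simp)

lemma prod_awalk_pos: "awalk x w y \<Longrightarrow> 0 < (\<Prod>e\<leftarrow>w. p e)"
  by (induction w arbitrary: x) (auto simp: awalk_Cons_iff arc_prob_pos)

lemma prod_awalk_le_transition_op_pow:
  fixes f :: "'a \<Rightarrow> real"
  assumes "awalk x w r" "\<And>x. x \<in> verts G \<Longrightarrow> 0 \<le> f x"
  shows "(\<Prod>e\<leftarrow>w. p e) * f r \<le> (transition_op ^^ length w) f x"
  using assms(1)
proof (induction w arbitrary: x)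
  case Nil
  then show ?case by (simp add: awalk_Nil_iff)
next
  case (Cons e w)
  let ?h = "\<lambda>e. (transition_op ^^ length w) f (head G e)"
  have e: "e \<in> out_arcs G x" "e \<in> arcs G" and w: "awalk (head G e) w r"
    using Cons.prems by (auto simp: awalk_Cons_iff)
  have "(\<Prod>e\<leftarrow>e # w. p e) * f r = p e * ((\<Prod>e\<leftarrow>w. p e) * f r)" by simp
  also have "\<dots> \<le> p e * ?h e"
    using Cons.IH[OF w] arc_prob_pos[OF e(2)] by (intro mult_left_mono) auto
  also have "\<dots> \<le> (\<Sum>e\<in>out_arcs G x. p e * ?h e)"
    using arc_prob_pos transition_op_pow_nonneg[of f] assms(2)
    by (intro member_le_sum[OF e(1)]) (auto simp: less_imp_le intro!: mult_nonneg_nonneg)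
  also have "\<dots> = arc_mean ?h x" unfolding arc_mean_def by simp
  also have "\<dots> = (transition_op ^^ length (e # w)) f x"
    unfolding list.size(4) add_0_right add_Suc_right transition_op_pow_Suc ..
  finally show ?case .
qed

definition oscillation :: "('a \<Rightarrow> real) \<Rightarrow> real" where
  "oscillation f = Max (f ` verts G) - Min (f ` verts G)"

lemma abs_diff_le_oscillation:
  assumes "x \<in> verts G" "y \<in> verts G"
  shows "\<bar>f x - f y\<bar> \<le> oscillation f"
proof -
  have "Min (f ` verts G) \<le> f z \<and> f z \<le> Max (f ` verts G)" if "z \<in> verts G" for z
    using that by simp
  from this[OF assms(1)] this[OF assms(2)] show ?thesis unfolding oscillation_def by linarith
qed

lemma oscillation_nonneg: "x \<in> verts G \<Longrightarrow> 0 \<le> oscillation f"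
  using abs_diff_le_oscillation[of x x f] by simp

definition minorizes :: "nat \<Rightarrow> 'a \<Rightarrow> real \<Rightarrow> bool" where
  "minorizes N r \<delta> \<longleftrightarrow> (\<forall>x\<in>verts G. \<forall>f. (\<forall>y\<in>verts G. 0 \<le> f y) \<longrightarrow> \<delta> * f r \<le> (transition_op ^^ N) f x)"

lemma minorizesD:
  "minorizes N r \<delta> \<Longrightarrow> x \<in> verts G \<Longrightarrow> (\<And>y. y \<in> verts G \<Longrightarrow> 0 \<le> f y) \<Longrightarrow>
    \<delta> * f r \<le> (transition_op ^^ N) f x"
  unfolding minorizes_def by blast

text \<open>Doeblin's argument: a bound from below by \<open>\<delta> * f r\<close>, applied to \<open>Max f - f\<close> at one vertex and
  to \<open>f - Min f\<close> at another, leaves at most the fraction \<open>1 - \<delta>\<close> of the oscillation.\<close>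

lemma oscillation_transition_op_pow_le:
  assumes r: "r \<in> verts G" and minor: "minorizes N r \<delta>"
  shows "oscillation ((transition_op ^^ N) f) \<le> (1 - \<delta>) * oscillation f"
proof -
  let ?Q = "(transition_op ^^ N) f" and ?a = "Min (f ` verts G)" and ?b = "Max (f ` verts G)"
  have diff: "?Q x - ?Q y \<le> (1 - \<delta>) * oscillation f" if xy: "x \<in> verts G" "y \<in> verts G" for x y
  proof -
    have "\<delta> * (?b + (-1) * f r) \<le> (transition_op ^^ N) (\<lambda>z. ?b + (-1) * f z) x"
      by (rule minorizesD[OF minor xy(1)]) simp
    then have upper: "\<delta> * (?b - f r) \<le> ?b - ?Q x"
      using transition_op_pow_affine[OF xy(1), of N ?b "-1" f] by simp
    have "\<delta> * (- ?a + 1 * f r) \<le> (transition_op ^^ N) (\<lambda>z. - ?a + 1 * f z) y"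
      by (rule minorizesD[OF minor xy(2)]) simp
    then have lower: "\<delta> * (f r - ?a) \<le> ?Q y - ?a"
      using transition_op_pow_affine[OF xy(2), of N "- ?a" 1 f] by simp
    show ?thesis using upper lower unfolding oscillation_def by (simp add: algebra_simps)
  qed
  have "Max (?Q ` verts G) \<in> ?Q ` verts G" "Min (?Q ` verts G) \<in> ?Q ` verts G"
    using r by (auto intro!: Max_in Min_in)
  then show ?thesis using diff unfolding oscillation_def[of ?Q] by auto
qed

lemma oscillation_transition_op_pow_decay:
  assumes r: "r \<in> verts G" and minor: "minorizes N r \<delta>" and "\<delta> \<le> 1"
  shows "oscillation ((transition_op ^^ n) f) \<le> (1 - \<delta>) ^ (n div N) * oscillation f"
proof -
  have step: "oscillation (transition_op g) \<le> oscillation g" for g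
  proof -
    have "minorizes 1 r 0" unfolding minorizes_def using transition_op_pow_nonneg[of _ _ 1] by simp
    from oscillation_transition_op_pow_le[OF r this] show ?thesis by simp
  qed
  have steps: "oscillation ((transition_op ^^ m) g) \<le> oscillation g" for m g
  proof (induction m)
    case (Suc m)
    then show ?case using step[of "(transition_op ^^ m) g"] by simp
  qed simp
  have blocks: "oscillation ((transition_op ^^ (k * N)) f) \<le> (1 - \<delta>) ^ k * oscillation f" for k
  proof (induction k)
    case (Suc k)
    have "(transition_op ^^ (Suc k * N)) f = (transition_op ^^ N) ((transition_op ^^ (k * N)) f)"
      by (simp add: funpow_add)
    then have "oscillation ((transition_op ^^ (Suc k * N)) f) \<le>
        (1 - \<delta>) * oscillation ((transition_op ^^ (k * N)) f)"
      using oscillation_transition_op_pow_le[OF r minor] by simp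
    also have "\<dots> \<le> (1 - \<delta>) * ((1 - \<delta>) ^ k * oscillation f)"
      using Suc assms(3) by (intro mult_left_mono) auto
    finally show ?case by simp
  qed simp
  have "(transition_op ^^ (n mod N + n div N * N)) f =
      (transition_op ^^ (n mod N)) ((transition_op ^^ (n div N * N)) f)"
    by (simp only: funpow_add comp_apply)
  then show ?thesis using order_trans[OF steps blocks] by simp
qed

lemma ex_minorization:
  assumes "verts G \<noteq> {}" and walks: "\<forall>x\<in>verts G. \<exists>w. awalk x w r \<and> length w = N"
  obtains \<delta> where "0 < \<delta>" "minorizes N r \<delta>"
proof -
  obtain W where W: "\<And>x. x \<in> verts G \<Longrightarrow> awalk x (W x) r" "\<And>x. x \<in> verts G \<Longrightarrow> length (W x) = N"
    using walks by metis
  define \<delta> where "\<delta> = Min ((\<lambda>x. \<Prod>e\<leftarrow>W x. p e) ` verts G)"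
  have r: "r \<in> verts G" using W(1) assms(1) awalk_last_in_verts by blast
  show ?thesis
  proof (rule that)
    show "0 < \<delta>" unfolding \<delta>_def using assms(1) W(1) prod_awalk_pos by (subst Min_gr_iff) auto
    show "minorizes N r \<delta>" unfolding minorizes_def
    proof (intro ballI allI impI)
      fix f :: "'a \<Rightarrow> real" and x
      assume x: "x \<in> verts G" and "\<forall>y\<in>verts G. 0 \<le> f y"
      then have f: "\<And>y. y \<in> verts G \<Longrightarrow> 0 \<le> f y" by blast
      have "\<delta> \<le> (\<Prod>e\<leftarrow>W x. p e)" unfolding \<delta>_def using x by simp
      then have "\<delta> * f r \<le> (\<Prod>e\<leftarrow>W x. p e) * f r" using f[OF r] by (intro mult_right_mono)
      also have "\<dots> \<le> (transition_op ^^ N) f x"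
        using prod_awalk_le_transition_op_pow[OF W(1)[OF x] f] W(2)[OF x] by simp
      finally show "\<delta> * f r \<le> (transition_op ^^ N) f x" .
    qed
  qed
qed

lemma summable_oscillation_transition_op_pow:
  assumes "r \<in> verts G" "0 < N" "\<forall>x\<in>verts G. \<exists>w. awalk x w r \<and> length w = N"
  shows "summable (\<lambda>n. oscillation ((transition_op ^^ n) f))"
proof -
  obtain \<delta> where "0 < \<delta>" and minor: "minorizes N r \<delta>"
    using ex_minorization[OF _ assms(3)] assms(1) by blast
  have "\<delta> \<le> 1"
    using minorizesD[OF minor assms(1), of "\<lambda>_. 1"]
        transition_op_pow_affine[OF assms(1), of N 1 0 "\<lambda>_. 0"] by simp
  show ?thesis
  proof (rule summable_comparison_test')
    show "summable (\<lambda>n. (1 - \<delta>) ^ (n div N) * oscillation f)"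
      by (intro summable_mult2 summable_power_div) (use \<open>0 < \<delta>\<close> \<open>\<delta> \<le> 1\<close> assms(2) in auto)
    show "norm (oscillation ((transition_op ^^ n) f)) \<le> (1 - \<delta>) ^ (n div N) * oscillation f" for n
      using oscillation_transition_op_pow_decay[OF assms(1) minor \<open>\<delta> \<le> 1\<close>]
        oscillation_nonneg[OF assms(1)] by simp
  qed
qed

lemma arc_mean_sums:
  assumes "\<And>e. e \<in> out_arcs G x \<Longrightarrow> (\<lambda>n. g n e) sums s e"
  shows "(\<lambda>n. arc_mean (g n) x) sums arc_mean s x"
  unfolding arc_mean_def using assms by (intro sums_sum sums_scaleR_right)

end

section \<open>The Poisson equation\<close>

locale ergodic_digraph = stochastic_digraph G p + finally_aperiodic_digraph G
  for G :: "('a, 'e) pre_digraph" and p :: "'e \<Rightarrow> real"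
begin

lemma geometric_ergodicity: "summable (\<lambda>n. oscillation ((transition_op ^^ n) f))"
  using ex_awalks_of_common_length summable_oscillation_transition_op_pow by metis

lemma poisson_vertex:
  fixes f :: "'a \<Rightarrow> real"
  obtains h c where "\<forall>x\<in>verts G. f x + transition_op h x - h x = c"
proof -
  obtain r where r: "r \<in> verts G" using final_verts_nonempty final_verts_subset by blast
  define q where "q n = (transition_op ^^ n) f" for n
  define h where "h x = (\<Sum>n. q n x - q n r)" for x
  have summable: "summable (\<lambda>n. q n x - q n r)" if "x \<in> verts G" for x
    by (rule summable_comparison_test'[OF geometric_ergodicity[of f], of 0])
       (simp add: q_def abs_diff_le_oscillation[OF that r])
  have limit: "(\<lambda>n. q n x) \<longlonglongrightarrow> f x + transition_op h x - h x" if x: "x \<in> verts G" for x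
  proof -
    have "(\<lambda>n. arc_mean (\<lambda>e. q n (head G e) - q n r) x) sums transition_op h x"
      unfolding transition_op_def h_def by (intro arc_mean_sums summable_sums summable) simp
    moreover have "arc_mean (\<lambda>e. q n (head G e) - q n r) x = q (Suc n) x - q n r" for n
      by (simp add: arc_mean_diff arc_mean_const[OF x] q_def transition_op_def)
    moreover have "(\<lambda>n. q n x - q n r) sums h x" unfolding h_def by (rule summable_sums[OF summable[OF x]])
    ultimately have "(\<lambda>n. q (Suc n) x - q n x) sums (transition_op h x - h x)"
      using sums_diff[of "\<lambda>n. q (Suc n) x - q n r" _ "\<lambda>n. q n x - q n r"] by simp
    then have "(\<lambda>n. q n x - q 0 x) \<longlonglongrightarrow> transition_op h x - h x"
      unfolding sums_def sum_lessThan_telescope[of "\<lambda>i. q i x"] .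
    from tendsto_add[OF this tendsto_const[of "q 0 x"]] show ?thesis by (simp add: q_def algebra_simps)
  qed
  have "f x + transition_op h x - h x = f r + transition_op h r - h r" if x: "x \<in> verts G" for x
  proof -
    have "(\<lambda>n. (q n x - q n r) + q n r) \<longlonglongrightarrow> 0 + (f r + transition_op h r - h r)"
      by (intro tendsto_add summable_LIMSEQ_zero[OF summable[OF x]] limit[OF r])
    then show ?thesis using LIMSEQ_unique[OF limit[OF x]] by simp
  qed
  then show ?thesis using that by blast
qed

sublocale final: stochastic_digraph "G \<restriction> final_verts" p
proof (rule stochastic_digraph.intro[OF fin_digraph_final])
  show "stochastic_digraph_axioms (G \<restriction> final_verts) p"
    by unfold_locales (use arc_prob_pos out_prob_sum final_verts_subset in \<open>auto simp: out_arcs_final\<close>)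
qed

lemma final_arc_mean: "x \<in> final_verts \<Longrightarrow> final.arc_mean g x = arc_mean g x"
  unfolding final.arc_mean_def arc_mean_def by (simp add: out_arcs_final)

lemma coboundary_final: "coboundary (G \<restriction> final_verts) = coboundary G"
  by (simp add: coboundary_def fun_eq_iff)

definition asymptotic_mean :: "('e \<Rightarrow> real) \<Rightarrow> real" where
  "asymptotic_mean k = D1_sum (G \<restriction> final_verts) p k / D1_sum (G \<restriction> final_verts) p (\<lambda>_. 1)"

lemma D1_sum_final_one_pos: "0 < D1_sum (G \<restriction> final_verts) p (\<lambda>_. 1)"
  by (rule final.D1_sum_one_pos[OF strongly_connected_final])

lemma asymptotic_mean_nonneg: "(\<And>e. 0 \<le> k e) \<Longrightarrow> 0 \<le> asymptotic_mean k"
  unfolding asymptotic_mean_def using final.D1_sum_nonneg[of k] D1_sum_final_one_pos by simp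

lemma asymptotic_mean_linear:
  "asymptotic_mean (\<lambda>e. a * g e + b * h e) = a * asymptotic_mean g + b * asymptotic_mean h"
  unfolding asymptotic_mean_def final.D1_sum_linear by (simp add: add_divide_distrib)

text \<open>The constant is read off on the final component: there \<open>k\<close> plus a coboundary has the same cycle
  sums as \<open>k\<close>.\<close>

theorem poisson:
  obtains h where "\<forall>x\<in>verts G. arc_mean (\<lambda>e. k e + coboundary G h e) x = asymptotic_mean k"
proof -
  obtain h c where "\<forall>x\<in>verts G. arc_mean k x + transition_op h x - h x = c"
    by (rule poisson_vertex)
  moreover have "arc_mean (\<lambda>e. k e + coboundary G h e) x = arc_mean k x + transition_op h x - h x"
    if "x \<in> verts G" for x
  proof -
    have "arc_mean (\<lambda>e. h (tail G e)) x = arc_mean (\<lambda>_. h x) x" by (rule arc_mean_cong) simp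
    then show ?thesis
      by (simp add: coboundary_def arc_mean_add arc_mean_diff transition_op_def arc_mean_const[OF that])
  qed
  ultimately have const: "arc_mean (\<lambda>e. k e + coboundary G h e) x = c" if "x \<in> verts G" for x
    using that by simp
  have "D1_sum (G \<restriction> final_verts) p k = D1_sum (G \<restriction> final_verts) p (\<lambda>e. k e + coboundary G h e)"
    using D1_sum_add_coboundary[of "G \<restriction> final_verts" p k h] unfolding coboundary_final by simp
  also have "\<dots> = c * D1_sum (G \<restriction> final_verts) p (\<lambda>_. 1)"
    by (rule final.D1_sum_if_arc_mean_const) (use const final_verts_subset in \<open>auto simp: final_arc_mean\<close>)
  finally have "asymptotic_mean k = c" unfolding asymptotic_mean_def using D1_sum_final_one_pos by simp
  then show ?thesis using that[of h] const by simp
qed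

end

section \<open>Means over random paths\<close>

lemma output_sum_Nil [simp]: "output_sum k [] = 0"
  unfolding output_sum_def by simp

lemma output_sum_Cons [simp]: "output_sum k (e # w) = k e + output_sum k w"
  unfolding output_sum_def by simp

lemma output_sum_add: "output_sum (\<lambda>e. k e + l e) w = output_sum k w + output_sum l w"
  by (induction w) simp_all

lemma output_sum_diff_const: "output_sum (\<lambda>e. k e - c) w = output_sum k w - c * real (length w)"
  by (induction w) (simp_all add: algebra_simps)

lemma output_sum_linear:
  "output_sum (\<lambda>e. a * k e + b * l e) w = a * output_sum k w + b * output_sum l w"
  by (induction w) (simp_all add: algebra_simps)

context stochastic_digraph
begin

definition paths :: "nat \<Rightarrow> 'a \<Rightarrow> 'e list set" where
  "paths n x = {w. length w = n \<and> (\<exists>v. awalk x w v)}"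

definition path_mean :: "nat \<Rightarrow> 'a \<Rightarrow> ('e list \<Rightarrow> 'b) \<Rightarrow> 'b::real_normed_vector" where
  "path_mean n x f = (\<Sum>w\<in>paths n x. (\<Prod>e\<leftarrow>w. p e) *\<^sub>R f w)"

lemma finite_paths: "finite (paths n x)"
proof (rule finite_subset)
  show "paths n x \<subseteq> {w. set w \<subseteq> arcs G \<and> length w = n}" unfolding paths_def by auto
qed (intro finite_lists_length_eq finite_arcs)

lemma paths_0: "x \<in> verts G \<Longrightarrow> paths 0 x = {[]}"
  unfolding paths_def by (auto simp: awalk_Nil_iff)

lemma paths_Suc: "paths (Suc n) x = (\<lambda>(e, w). e # w) ` (SIGMA e:out_arcs G x. paths n (head G e))"
proof
  show "paths (Suc n) x \<subseteq> (\<lambda>(e, w). e # w) ` (SIGMA e:out_arcs G x. paths n (head G e))"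
  proof
    fix w assume "w \<in> paths (Suc n) x"
    then obtain e w' v where "w = e # w'" "length w' = n" "awalk x (e # w') v"
      unfolding paths_def by (auto simp: length_Suc_conv)
    then show "w \<in> (\<lambda>(e, w). e # w) ` (SIGMA e:out_arcs G x. paths n (head G e))"
      unfolding paths_def by (force simp: awalk_Cons_iff)
  qed
qed (auto simp: paths_def awalk_Cons_iff)

lemma awlast_in_verts_if_path: "w \<in> paths n x \<Longrightarrow> awlast x w \<in> verts G"
  unfolding paths_def by (auto dest: awalk_last_in_verts)

lemma path_prob_pos: "w \<in> paths n x \<Longrightarrow> 0 < (\<Prod>e\<leftarrow>w. p e)"
  unfolding paths_def using prod_awalk_pos by blast

lemma path_mean_0: "x \<in> verts G \<Longrightarrow> path_mean 0 x f = f []"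
  unfolding path_mean_def by (simp add: paths_0)

lemma path_mean_Suc: "path_mean (Suc n) x f = arc_mean (\<lambda>e. path_mean n (head G e) (\<lambda>w. f (e # w))) x"
proof -
  let ?A = "SIGMA e:out_arcs G x. paths n (head G e)"
  have "inj_on (\<lambda>(e, w). e # w) ?A" by (auto simp: inj_on_def)
  then have "path_mean (Suc n) x f = (\<Sum>(e, w)\<in>?A. (p e * (\<Prod>e\<leftarrow>w. p e)) *\<^sub>R f (e # w))"
    unfolding path_mean_def paths_Suc by (subst sum.reindex) (auto simp: case_prod_unfold)
  also have "\<dots> = (\<Sum>e\<in>out_arcs G x. \<Sum>w\<in>paths n (head G e). (p e * (\<Prod>e\<leftarrow>w. p e)) *\<^sub>R f (e # w))"
    by (rule sum.Sigma[symmetric]) (auto simp: finite_paths)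
  finally show ?thesis unfolding path_mean_def arc_mean_def by (simp add: scaleR_sum_right)
qed

lemma path_mean_cong: "(\<And>w. w \<in> paths n x \<Longrightarrow> f w = g w) \<Longrightarrow> path_mean n x f = path_mean n x g"
  unfolding path_mean_def by (intro sum.cong refl) simp

lemma path_mean_add: "path_mean n x (\<lambda>w. f w + g w) = path_mean n x f + path_mean n x g"
  unfolding path_mean_def by (simp add: scaleR_add_right sum.distrib)

lemma path_mean_diff: "path_mean n x (\<lambda>w. f w - g w) = path_mean n x f - path_mean n x g"
  unfolding path_mean_def by (simp add: scaleR_diff_right sum_subtractf)

lemma path_mean_mult_left: "path_mean n x (\<lambda>w. c * f w) = c * path_mean n x f"
  for c :: "'b::real_normed_algebra"
  unfolding path_mean_def by (simp add: sum_distrib_left)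

lemma path_mean_const: "x \<in> verts G \<Longrightarrow> path_mean n x (\<lambda>_. c) = c"
proof (induction n arbitrary: x)
  case (Suc n)
  have "path_mean (Suc n) x (\<lambda>_. c) = arc_mean (\<lambda>_. c) x"
    unfolding path_mean_Suc by (intro arc_mean_cong) (simp add: Suc.IH)
  then show ?case by (simp add: arc_mean_const[OF Suc.prems])
qed (simp add: path_mean_0)

lemma norm_path_mean_le:
  assumes "x \<in> verts G" "\<And>w. w \<in> paths n x \<Longrightarrow> norm (f w) \<le> B"
  shows "norm (path_mean n x f) \<le> B"
  using assms
proof (induction n arbitrary: x f)
  case 0
  then show ?case by (simp add: path_mean_0 paths_0)
next
  case (Suc n)
  show ?case unfolding path_mean_Suc
  proof (rule norm_arc_mean_le[OF Suc.prems(1)])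
    fix e assume "e \<in> out_arcs G x"
    then show "norm (path_mean n (head G e) (\<lambda>w. f (e # w))) \<le> B"
      by (intro Suc.IH Suc.prems(2)) (auto simp: paths_Suc)
  qed
qed

lemma path_mean_awlast:
  "x \<in> verts G \<Longrightarrow> path_mean n x (\<lambda>w. h (awlast x w)) = (transition_op ^^ n) h x"
proof (induction n arbitrary: x)
  case (Suc n)
  show ?case unfolding path_mean_Suc transition_op_pow_Suc by (intro arc_mean_cong) (simp add: Suc.IH)
qed (simp add: path_mean_0)

lemma path_mean_awlast_bigo:
  fixes h :: "'a \<Rightarrow> real"
  assumes "x \<in> verts G"
  shows "(\<lambda>n. path_mean n x (\<lambda>w. h (awlast x w))) \<in> O(\<lambda>_. 1)"
proof (rule bigoI[of _ "\<Sum>y\<in>verts G. \<bar>h y\<bar>"], rule always_eventually, rule allI)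
  have "\<bar>h y\<bar> \<le> (\<Sum>y\<in>verts G. \<bar>h y\<bar>)" if "y \<in> verts G" for y
    by (rule member_le_sum[OF that]) auto
  then show "norm (path_mean n x (\<lambda>w. h (awlast x w))) \<le> (\<Sum>y\<in>verts G. \<bar>h y\<bar>) * norm (1 :: real)" for n
    using norm_path_mean_le[OF assms, of n "\<lambda>w. h (awlast x w)"] awlast_in_verts_if_path by simp
qed

lemma output_sum_coboundary:
  assumes "w \<in> paths n x"
  shows "output_sum (coboundary G h) w = h (awlast x w) - h x"
  using assms sum_list_coboundary_awalk unfolding paths_def output_sum_def by fastforce

definition path_cov :: "nat \<Rightarrow> 'a \<Rightarrow> ('e list \<Rightarrow> real) \<Rightarrow> ('e list \<Rightarrow> real) \<Rightarrow> real" where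
  "path_cov n x f g = path_mean n x (\<lambda>w. (f w - path_mean n x f) * (g w - path_mean n x g))"

lemma path_cov_eq:
  assumes "x \<in> verts G"
  shows "path_cov n x f g = path_mean n x (\<lambda>w. f w * g w) - path_mean n x f * path_mean n x g"
proof -
  define a b where "a = path_mean n x f" and "b = path_mean n x g"
  have "path_cov n x f g = path_mean n x (\<lambda>w. f w * g w - b * f w - a * g w + a * b)"
    unfolding path_cov_def a_def[symmetric] b_def[symmetric] by (rule path_mean_cong) (simp add: algebra_simps)
  also have "\<dots> = path_mean n x (\<lambda>w. f w * g w) - a * b"
    by (simp add: path_mean_add path_mean_diff path_mean_mult_left path_mean_const[OF assms] a_def b_def)
  finally show ?thesis unfolding a_def b_def .
qed

definition centered :: "('e \<Rightarrow> real) \<Rightarrow> bool" where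
  "centered g \<longleftrightarrow> (\<forall>x\<in>verts G. arc_mean g x = 0)"

lemma centeredD: "centered g \<Longrightarrow> x \<in> verts G \<Longrightarrow> arc_mean g x = 0"
  unfolding centered_def by blast

lemma centered_linear:
  assumes "centered g" "centered h"
  shows "centered (\<lambda>e. a * g e + b * h e)"
  using assms unfolding centered_def by (simp add: arc_mean_add arc_mean_mult_left)

lemma path_mean_output_sum_Suc:
  "path_mean (Suc n) x (output_sum k) = arc_mean (\<lambda>e. k e + path_mean n (head G e) (output_sum k)) x"
  unfolding path_mean_Suc output_sum_Cons path_mean_add by (intro arc_mean_cong) (simp add: path_mean_const)

lemma path_mean_output_sum_centered:
  assumes "centered g" "x \<in> verts G"
  shows "path_mean n x (output_sum g) = 0"
  using assms(2)
proof (induction n arbitrary: x)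
  case (Suc n)
  have "path_mean (Suc n) x (output_sum g) = arc_mean g x"
    unfolding path_mean_output_sum_Suc by (intro arc_mean_cong) (simp add: Suc.IH)
  then show ?case using centeredD[OF assms(1) Suc.prems] by simp
qed (simp add: path_mean_0)

lemma path_mean_output_sum_mult_centered:
  assumes "centered g" "centered h" "x \<in> verts G"
  shows "path_mean n x (\<lambda>w. output_sum g w * output_sum h w) = path_mean n x (output_sum (\<lambda>e. g e * h e))"
  using assms(3)
proof (induction n arbitrary: x)
  case (Suc n)
  have "path_mean n y (\<lambda>w. output_sum g (e # w) * output_sum h (e # w)) =
    g e * h e + path_mean n y (output_sum (\<lambda>e. g e * h e))" if y: "y \<in> verts G" for y e
  proof -
    have "path_mean n y (\<lambda>w. output_sum g (e # w) * output_sum h (e # w)) =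
      path_mean n y (\<lambda>w. g e * h e + g e * output_sum h w + h e * output_sum g w +
          output_sum g w * output_sum h w)"
      by (rule path_mean_cong) (simp add: algebra_simps)
    then show ?thesis
      using Suc.IH[OF y] path_mean_output_sum_centered[OF assms(1) y]
        path_mean_output_sum_centered[OF assms(2) y]
      by (simp add: path_mean_add path_mean_mult_left path_mean_const[OF y])
  qed
  then show ?case unfolding path_mean_output_sum_Suc unfolding path_mean_Suc
    by (intro arc_mean_cong) simp
qed (simp add: path_mean_0)

text \<open>Since \<open>g\<close> is centred, \<open>h\<close> of the end state may be replaced, in each step, by its deviation from
  the value expected before the step, and these deviations decay.\<close>

lemma path_mean_output_sum_centered_mult_awlast_le:
  fixes h :: "'a \<Rightarrow> real"
  assumes g: "centered g" "\<And>e. e \<in> arcs G \<Longrightarrow> \<bar>g e\<bar> \<le> K" and "x \<in> verts G"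
  shows "\<bar>path_mean n x (\<lambda>w. output_sum g w * h (awlast x w))\<bar> \<le>
    (\<Sum>i<n. K * oscillation ((transition_op ^^ i) h))"
  using assms(3)
proof (induction n arbitrary: x)
  case (Suc n)
  let ?q = "(transition_op ^^ n) h" and ?m = "\<lambda>y. path_mean n y (\<lambda>w. output_sum g w * h (awlast y w))"
  let ?S = "\<Sum>i<n. K * oscillation ((transition_op ^^ i) h)"
  have first_step: "path_mean n y (\<lambda>w. output_sum g (e # w) * h (awlast y w)) = g e * ?q y + ?m y"
    if "y \<in> verts G" for e y
    by (simp add: distrib_right path_mean_add path_mean_mult_left path_mean_awlast[OF that])
  have "path_mean (Suc n) x (\<lambda>w. output_sum g w * h (awlast x w)) =
      arc_mean (\<lambda>e. g e * ?q (head G e) + ?m (head G e)) x"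
    unfolding path_mean_Suc by (intro arc_mean_cong) (simp add: first_step del: output_sum_Cons)
  also have "\<dots> = arc_mean (\<lambda>e. (g e * (?q (head G e) - ?q x) + ?m (head G e)) + ?q x * g e) x"
    by (intro arc_mean_cong) (simp add: algebra_simps)
  also have "\<dots> = arc_mean (\<lambda>e. g e * (?q (head G e) - ?q x) + ?m (head G e)) x"
    by (simp add: arc_mean_add arc_mean_mult_left centeredD[OF g(1) Suc.prems])
  finally have decomposition: "path_mean (Suc n) x (\<lambda>w. output_sum g w * h (awlast x w)) = \<dots>" .
  have "norm (arc_mean (\<lambda>e. g e * (?q (head G e) - ?q x) + ?m (head G e)) x) \<le> K * oscillation ?q + ?S"
  proof (rule norm_arc_mean_le[OF Suc.prems])
    fix e assume e: "e \<in> out_arcs G x"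
    then have "\<bar>g e * (?q (head G e) - ?q x)\<bar> \<le> K * oscillation ?q"
      unfolding abs_mult using g(2)[of e] abs_diff_le_oscillation[of "head G e" x ?q] Suc.prems
        order_trans[OF abs_ge_zero g(2)[of e]] by (intro mult_mono) auto
    moreover have "\<bar>?m (head G e)\<bar> \<le> ?S" using Suc.IH e by simp
    ultimately show "norm (g e * (?q (head G e) - ?q x) + ?m (head G e)) \<le> K * oscillation ?q + ?S"
      unfolding real_norm_def by linarith
  qed
  then show ?case unfolding decomposition by (simp add: add.commute)
qed (simp add: path_mean_0)

end

section \<open>Asymptotics of mean and covariance\<close>

context ergodic_digraph
begin

definition corrected :: "('e \<Rightarrow> real) \<Rightarrow> ('a \<Rightarrow> real) \<Rightarrow> 'e \<Rightarrow> real" where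
  "corrected k h e = k e - asymptotic_mean k + coboundary G h e"

lemma ex_centered_corrected: obtains h where "centered (corrected k h)"
proof -
  obtain h where h: "\<forall>x\<in>verts G. arc_mean (\<lambda>e. k e + coboundary G h e) x = asymptotic_mean k"
    by (rule poisson)
  have "corrected k h = (\<lambda>e. k e + coboundary G h e - asymptotic_mean k)"
    by (simp add: corrected_def fun_eq_iff)
  then have "centered (corrected k h)"
    using h by (simp add: centered_def arc_mean_diff arc_mean_const)
  then show ?thesis by (rule that)
qed

lemma output_sum_corrected:
  assumes "w \<in> paths n x"
  shows "output_sum (corrected k h) w =
    output_sum k w - asymptotic_mean k * real n + (h (awlast x w) - h x)"
proof -
  have "length w = n" using assms unfolding paths_def by simp
  then show ?thesis
    unfolding corrected_def by (simp add: output_sum_add output_sum_diff_const output_sum_coboundary[OF assms])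
qed

lemma path_mean_output_sum_eq:
  assumes "centered (corrected k h)" "x \<in> verts G"
  shows "path_mean n x (output_sum k) = asymptotic_mean k * real n + (h x - path_mean n x (\<lambda>w. h (awlast x w)))"
proof -
  have "0 = path_mean n x (output_sum (corrected k h))"
    by (rule path_mean_output_sum_centered[OF assms, symmetric])
  also have "\<dots> = path_mean n x (\<lambda>w. output_sum k w - asymptotic_mean k * real n + (h (awlast x w) - h x))"
    by (rule path_mean_cong) (rule output_sum_corrected)
  also have "\<dots> = path_mean n x (output_sum k) - asymptotic_mean k * real n +
      (path_mean n x (\<lambda>w. h (awlast x w)) - h x)"
    by (simp only: path_mean_add path_mean_diff path_mean_const[OF assms(2)])
  finally show ?thesis by simp
qed

lemma output_sum_deviation:
  assumes "centered (corrected k h)" "x \<in> verts G" "w \<in> paths n x"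
  shows "output_sum k w - path_mean n x (output_sum k) =
    output_sum (corrected k h) w - (h (awlast x w) - path_mean n x (\<lambda>w. h (awlast x w)))"
  using output_sum_corrected[OF assms(3), of k h] path_mean_output_sum_eq[OF assms(1,2), of n] by simp

theorem path_mean_output_sum_asymptotics:
  assumes x: "x \<in> verts G"
  shows "(\<lambda>n. path_mean n x (output_sum k) - asymptotic_mean k * real n) \<in> O(\<lambda>_. 1)"
proof -
  obtain h where h: "centered (corrected k h)" by (rule ex_centered_corrected)
  have "(\<lambda>n. h x - path_mean n x (\<lambda>w. h (awlast x w))) \<in> O(\<lambda>_. 1)"
    by (intro sum_in_bigo path_mean_awlast_bigo[OF x]) simp
  then show ?thesis by (simp add: path_mean_output_sum_eq[OF h x])
qed

lemma path_mean_output_sum_centered_mult_awlast_bigo: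
  assumes g: "centered g" and x: "x \<in> verts G"
  shows "(\<lambda>n. path_mean n x (\<lambda>w. output_sum g w * h (awlast x w))) \<in> O(\<lambda>_. 1)"
proof -
  define K where "K = (\<Sum>e\<in>arcs G. \<bar>g e\<bar>)"
  have K: "\<bar>g e\<bar> \<le> K" if "e \<in> arcs G" for e
    unfolding K_def by (rule member_le_sum[OF that]) auto
  define B where "B = (\<Sum>i. K * oscillation ((transition_op ^^ i) h))"
  have "(\<Sum>i<n. K * oscillation ((transition_op ^^ i) h)) \<le> B" for n
    unfolding B_def using oscillation_nonneg[OF x]
    by (intro sum_le_suminf summable_mult geometric_ergodicity)
      (auto simp: K_def intro!: mult_nonneg_nonneg sum_nonneg)
  then have "\<bar>path_mean n x (\<lambda>w. output_sum g w * h (awlast x w))\<bar> \<le> B" for n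
    using order_trans[OF path_mean_output_sum_centered_mult_awlast_le[OF g K x]] by blast
  then show ?thesis by (intro bigoI[of _ B]) simp
qed

definition asymptotic_cov :: "('e \<Rightarrow> real) \<Rightarrow> ('e \<Rightarrow> real) \<Rightarrow> real" where
  "asymptotic_cov k l = 1 / D1_sum (G \<restriction> final_verts) p (\<lambda>_. 1) *
    (D1_pair (G \<restriction> final_verts) p (\<lambda>e. k e - asymptotic_mean k) (\<lambda>e. l e - asymptotic_mean l) -
     D2_pair (G \<restriction> final_verts) p (\<lambda>e. k e - asymptotic_mean k) (\<lambda>e. l e - asymptotic_mean l))"

lemma asymptotic_cov_eq_mean_corrected:
  assumes "centered (corrected k h)" "centered (corrected l j)"
  shows "asymptotic_cov k l = asymptotic_mean (\<lambda>e. corrected k h e * corrected l j e)"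
proof -
  let ?F = "G \<restriction> final_verts" and ?k = "\<lambda>e. k e - asymptotic_mean k" and ?l = "\<lambda>e. l e - asymptotic_mean l"
  have mean_0: "final.arc_mean g x = 0" if "centered g" "x \<in> verts ?F" for g x
    using that final_verts_subset centeredD[OF that(1)] by (auto simp: final_arc_mean)
  have "corrected k h = (\<lambda>e. ?k e + coboundary ?F h e)" "corrected l j = (\<lambda>e. ?l e + coboundary ?F j e)"
    unfolding coboundary_final corrected_def by simp_all
  then have "D1_pair ?F p ?k ?l - D2_pair ?F p ?k ?l =
      D1_pair ?F p (corrected k h) (corrected l j) - D2_pair ?F p (corrected k h) (corrected l j)"
    by (simp only: D1_pair_add_coboundary[of ?F p ?k h ?l j] D2_pair_add_coboundary[of ?F p ?k h ?l j])
  also have "\<dots> = D1_sum ?F p (\<lambda>e. corrected k h e * corrected l j e)"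
    by (intro final.D1_pair_minus_D2_pair_if_arc_mean_0 mean_0 assms)
  finally show ?thesis unfolding asymptotic_cov_def asymptotic_mean_def by simp
qed

lemma asymptotic_cov_nonneg: "0 \<le> asymptotic_cov k k"
proof -
  obtain h where h: "centered (corrected k h)" by (rule ex_centered_corrected)
  show ?thesis unfolding asymptotic_cov_eq_mean_corrected[OF h h] by (rule asymptotic_mean_nonneg) simp
qed

lemma path_cov_output_sum_eq:
  assumes c: "centered (corrected k h)" "centered (corrected l j)" and x: "x \<in> verts G"
  shows "path_cov n x (output_sum k) (output_sum l) =
    path_mean n x (output_sum (\<lambda>e. corrected k h e * corrected l j e)) -
    path_mean n x (\<lambda>w. output_sum (corrected k h) w * j (awlast x w)) -
    path_mean n x (\<lambda>w. output_sum (corrected l j) w * h (awlast x w)) +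
    path_cov n x (\<lambda>w. h (awlast x w)) (\<lambda>w. j (awlast x w))"
proof -
  let ?g = "output_sum (corrected k h)" and ?f = "output_sum (corrected l j)"
  define a b where "a = path_mean n x (\<lambda>w. h (awlast x w))" and "b = path_mean n x (\<lambda>w. j (awlast x w))"
  have "path_cov n x (output_sum k) (output_sum l) =
      path_mean n x (\<lambda>w. (?g w - (h (awlast x w) - a)) * (?f w - (j (awlast x w) - b)))"
    unfolding path_cov_def a_def b_def
    by (rule path_mean_cong) (simp only: output_sum_deviation[OF c(1) x] output_sum_deviation[OF c(2) x])
  also have "\<dots> = path_mean n x (\<lambda>w. ?g w * ?f w - ?g w * j (awlast x w) + b * ?g w - ?f w * h (awlast x w)
      + a * ?f w + (h (awlast x w) - a) * (j (awlast x w) - b))"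
    by (rule path_mean_cong) (simp add: algebra_simps)
  finally show ?thesis
    by (simp add: path_mean_add path_mean_diff path_mean_mult_left path_mean_output_sum_centered[OF c(1) x]
        path_mean_output_sum_centered[OF c(2) x] path_mean_output_sum_mult_centered[OF c x]
        path_cov_def[of _ _ "\<lambda>w. h (awlast x w)"] a_def b_def)
qed

theorem path_cov_output_sum_asymptotics:
  assumes x: "x \<in> verts G"
  shows "(\<lambda>n. path_cov n x (output_sum k) (output_sum l) - asymptotic_cov k l * real n) \<in> O(\<lambda>_. 1)"
proof -
  obtain h where h: "centered (corrected k h)" by (rule ex_centered_corrected)
  obtain j where j: "centered (corrected l j)" by (rule ex_centered_corrected)
  let ?m = "\<lambda>n. path_mean n x (output_sum (\<lambda>e. corrected k h e * corrected l j e))"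
  have ends: "(\<lambda>n. path_cov n x (\<lambda>w. h (awlast x w)) (\<lambda>w. j (awlast x w))) \<in> O(\<lambda>_. 1)"
    unfolding path_cov_eq[OF x]
    using path_mean_awlast_bigo[OF x, of "\<lambda>y. h y * j y"]
      landau_o.big.mult[OF path_mean_awlast_bigo[OF x, of h] path_mean_awlast_bigo[OF x, of j]]
    by (intro sum_in_bigo) simp_all
  have mean: "(\<lambda>n. ?m n - asymptotic_cov k l * real n) \<in> O(\<lambda>_. 1)"
    unfolding asymptotic_cov_eq_mean_corrected[OF h j] by (rule path_mean_output_sum_asymptotics[OF x])
  have "(\<lambda>n. ?m n - asymptotic_cov k l * real n -
      path_mean n x (\<lambda>w. output_sum (corrected k h) w * j (awlast x w)) -
      path_mean n x (\<lambda>w. output_sum (corrected l j) w * h (awlast x w)) +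
      path_cov n x (\<lambda>w. h (awlast x w)) (\<lambda>w. j (awlast x w))) \<in> O(\<lambda>_. 1)"
    by (rule sum_in_bigo(1)[OF sum_in_bigo(2)[OF sum_in_bigo(2)[OF mean]] ends])
       (rule path_mean_output_sum_centered_mult_awlast_bigo[OF _ x], fact)+
  then show ?thesis by (simp add: path_cov_output_sum_eq[OF h j x] algebra_simps)
qed

end

section \<open>The characteristic function of a centred output sum\<close>

lemma norm_iexp_diff_le: "norm (iexp a - iexp b) \<le> \<bar>a - b\<bar>"
proof -
  have "iexp a - iexp b = iexp b * (iexp (a - b) - 1)"
    by (simp add: right_diff_distrib exp_add[symmetric] algebra_simps)
  then have "norm (iexp a - iexp b) = norm (iexp (a - b) - 1)"
    by (simp only: norm_mult norm_exp_i_times mult_1_left)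
  then show ?thesis using iexp_approx1[of "a - b" 0] by simp
qed

lemma norm_iexp_taylor2_le:
  "norm (iexp y - (1 + \<i> * complex_of_real y - complex_of_real (y\<^sup>2 / 2))) \<le> \<bar>y\<bar> ^ 3 / 6"
proof -
  have "(\<Sum>k\<le>2. f k) = f 0 + f 1 + f 2" for f :: "nat \<Rightarrow> complex"
    by (simp add: numeral_2_eq_2)
  then have "(\<Sum>k\<le>2. (\<i> * complex_of_real y) ^ k / fact k) =
    1 + \<i> * complex_of_real y - complex_of_real (y\<^sup>2 / 2)"
    by (simp add: power_mult_distrib)
  then show ?thesis using iexp_approx1[of y 2] by (simp add: fact_numeral)
qed

lemma norm_iexp_mult_perturbation_le:
  assumes g: "\<bar>g\<bar> \<le> K" and u: "\<bar>u\<bar> \<le> U"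
  shows "norm (iexp (\<theta> * g) * complex_of_real (1 + \<theta>\<^sup>2 / 2 * u) -
    (complex_of_real (1 + \<theta>\<^sup>2 / 2 * (u - g\<^sup>2)) + \<i> * complex_of_real (\<theta> * g)))
    \<le> (K ^ 3 / 6 + K * U / 2) * \<bar>\<theta>\<bar> ^ 3"
proof -
  let ?y = "\<theta> * g"
  let ?R = "iexp ?y - (1 + \<i> * complex_of_real ?y - complex_of_real (?y\<^sup>2 / 2))"
  let ?S = "(iexp ?y - 1) * complex_of_real (\<theta>\<^sup>2 / 2 * u)"
  have y: "\<bar>?y\<bar> \<le> \<bar>\<theta>\<bar> * K" unfolding abs_mult using g by (intro mult_left_mono) auto
  have "norm ?R \<le> \<bar>?y\<bar> ^ 3 / 6" by (rule norm_iexp_taylor2_le)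
  also have "\<dots> \<le> (\<bar>\<theta>\<bar> * K) ^ 3 / 6" using y by (intro divide_right_mono power_mono) auto
  finally have R: "norm ?R \<le> K ^ 3 / 6 * \<bar>\<theta>\<bar> ^ 3" by (simp add: power_mult_distrib mult.commute)
  have "norm (iexp ?y - 1) \<le> \<bar>\<theta>\<bar> * K" using norm_iexp_diff_le[of ?y 0] y by simp
  moreover have "\<bar>\<theta>\<^sup>2 / 2 * u\<bar> \<le> \<bar>\<theta>\<bar>\<^sup>2 / 2 * U" using u by (simp add: abs_mult mult_left_mono)
  ultimately have "norm ?S \<le> (\<bar>\<theta>\<bar> * K) * (\<bar>\<theta>\<bar>\<^sup>2 / 2 * U)"
    unfolding norm_mult norm_of_real using order_trans[OF abs_ge_zero g] by (intro mult_mono) auto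
  then have S: "norm ?S \<le> K * U / 2 * \<bar>\<theta>\<bar> ^ 3"
    by (simp add: power2_eq_square power3_eq_cube mult_ac del: abs_mult_self_eq)
  have "iexp ?y * complex_of_real (1 + \<theta>\<^sup>2 / 2 * u) -
      (complex_of_real (1 + \<theta>\<^sup>2 / 2 * (u - g\<^sup>2)) + \<i> * complex_of_real ?y) = ?R + ?S"
    by (simp add: field_simps power_mult_distrib)
  then show ?thesis
    using norm_triangle_mono[OF R S] by (simp only: distrib_right)
qed

context stochastic_digraph
begin

definition twisted_op :: "real \<Rightarrow> ('e \<Rightarrow> real) \<Rightarrow> ('a \<Rightarrow> complex) \<Rightarrow> 'a \<Rightarrow> complex" where
  "twisted_op \<theta> g \<phi> x = arc_mean (\<lambda>e. iexp (\<theta> * g e) * \<phi> (head G e)) x"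

lemma path_mean_iexp_output_sum_Suc:
  "path_mean (Suc n) x (\<lambda>w. iexp (\<theta> * output_sum g w)) =
    twisted_op \<theta> g (\<lambda>y. path_mean n y (\<lambda>w. iexp (\<theta> * output_sum g w))) x"
  unfolding path_mean_Suc twisted_op_def path_mean_mult_left[symmetric]
  by (simp add: distrib_left exp_add)

lemma norm_twisted_op_le:
  assumes "x \<in> verts G" "\<And>y. y \<in> verts G \<Longrightarrow> norm (\<phi> y) \<le> B"
  shows "norm (twisted_op \<theta> g \<phi> x) \<le> B"
  unfolding twisted_op_def using assms by (intro norm_arc_mean_le) (auto simp: norm_mult)

lemma path_mean_iexp_approx_eigenvector:
  assumes start: "\<And>y. y \<in> verts G \<Longrightarrow> norm (1 - \<phi> y) \<le> B"
    and eigen: "\<And>y. y \<in> verts G \<Longrightarrow> norm (twisted_op \<theta> g \<phi> y - \<rho> * \<phi> y) \<le> \<epsilon>"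
    and "norm \<rho> \<le> 1" and "x \<in> verts G"
  shows "norm (path_mean n x (\<lambda>w. iexp (\<theta> * output_sum g w)) - \<rho> ^ n * \<phi> x) \<le> B + real n * \<epsilon>"
  using assms(4)
proof (induction n arbitrary: x)
  case 0
  then show ?case using start[OF 0] by (simp add: path_mean_0)
next
  case (Suc n)
  let ?m = "\<lambda>y. path_mean n y (\<lambda>w. iexp (\<theta> * output_sum g w))"
  have linear: "twisted_op \<theta> g (\<lambda>y. ?m y - \<rho> ^ n * \<phi> y) x = twisted_op \<theta> g ?m x - \<rho> ^ n * twisted_op \<theta> g \<phi> x"
    unfolding twisted_op_def arc_mean_mult_left[symmetric] arc_mean_diff[symmetric]
    by (simp add: right_diff_distrib mult.left_commute)
  have "norm (twisted_op \<theta> g (\<lambda>y. ?m y - \<rho> ^ n * \<phi> y) x) \<le> B + real n * \<epsilon>"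
    using Suc by (intro norm_twisted_op_le)
  moreover have "norm (\<rho> ^ n * (twisted_op \<theta> g \<phi> x - \<rho> * \<phi> x)) \<le> 1 * \<epsilon>"
    unfolding norm_mult norm_power using eigen[OF Suc.prems] \<open>norm \<rho> \<le> 1\<close>
    by (intro mult_mono power_le_one) auto
  ultimately have "norm (twisted_op \<theta> g (\<lambda>y. ?m y - \<rho> ^ n * \<phi> y) x + \<rho> ^ n * (twisted_op \<theta> g \<phi> x - \<rho> * \<phi> x))
      \<le> (B + real n * \<epsilon>) + 1 * \<epsilon>"
    by (rule norm_triangle_mono)
  then show ?case
    unfolding linear path_mean_iexp_output_sum_Suc by (simp add: algebra_simps)
qed

lemma norm_twisted_op_perturbation_le:
  fixes u :: "'a \<Rightarrow> real"
  assumes x: "x \<in> verts G" and centered: "centered g" and g: "\<And>e. e \<in> arcs G \<Longrightarrow> \<bar>g e\<bar> \<le> K"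
    and u: "\<And>y. y \<in> verts G \<Longrightarrow> \<bar>u y\<bar> \<le> U" and "0 \<le> v"
    and poisson: "arc_mean (\<lambda>e. u (head G e) - (g e)\<^sup>2) x = u x - v" and \<theta>: "\<bar>\<theta>\<bar> \<le> 1"
  shows "norm (twisted_op \<theta> g (\<lambda>y. complex_of_real (1 + \<theta>\<^sup>2 / 2 * u y)) x -
      complex_of_real (1 - \<theta>\<^sup>2 / 2 * v) * complex_of_real (1 + \<theta>\<^sup>2 / 2 * u x))
    \<le> (K ^ 3 / 6 + K * U / 2 + U * v / 4) * \<bar>\<theta>\<bar> ^ 3"
proof -
  let ?T = "\<lambda>e. complex_of_real (1 + \<theta>\<^sup>2 / 2 * (u (head G e) - (g e)\<^sup>2)) + \<i> * complex_of_real (\<theta> * g e)"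
  let ?L = "twisted_op \<theta> g (\<lambda>y. complex_of_real (1 + \<theta>\<^sup>2 / 2 * u y)) x"
  let ?m = "1 + \<theta>\<^sup>2 / 2 * (u x - v)"
  have "arc_mean ?T x = complex_of_real (arc_mean (\<lambda>e. 1 + \<theta>\<^sup>2 / 2 * (u (head G e) - (g e)\<^sup>2)) x) +
      \<i> * complex_of_real (arc_mean (\<lambda>e. \<theta> * g e) x)"
    by (simp only: arc_mean_add arc_mean_mult_left arc_mean_of_real)
  also have "\<dots> = complex_of_real ?m"
    by (simp only: arc_mean_add arc_mean_mult_left arc_mean_const[OF x] poisson centeredD[OF centered x]) simp
  finally have "?L - complex_of_real ?m =
      arc_mean (\<lambda>e. iexp (\<theta> * g e) * complex_of_real (1 + \<theta>\<^sup>2 / 2 * u (head G e)) - ?T e) x"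
    unfolding twisted_op_def arc_mean_diff by simp
  then have main: "norm (?L - complex_of_real ?m) \<le> (K ^ 3 / 6 + K * U / 2) * \<bar>\<theta>\<bar> ^ 3"
    using g u by (simp only:) (intro norm_arc_mean_le[OF x] norm_iexp_mult_perturbation_le; simp)
  have "?m - (1 - \<theta>\<^sup>2 / 2 * v) * (1 + \<theta>\<^sup>2 / 2 * u x) = \<theta> ^ 4 * (u x * v / 4)"
    by (simp add: field_simps power2_eq_square power4_eq_xxxx)
  moreover have "\<bar>\<theta> ^ 4 * (u x * v / 4)\<bar> \<le> \<bar>\<theta>\<bar> ^ 3 * (U * v / 4)"
    unfolding abs_mult power_abs using \<theta> u[OF x] \<open>0 \<le> v\<close>
    by (intro mult_mono power_decreasing) (auto simp: abs_mult intro!: mult_right_mono)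
  ultimately have rest: "norm (complex_of_real ?m
      - complex_of_real (1 - \<theta>\<^sup>2 / 2 * v) * complex_of_real (1 + \<theta>\<^sup>2 / 2 * u x))
      \<le> \<bar>\<theta>\<bar> ^ 3 * (U * v / 4)"
    unfolding of_real_mult[symmetric] of_real_diff[symmetric] norm_of_real by (simp only:)
  show ?thesis using norm_diff_triangle_le[OF main rest] by (simp add: algebra_simps)
qed

lemma norm_path_mean_iexp_minus_power_le:
  fixes u :: "'a \<Rightarrow> real"
  assumes centered: "centered g" and g: "\<And>e. e \<in> arcs G \<Longrightarrow> \<bar>g e\<bar> \<le> K"
    and u: "\<And>y. y \<in> verts G \<Longrightarrow> \<bar>u y\<bar> \<le> U" and v: "0 \<le> v"
    and poisson: "\<And>y. y \<in> verts G \<Longrightarrow> arc_mean (\<lambda>e. u (head G e) - (g e)\<^sup>2) y = u y - v"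
    and \<theta>: "\<bar>\<theta>\<bar> \<le> 1" "\<theta>\<^sup>2 / 2 * v \<le> 1" and x: "x \<in> verts G"
  shows "norm (path_mean n x (\<lambda>w. iexp (\<theta> * output_sum g w)) - complex_of_real ((1 - \<theta>\<^sup>2 / 2 * v) ^ n))
    \<le> U * \<theta>\<^sup>2 + real n * ((K ^ 3 / 6 + K * U / 2 + U * v / 4) * \<bar>\<theta>\<bar> ^ 3)"
proof -
  let ?l = "complex_of_real (1 - \<theta>\<^sup>2 / 2 * v)" and ?b = "\<lambda>y. complex_of_real (1 + \<theta>\<^sup>2 / 2 * u y)"
  have l: "norm ?l \<le> 1" unfolding norm_of_real using \<theta>(2) v by simp
  have perturbation: "norm (1 - ?b y) \<le> U * \<theta>\<^sup>2 / 2" if "y \<in> verts G" for y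
  proof -
    have "1 - ?b y = complex_of_real (- (u y * (\<theta>\<^sup>2 / 2)))" by simp
    then have "norm (1 - ?b y) = \<bar>u y * (\<theta>\<^sup>2 / 2)\<bar>" by (simp only: norm_of_real abs_minus_cancel)
    also have "\<dots> = \<bar>u y\<bar> * (\<theta>\<^sup>2 / 2)" by (simp add: abs_mult)
    finally show ?thesis using mult_right_mono[OF u[OF that], of "\<theta>\<^sup>2 / 2"] by simp
  qed
  have approx: "norm (path_mean n x (\<lambda>w. iexp (\<theta> * output_sum g w)) - ?l ^ n * ?b x)
      \<le> U * \<theta>\<^sup>2 / 2 + real n * ((K ^ 3 / 6 + K * U / 2 + U * v / 4) * \<bar>\<theta>\<bar> ^ 3)"
    using norm_twisted_op_perturbation_le[OF _ centered g u v poisson \<theta>(1)]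
    by (intro path_mean_iexp_approx_eigenvector perturbation l x) simp_all
  have "?l ^ n * ?b x - ?l ^ n = - (?l ^ n * (1 - ?b x))"
    by (simp only: right_diff_distrib mult_1_right minus_diff_eq)
  then have "norm (?l ^ n * ?b x - ?l ^ n) = norm ?l ^ n * norm (1 - ?b x)"
    by (simp only: norm_minus_cancel norm_mult norm_power)
  also have "\<dots> \<le> 1 * (U * \<theta>\<^sup>2 / 2)"
    using l perturbation[OF x] by (intro mult_mono power_le_one) auto
  finally have "norm (?l ^ n * ?b x - ?l ^ n) \<le> U * \<theta>\<^sup>2 / 2" by simp
  from norm_diff_triangle_le[OF approx this] show ?thesis by (simp add: algebra_simps)
qed

end

context ergodic_digraph
begin

lemma ex_poisson_potential:
  obtains u where "\<forall>x\<in>verts G. arc_mean (\<lambda>e. u (head G e) - k e) x = u x - asymptotic_mean k"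
proof -
  obtain h where h: "\<forall>x\<in>verts G. arc_mean (\<lambda>e. k e + coboundary G h e) x = asymptotic_mean k"
    by (rule poisson)
  have "arc_mean (\<lambda>e. - h (head G e) - k e) x = - h x - asymptotic_mean k" if x: "x \<in> verts G" for x
  proof -
    have "arc_mean (\<lambda>e. - h (head G e) - k e) x = arc_mean (\<lambda>e. - h x - (k e + coboundary G h e)) x"
      by (rule arc_mean_cong) (auto simp: coboundary_def)
    then show ?thesis using h x by (simp add: arc_mean_diff arc_mean_const)
  qed
  then show ?thesis using that[of "\<lambda>x. - h x"] by blast
qed

text \<open>The twisted operator has the approximate eigenvector \<open>1 + \<theta>\<^sup>2 u / 2\<close> with eigenvalue
  \<open>1 - \<theta>\<^sup>2 v / 2\<close>, where \<open>u\<close> is a potential for \<open>g\<^sup>2\<close>.\<close>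

lemma ex_characteristic_function_estimate:
  assumes "centered g"
  defines "v \<equiv> asymptotic_mean (\<lambda>e. (g e)\<^sup>2)"
  obtains U C where "\<forall>\<theta> n. \<forall>x\<in>verts G. \<bar>\<theta>\<bar> \<le> 1 \<longrightarrow> \<theta>\<^sup>2 / 2 * v \<le> 1 \<longrightarrow>
    norm (path_mean n x (\<lambda>w. iexp (\<theta> * output_sum g w)) - complex_of_real ((1 - \<theta>\<^sup>2 / 2 * v) ^ n))
      \<le> U * \<theta>\<^sup>2 + real n * (C * \<bar>\<theta>\<bar> ^ 3)"
proof -
  have v: "0 \<le> v" unfolding v_def by (rule asymptotic_mean_nonneg) simp
  obtain u where poisson: "\<forall>x\<in>verts G. arc_mean (\<lambda>e. u (head G e) - (g e)\<^sup>2) x = u x - v"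
    unfolding v_def by (rule ex_poisson_potential)
  define K where "K = (\<Sum>e\<in>arcs G. \<bar>g e\<bar>)"
  define U where "U = (\<Sum>y\<in>verts G. \<bar>u y\<bar>)"
  have g: "\<bar>g e\<bar> \<le> K" if "e \<in> arcs G" for e unfolding K_def by (rule member_le_sum[OF that]) auto
  have u: "\<bar>u y\<bar> \<le> U" if "y \<in> verts G" for y unfolding U_def by (rule member_le_sum[OF that]) auto
  show ?thesis
    using that[of U "K ^ 3 / 6 + K * U / 2 + U * v / 4"]
      norm_path_mean_iexp_minus_power_le[OF assms(1) g u v poisson[rule_format]] by blast
qed

theorem characteristic_function_limit:
  assumes centered: "centered g" and x: "x \<in> verts G"
  shows "(\<lambda>n. path_mean n x (\<lambda>w. iexp (output_sum g w / sqrt (real n)))) \<longlonglongrightarrow>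
    complex_of_real (exp (- asymptotic_mean (\<lambda>e. (g e)\<^sup>2) / 2))"
proof -
  define v where "v = asymptotic_mean (\<lambda>e. (g e)\<^sup>2)"
  let ?m = "\<lambda>n. path_mean n x (\<lambda>w. iexp (output_sum g w / sqrt (real n)))"
  let ?l = "\<lambda>n. complex_of_real ((1 + (- v / 2) / real n) ^ n)"
  obtain U C where estimate: "\<forall>\<theta> n. \<forall>x\<in>verts G. \<bar>\<theta>\<bar> \<le> 1 \<longrightarrow> \<theta>\<^sup>2 / 2 * v \<le> 1 \<longrightarrow>
    norm (path_mean n x (\<lambda>w. iexp (\<theta> * output_sum g w)) - complex_of_real ((1 - \<theta>\<^sup>2 / 2 * v) ^ n))
      \<le> U * \<theta>\<^sup>2 + real n * (C * \<bar>\<theta>\<bar> ^ 3)"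
    unfolding v_def by (rule ex_characteristic_function_estimate[OF centered])
  have difference: "(\<lambda>n. ?m n - ?l n) \<longlonglongrightarrow> 0"
  proof (rule Lim_null_comparison)
    show "(\<lambda>n. U / real n + C / sqrt (real n)) \<longlonglongrightarrow> 0" by real_asymp
    show "\<forall>\<^sub>F n in sequentially. norm (?m n - ?l n) \<le> U / real n + C / sqrt (real n)"
      using eventually_ge_at_top[of "max 1 (nat \<lceil>v\<rceil>)"]
    proof eventually_elim
      case (elim n)
      then have n: "1 \<le> n" "v \<le> real n" by linarith+
      let ?t = "1 / sqrt (real n)"
      have square: "?t\<^sup>2 = 1 / real n" using n by (simp add: power_divide)
      have t: "\<bar>?t\<bar> \<le> 1" "?t\<^sup>2 / 2 * v \<le> 1" unfolding square using n by (auto simp: field_simps)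
      have "real n * (C * \<bar>?t\<bar> ^ 3) = C * ?t * (real n * ?t\<^sup>2)"
        using n by (simp add: power3_eq_cube power2_eq_square)
      then have "real n * (C * \<bar>?t\<bar> ^ 3) = C / sqrt (real n)" unfolding square using n by simp
      moreover have "1 - ?t\<^sup>2 / 2 * v = 1 + (- v / 2) / real n" unfolding square by simp
      ultimately show ?case
        using estimate[rule_format, OF x t, of n] unfolding square by (simp add: mult.commute)
    qed
  qed
  have "?l \<longlonglongrightarrow> complex_of_real (exp (- v / 2))"
    by (intro tendsto_of_real tendsto_exp_limit_sequentially)
  then show ?thesis unfolding v_def[symmetric] using difference by (rule Lim_transform)
qed

end

section \<open>Weak convergence and characteristic functions in Euclidean space\<close>

locale euclidean_distribution = prob_space M for M :: "'a::euclidean_space measure" +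
  assumes sets_eq_borel [simp, measurable_cong]: "sets M = sets borel"
begin

lemma borel_measurable_if_continuous:
  fixes f :: "'a \<Rightarrow> 'b::topological_space"
  shows "continuous_on UNIV f \<Longrightarrow> f \<in> borel_measurable M"
  using borel_measurable_continuous_onI measurable_cong_sets[OF sets_eq_borel refl] by blast

lemma integrable_if_continuous_bounded:
  fixes f :: "'a \<Rightarrow> 'b::{banach, second_countable_topology}"
  shows "continuous_on UNIV f \<Longrightarrow> (\<And>z. norm (f z) \<le> B) \<Longrightarrow> integrable M f"
  by (rule integrable_const_bound[where B = B]) (auto simp: borel_measurable_if_continuous)

lemma abs_integral_diff_le:
  fixes f g w :: "'a \<Rightarrow> real"
  assumes "integrable M f" "integrable M g" "integrable M w"
    and "\<And>z. \<bar>f z - g z\<bar> \<le> \<epsilon> + b * w z" and "(LINT z|M. w z) \<le> C" "0 \<le> b"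
  shows "\<bar>(LINT z|M. f z) - (LINT z|M. g z)\<bar> \<le> \<epsilon> + b * C"
proof -
  have "\<bar>(LINT z|M. f z) - (LINT z|M. g z)\<bar> = \<bar>LINT z|M. f z - g z\<bar>"
    using assms(1,2) by simp
  also have "\<dots> \<le> (LINT z|M. \<bar>f z - g z\<bar>)" by (rule integral_abs_bound)
  also have "\<dots> \<le> (LINT z|M. \<epsilon> + b * w z)" using assms(1-4) by (intro integral_mono) auto
  also have "\<dots> = \<epsilon> + b * (LINT z|M. w z)" using assms(3) by (simp add: prob_space)
  also have "\<dots> \<le> \<epsilon> + b * C" using assms(5,6) by (simp add: mult_left_mono)
  finally show ?thesis .
qed

end

definition char_vec :: "'a::euclidean_space measure \<Rightarrow> 'a \<Rightarrow> complex" where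
  "char_vec M s = (CLINT z|M. iexp (s \<bullet> z))"

definition weakly_converges :: "(nat \<Rightarrow> 'a::topological_space measure) \<Rightarrow> 'a measure \<Rightarrow> bool" where
  "weakly_converges N L \<longleftrightarrow> (\<forall>f :: 'a \<Rightarrow> real. continuous_on UNIV f \<and> bounded (range f) \<longrightarrow>
    (\<lambda>n. LINT z|N n. f z) \<longlonglongrightarrow> (LINT z|L. f z))"

lemma weak_conv_2d_eq: "weak_conv_2d = weakly_converges"
  unfolding weak_conv_2d_def weakly_converges_def by (simp add: fun_eq_iff)

lemma char_vec_tendsto_if_weakly_converges:
  fixes L :: "'a::euclidean_space measure"
  assumes N: "\<And>n. euclidean_distribution (N n)" and L: "euclidean_distribution L"
    and conv: "weakly_converges N L"
  shows "(\<lambda>n. char_vec (N n) s) \<longlonglongrightarrow> char_vec L s"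
proof -
  have char_vec: "char_vec M s =
      complex_of_real (LINT z|M. cos (s \<bullet> z)) + \<i> * complex_of_real (LINT z|M. sin (s \<bullet> z))"
    if "euclidean_distribution M" for M :: "'a measure"
  proof -
    interpret euclidean_distribution M by fact
    have "integrable M (\<lambda>z. cos (s \<bullet> z))" "integrable M (\<lambda>z. sin (s \<bullet> z))"
      by (auto intro!: integrable_if_continuous_bounded[of _ 1] continuous_intros)
    moreover have "iexp (s \<bullet> z) = complex_of_real (cos (s \<bullet> z)) + \<i> * complex_of_real (sin (s \<bullet> z))" for z
      unfolding cis_conv_exp[symmetric] by (simp add: complex_eq_iff)
    ultimately show ?thesis
      unfolding char_vec_def
      by (simp only:) (subst Bochner_Integration.integral_add, auto simp: complex_of_real_integrable_eq)
  qed
  have "(\<lambda>n. LINT z|N n. f z) \<longlonglongrightarrow> (LINT z|L. f z)"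
    if "continuous_on UNIV f" "\<And>z. \<bar>f z\<bar> \<le> 1" for f :: "'a \<Rightarrow> real"
  proof -
    have "bounded (range f)" using that(2) by (intro boundedI[of _ 1]) auto
    then show ?thesis using conv that(1) unfolding weakly_converges_def by blast
  qed
  then have "(\<lambda>n. LINT z|N n. cos (s \<bullet> z)) \<longlonglongrightarrow> (LINT z|L. cos (s \<bullet> z))"
    "(\<lambda>n. LINT z|N n. sin (s \<bullet> z)) \<longlonglongrightarrow> (LINT z|L. sin (s \<bullet> z))"
    by (simp_all add: continuous_intros)
  then show ?thesis unfolding char_vec[OF N] char_vec[OF L] by (intro tendsto_intros)
qed

inductive trig_poly :: "('a::euclidean_space \<Rightarrow> complex) \<Rightarrow> bool" where
  monomial: "trig_poly (\<lambda>z. c * iexp (s \<bullet> z))"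
| add: "trig_poly f \<Longrightarrow> trig_poly g \<Longrightarrow> trig_poly (\<lambda>z. f z + g z)"

lemma trig_poly_const: "trig_poly (\<lambda>_. c)"
  using trig_poly.monomial[of c 0] by simp

lemma trig_poly_mult:
  assumes "trig_poly f" "trig_poly g"
  shows "trig_poly (\<lambda>z. f z * g z)"
  using assms(1)
proof (induction f rule: trig_poly.induct)
  case (monomial c s)
  show ?case using assms(2)
  proof (induction g rule: trig_poly.induct)
    case (monomial d t)
    have "(\<lambda>z. c * iexp (s \<bullet> z) * (d * iexp (t \<bullet> z))) = (\<lambda>z. (c * d) * iexp ((s + t) \<bullet> z))"
      by (simp add: fun_eq_iff inner_add_left distrib_left exp_add)
    then show ?case by (simp only: trig_poly.monomial)
  next
    case (add f g)
    then show ?case using trig_poly.add[OF add.IH] by (simp only: distrib_left)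
  qed
next
  case (add f g)
  then show ?case using trig_poly.add[OF add.IH] by (simp only: distrib_right)
qed

lemma trig_poly_sum:
  "finite A \<Longrightarrow> (\<And>a. a \<in> A \<Longrightarrow> trig_poly (f a)) \<Longrightarrow> trig_poly (\<lambda>z. \<Sum>a\<in>A. f a z)"
  by (induction A rule: finite_induct) (auto intro: trig_poly_const trig_poly.add)

lemma trig_poly_sin: "trig_poly (\<lambda>z. complex_of_real (sin (s \<bullet> z)))"
proof -
  have "complex_of_real (sin a) = (- \<i> / 2) * iexp a + (\<i> / 2) * iexp (- a)" for a
    unfolding cis_conv_exp[symmetric] by (simp add: complex_eq_iff)
  then have "(\<lambda>z. complex_of_real (sin (s \<bullet> z))) =
      (\<lambda>z. (- \<i> / 2) * iexp (s \<bullet> z) + (\<i> / 2) * iexp ((- s) \<bullet> z))"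
    by (simp only: inner_minus_left)
  then show ?thesis by (simp only:) (rule trig_poly.add; rule trig_poly.monomial)
qed

definition sines :: "real \<Rightarrow> 'a::euclidean_space \<Rightarrow> 'a" where
  "sines \<omega> z = (\<Sum>b\<in>Basis. sin (\<omega> * (b \<bullet> z)) *\<^sub>R b)"

lemma trig_poly_polynomial_sines:
  fixes P :: "'a::euclidean_space \<Rightarrow> real"
  assumes "real_polynomial_function P"
  shows "trig_poly (\<lambda>z. complex_of_real (P (sines \<omega> z)))"
  using assms
proof (induction P rule: real_polynomial_function.induct)
  case (linear h)
  interpret bounded_linear h by fact
  have "(\<lambda>z. complex_of_real (h (sines \<omega> z))) =
      (\<lambda>z. \<Sum>b\<in>Basis. complex_of_real (h b) * complex_of_real (sin ((\<omega> *\<^sub>R b) \<bullet> z)))"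
    by (simp add: fun_eq_iff sines_def sum scaleR mult.commute)
  then show ?case
    by (simp only:) (intro trig_poly_sum trig_poly_mult trig_poly_const trig_poly_sin finite_Basis)
next
  case (const c)
  then show ?case by (rule trig_poly_const)
next
  case (add f g)
  then show ?case using trig_poly.add[OF add.IH] by (simp only: of_real_add)
next
  case (mult f g)
  then show ?case using trig_poly_mult[OF mult.IH] by (simp only: of_real_mult)
qed

lemma (in euclidean_distribution) integrable_trig_poly:
  assumes "trig_poly f"
  shows "integrable M f"
  using assms
proof (induction rule: trig_poly.induct)
  case (monomial c s)
  show ?case
    by (rule integrable_if_continuous_bounded[of _ "cmod c"]) (auto simp: norm_mult intro!: continuous_intros)
qed simp

lemma integral_trig_poly_tendsto:
  fixes L :: "'a::euclidean_space measure"
  assumes N: "\<And>n. euclidean_distribution (N n)" and L: "euclidean_distribution L"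
    and char: "\<And>s. (\<lambda>n. char_vec (N n) s) \<longlonglongrightarrow> char_vec L s" and f: "trig_poly f"
  shows "(\<lambda>n. CLINT z|N n. f z) \<longlonglongrightarrow> (CLINT z|L. f z)"
  using f
proof (induction rule: trig_poly.induct)
  case (monomial c s)
  show ?case using tendsto_mult_left[OF char[of s], of c] unfolding char_vec_def by simp
next
  case (add f g)
  then show ?case
    using tendsto_add[OF add.IH] euclidean_distribution.integrable_trig_poly[OF N]
      euclidean_distribution.integrable_trig_poly[OF L]
    by (simp add: Bochner_Integration.integral_add)
qed

lemma arcsin_sin_scaled:
  fixes R :: real
  assumes "0 < R" "\<bar>x\<bar> \<le> R"
  shows "arcsin (sin (pi / (2 * R) * x)) / (pi / (2 * R)) = x"
proof -
  have "\<bar>pi / (2 * R) * x\<bar> \<le> pi / (2 * R) * R"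
    unfolding abs_mult using assms by (intro mult_mono) auto
  then have "\<bar>pi / (2 * R) * x\<bar> \<le> pi / 2" using assms(1) by simp
  then have "arcsin (sin (pi / (2 * R) * x)) = pi / (2 * R) * x" by (intro arcsin_sin; linarith)
  then show ?thesis using assms(1) by simp
qed

definition arcsines :: "real \<Rightarrow> 'a::euclidean_space \<Rightarrow> 'a" where
  "arcsines \<omega> q = (\<Sum>b\<in>Basis. (arcsin (q \<bullet> b) / \<omega>) *\<^sub>R b)"

lemma sines_in_cbox: "sines \<omega> z \<in> cbox (- One) One"
  by (simp add: sines_def mem_box)

lemma arcsines_sines:
  assumes "0 < R" "norm z \<le> R"
  shows "arcsines (pi / (2 * R)) (sines (pi / (2 * R)) z) = z"
proof -
  have "arcsin (sines (pi / (2 * R)) z \<bullet> b) / (pi / (2 * R)) = z \<bullet> b" if "b \<in> Basis" for b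
  proof -
    have "sines (pi / (2 * R)) z \<bullet> b = sin (pi / (2 * R) * (z \<bullet> b))"
      using that by (simp add: sines_def inner_commute[of z b])
    then show ?thesis
      using arcsin_sin_scaled[OF assms(1) order_trans[OF Basis_le_norm[OF that] assms(2)]] by (simp only:)
  qed
  then show ?thesis by (simp add: arcsines_def euclidean_representation)
qed

text \<open>Folding space into a box by \<open>arcsines \<omega> \<circ> sines \<omega>\<close> turns a bounded continuous function into a
  continuous function of the \<open>sin (\<omega> x)\<close>, hence by Weierstrass into a uniform limit of trigonometric
  polynomials; outside the box the second moment controls the error.\<close>

lemma ex_trig_poly_close:
  fixes f :: "'a::euclidean_space \<Rightarrow> real"
  assumes cont: "continuous_on UNIV f" and B: "\<And>z. \<bar>f z\<bar> \<le> B" and "0 < R" "0 < \<delta>"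
  obtains Q where "trig_poly (\<lambda>z. complex_of_real (Q z))"
    "\<forall>z. \<bar>f z - Q z\<bar> \<le> \<delta> + 2 * B / R\<^sup>2 * (norm z)\<^sup>2"
proof -
  let ?\<omega> = "pi / (2 * R)"
  have "continuous_on (cbox (- One) One) (\<lambda>q. f (arcsines ?\<omega> q))"
    unfolding arcsines_def using \<open>0 < R\<close>
    by (intro continuous_on_compose2[OF cont] continuous_intros) (auto simp: mem_box)
  then obtain P where P: "real_polynomial_function P"
    "\<And>q. q \<in> cbox (- One) One \<Longrightarrow> \<bar>f (arcsines ?\<omega> q) - P q\<bar> < \<delta>"
    using Stone_Weierstrass_real_polynomial_function[OF compact_cbox _ \<open>0 < \<delta>\<close>] by metis
  have "\<bar>f z - f (arcsines ?\<omega> (sines ?\<omega> z))\<bar> \<le> 2 * B / R\<^sup>2 * (norm z)\<^sup>2" for z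
  proof (cases "norm z \<le> R")
    case True
    then show ?thesis using arcsines_sines[OF \<open>0 < R\<close> True] order_trans[OF abs_ge_zero B] by simp
  next
    case False
    then have "1 \<le> (norm z)\<^sup>2 / R\<^sup>2" using \<open>0 < R\<close> by (simp add: power_mono)
    then have "2 * B * 1 \<le> 2 * B * ((norm z)\<^sup>2 / R\<^sup>2)"
      using order_trans[OF abs_ge_zero B] by (intro mult_left_mono) auto
    then show ?thesis using B[of z] B[of "arcsines ?\<omega> (sines ?\<omega> z)"] by simp
  qed
  then have "\<bar>f z - P (sines ?\<omega> z)\<bar> \<le> \<delta> + 2 * B / R\<^sup>2 * (norm z)\<^sup>2" for z
    using P(2)[OF sines_in_cbox[of ?\<omega> z]] by (smt (verit))
  then show ?thesis using that[of "\<lambda>z. P (sines ?\<omega> z)"] trig_poly_polynomial_sines[OF P(1)] by blast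
qed

lemma ex_trig_poly_integral_close:
  fixes f :: "'a::euclidean_space \<Rightarrow> real"
  assumes cont: "continuous_on UNIV f" and B: "\<And>z. \<bar>f z\<bar> \<le> B" "0 < B" and "0 \<le> C" "0 < \<epsilon>"
  obtains Q where "trig_poly (\<lambda>z. complex_of_real (Q z))"
    "\<And>M. euclidean_distribution M \<Longrightarrow> integrable M (\<lambda>z. (norm z)\<^sup>2) \<Longrightarrow> (LINT z|M. (norm z)\<^sup>2) \<le> C \<Longrightarrow>
      \<bar>(LINT z|M. f z) - (LINT z|M. Q z)\<bar> \<le> \<epsilon>"
proof -
  define R where "R = sqrt (4 * B * (C + 1) / \<epsilon>)"
  have "0 < R" and R2: "R\<^sup>2 = 4 * B * (C + 1) / \<epsilon>"
    unfolding R_def using \<open>0 < B\<close> \<open>0 \<le> C\<close> \<open>0 < \<epsilon>\<close> by simp_all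
  have "2 * B * C \<le> \<epsilon> / 2 * R\<^sup>2"
    unfolding R2 using \<open>0 < B\<close> \<open>0 < \<epsilon>\<close> by (simp add: field_simps)
  then have tail: "2 * B / R\<^sup>2 * C \<le> \<epsilon> / 2" using \<open>0 < R\<close> by (simp add: divide_simps)
  obtain Q where Q: "trig_poly (\<lambda>z. complex_of_real (Q z))"
    "\<forall>z. \<bar>f z - Q z\<bar> \<le> \<epsilon> / 2 + 2 * B / R\<^sup>2 * (norm z)\<^sup>2"
    using ex_trig_poly_close[OF cont B(1) \<open>0 < R\<close> half_gt_zero[OF \<open>0 < \<epsilon>\<close>]] by blast
  have "\<bar>(LINT z|M. f z) - (LINT z|M. Q z)\<bar> \<le> \<epsilon>"
    if "euclidean_distribution M" "integrable M (\<lambda>z. (norm z)\<^sup>2)" "(LINT z|M. (norm z)\<^sup>2) \<le> C" for M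
  proof -
    interpret euclidean_distribution M by fact
    have "integrable M f" using cont B(1) by (intro integrable_if_continuous_bounded[of _ B]) simp_all
    moreover have "integrable M Q"
      using integrable_trig_poly[OF Q(1)] by (simp add: complex_of_real_integrable_eq)
    ultimately have "\<bar>(LINT z|M. f z) - (LINT z|M. Q z)\<bar> \<le> \<epsilon> / 2 + 2 * B / R\<^sup>2 * C"
      using that(2,3) Q(2) \<open>0 < B\<close> by (intro abs_integral_diff_le) auto
    then show ?thesis using tail by linarith
  qed
  then show ?thesis using that Q(1) by blast
qed

theorem weakly_converges_if_char_vec_tendsto:
  fixes L :: "'a::euclidean_space measure"
  assumes N: "\<And>n. euclidean_distribution (N n)" and L: "euclidean_distribution L"
    and char: "\<And>s. (\<lambda>n. char_vec (N n) s) \<longlonglongrightarrow> char_vec L s"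
    and moment_N: "\<And>n. integrable (N n) (\<lambda>z. (norm z)\<^sup>2)" "(\<lambda>n. LINT z|N n. (norm z)\<^sup>2) \<in> O(\<lambda>_. 1)"
    and moment_L: "integrable L (\<lambda>z. (norm z)\<^sup>2)"
  shows "weakly_converges N L"
  unfolding weakly_converges_def
proof (intro allI impI, elim conjE)
  fix f :: "'a \<Rightarrow> real"
  assume cont: "continuous_on UNIV f" and "bounded (range f)"
  then obtain B where B: "\<And>z. \<bar>f z\<bar> \<le> B" "0 < B" unfolding bounded_pos by auto
  obtain C0 where "\<forall>\<^sub>F n in sequentially. norm (LINT z|N n. (norm z)\<^sup>2) \<le> C0 * norm (1 :: real)"
    using moment_N(2) by (rule landau_o.bigE)
  then have "\<forall>\<^sub>F n in sequentially. (LINT z|N n. (norm z)\<^sup>2) \<le> C0"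
    by eventually_elim (auto simp: abs_le_iff)
  moreover define C where "C = max C0 (LINT z|L. (norm z)\<^sup>2)"
  ultimately have C_N: "\<forall>\<^sub>F n in sequentially. (LINT z|N n. (norm z)\<^sup>2) \<le> C"
    by (simp add: le_max_iff_disj eventually_mono)
  have C_L: "(LINT z|L. (norm z)\<^sup>2) \<le> C" "0 \<le> C" unfolding C_def by (simp_all add: le_max_iff_disj)
  show "(\<lambda>n. LINT z|N n. f z) \<longlonglongrightarrow> (LINT z|L. f z)"
  proof (rule tendstoI)
    fix \<epsilon> :: real assume "0 < \<epsilon>"
    then have "0 < \<epsilon> / 3" by simp
    obtain Q where Q: "trig_poly (\<lambda>z. complex_of_real (Q z))"
      and close: "\<And>M. euclidean_distribution M \<Longrightarrow> integrable M (\<lambda>z. (norm z)\<^sup>2) \<Longrightarrow>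
        (LINT z|M. (norm z)\<^sup>2) \<le> C \<Longrightarrow> \<bar>(LINT z|M. f z) - (LINT z|M. Q z)\<bar> \<le> \<epsilon> / 3"
      by (rule ex_trig_poly_integral_close[OF cont B \<open>0 \<le> C\<close> \<open>0 < \<epsilon> / 3\<close>]) blast
    have "(\<lambda>n. complex_of_real (LINT z|N n. Q z)) \<longlonglongrightarrow> complex_of_real (LINT z|L. Q z)"
      using integral_trig_poly_tendsto[OF N L char Q] by simp
    then have "(\<lambda>n. LINT z|N n. Q z) \<longlonglongrightarrow> (LINT z|L. Q z)" by (simp only: tendsto_of_real_iff)
    from tendstoD[OF this \<open>0 < \<epsilon> / 3\<close>] C_N
    show "\<forall>\<^sub>F n in sequentially. dist (LINT z|N n. f z) (LINT z|L. f z) < \<epsilon>"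
    proof eventually_elim
      case (elim n)
      then show ?case
        using close[OF N moment_N(1) elim(2)] close[OF L moment_L C_L(1)] unfolding dist_real_def by linarith
    qed
  qed
qed

section \<open>The joint limit law\<close>

lemma euclidean_distribution_pair_measure:
  assumes "real_distribution \<mu>" "real_distribution \<nu>"
  shows "euclidean_distribution (\<mu> \<Otimes>\<^sub>M \<nu>)"
proof -
  interpret \<mu>: real_distribution \<mu> by fact
  interpret \<nu>: real_distribution \<nu> by fact
  interpret pair_prob_space \<mu> \<nu> ..
  show ?thesis
    by unfold_locales (simp add: borel_prod[symmetric] cong: sets_pair_measure_cong)
qed

lemma char_vec_pair_measure:
  assumes "real_distribution \<mu>" "real_distribution \<nu>"
  shows "char_vec (\<mu> \<Otimes>\<^sub>M \<nu>) (s, t) = char \<mu> s * char \<nu> t"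
proof -
  interpret \<mu>: real_distribution \<mu> by fact
  interpret \<nu>: real_distribution \<nu> by fact
  interpret pair_prob_space \<mu> \<nu> ..
  have "integrable (\<mu> \<Otimes>\<^sub>M \<nu>) (\<lambda>(x, y). iexp (s * x) * iexp (t * y))"
    by (rule integrable_const_bound[where B = 1]) (auto simp: norm_mult)
  from integral_fst'[OF this] have "(CLINT z|\<mu> \<Otimes>\<^sub>M \<nu>. iexp (s * fst z) * iexp (t * snd z)) =
    (CLINT x|\<mu>. CLINT y|\<nu>. iexp (s * x) * iexp (t * y))" by (simp add: case_prod_unfold)
  also have "\<dots> = char \<mu> s * char \<nu> t" unfolding char_def by simp
  finally show ?thesis unfolding char_vec_def by (simp add: inner_prod_def distrib_left exp_add)
qed

lemma integrable_pair_measure_fst: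
  fixes f :: "'a \<Rightarrow> 'b::{banach, second_countable_topology}"
  assumes "prob_space N" "integrable M f"
  shows "integrable (M \<Otimes>\<^sub>M N) (\<lambda>z. f (fst z))"
proof -
  interpret prob_space N by fact
  have "integrable (distr (M \<Otimes>\<^sub>M N) M fst) f" using assms(2) by (subst distr_pair_fst)
  then show ?thesis by (rule integrable_distr[rotated]) simp
qed

lemma integrable_pair_measure_norm_square:
  assumes "real_distribution \<mu>" "real_distribution \<nu>"
    and "integrable \<mu> (\<lambda>x. x\<^sup>2)" "integrable \<nu> (\<lambda>x. x\<^sup>2)"
  shows "integrable (\<mu> \<Otimes>\<^sub>M \<nu>) (\<lambda>z. (norm z)\<^sup>2)"
proof -
  interpret \<mu>: real_distribution \<mu> by fact
  interpret \<nu>: real_distribution \<nu> by fact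
  interpret pair_sigma_finite \<nu> \<mu> ..
  have "integrable (\<mu> \<Otimes>\<^sub>M \<nu>) (\<lambda>z. (snd z)\<^sup>2)"
    using integrable_product_swap[OF integrable_pair_measure_fst[OF \<mu>.prob_space_axioms assms(4)]]
    by (simp add: case_prod_unfold)
  then show ?thesis
    using integrable_pair_measure_fst[OF \<nu>.prob_space_axioms assms(3)] by (simp add: norm_prod_def)
qed

text \<open>Scaling the standard normal distribution admits the variance \<open>0\<close>.\<close>

definition gaussian :: "real \<Rightarrow> real measure" where
  "gaussian v = distr std_normal_distribution borel (\<lambda>x. sqrt v * x)"

lemma real_distribution_gaussian: "real_distribution (gaussian v)"
proof -
  interpret real_distribution std_normal_distribution by (rule real_dist_normal_dist)
  show ?thesis unfolding gaussian_def by (rule real_distribution_distr) simp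
qed

lemma char_gaussian:
  assumes "0 \<le> v"
  shows "char (gaussian v) t = complex_of_real (exp (- (t\<^sup>2 * v) / 2))"
proof -
  have "char (gaussian v) t = char std_normal_distribution (t * sqrt v)"
    unfolding gaussian_def char_def by (subst integral_distr) (auto simp: mult.assoc)
  then show ?thesis using assms by (simp add: char_std_normal_distribution power_mult_distrib)
qed

lemma integrable_gaussian_square: "integrable (gaussian v) (\<lambda>x. x\<^sup>2)"
  unfolding gaussian_def
  by (subst integrable_distr_eq)
     (auto simp: power_mult_distrib intro!: integrable_mult_right integrable_std_normal_distribution_moment)

context stochastic_digraph
begin

definition path_dist :: "nat \<Rightarrow> 'a \<Rightarrow> 'e list measure" where
  "path_dist n x = point_measure (paths n x) (\<lambda>w. ennreal (\<Prod>e\<leftarrow>w. p e))"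

lemma prob_space_path_dist:
  assumes "x \<in> verts G"
  shows "prob_space (path_dist n x)"
  unfolding path_dist_def
proof (rule prob_space_point_measure[OF finite_paths])
  have "(\<Sum>w\<in>paths n x. \<Prod>e\<leftarrow>w. p e) = 1"
    using path_mean_const[OF assms, of n "1 :: real"] unfolding path_mean_def by simp
  then show "(\<Sum>w\<in>paths n x. ennreal (\<Prod>e\<leftarrow>w. p e)) = 1"
    using path_prob_pos by (subst sum_ennreal) (auto simp: less_imp_le)
qed simp

lemma integral_path_dist:
  fixes f :: "'e list \<Rightarrow> 'b::{banach, second_countable_topology}"
  shows "integral\<^sup>L (path_dist n x) f = path_mean n x f"
  unfolding path_dist_def path_mean_def
  by (rule lebesgue_integral_point_measure_finite[OF finite_paths]) (auto simp: path_prob_pos less_imp_le)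

lemma integrable_path_dist:
  fixes f :: "'e list \<Rightarrow> 'b::{banach, second_countable_topology}"
  shows "integrable (path_dist n x) f"
  unfolding path_dist_def by (rule integrable_point_measure_finite[OF finite_paths])

lemma measurable_path_dist: "f \<in> path_dist n x \<rightarrow>\<^sub>M borel"
  unfolding path_dist_def by simp

lemma covariance_path_dist: "covariance (path_dist n x) f g = path_cov n x f g"
  unfolding covariance_def integral_path_dist path_cov_def ..

definition rescaled :: "nat \<Rightarrow> 'a \<Rightarrow> ('e \<Rightarrow> real) \<Rightarrow> 'e list \<Rightarrow> real" where
  "rescaled n x k w = (output_sum k w - path_mean n x (output_sum k)) / sqrt (real n)"

definition rescaled_law :: "nat \<Rightarrow> 'a \<Rightarrow> ('e \<Rightarrow> real) \<Rightarrow> ('e \<Rightarrow> real) \<Rightarrow> (real \<times> real) measure" where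
  "rescaled_law n x k l = distr (path_dist n x) borel (\<lambda>w. (rescaled n x k w, rescaled n x l w))"

lemma euclidean_distribution_rescaled_law:
  "x \<in> verts G \<Longrightarrow> euclidean_distribution (rescaled_law n x k l)"
  unfolding euclidean_distribution_def euclidean_distribution_axioms_def rescaled_law_def
  by (simp add: prob_space.prob_space_distr prob_space_path_dist measurable_path_dist)

lemma char_vec_rescaled_law:
  "char_vec (rescaled_law n x k l) (s, t) =
      path_mean n x (\<lambda>w. iexp (s * rescaled n x k w + t * rescaled n x l w))"
proof -
  have "(\<lambda>z :: real \<times> real. iexp ((s, t) \<bullet> z)) \<in> borel_measurable borel"
    by (intro borel_measurable_continuous_onI continuous_intros)
  then show ?thesis
    unfolding char_vec_def rescaled_law_def
    by (subst integral_distr[OF measurable_path_dist]) (simp_all add: integral_path_dist)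
qed

lemma integrable_rescaled_law:
  fixes f :: "real \<times> real \<Rightarrow> real"
  assumes "f \<in> borel_measurable borel"
  shows "integrable (rescaled_law n x k l) f"
  unfolding rescaled_law_def
  by (subst integrable_distr_eq[OF measurable_path_dist assms]) (rule integrable_path_dist)

lemma path_mean_rescaled_square:
  "path_mean n x (\<lambda>w. (rescaled n x k w)\<^sup>2) = path_cov n x (output_sum k) (output_sum k) / real n"
proof -
  have "path_mean n x (\<lambda>w. (rescaled n x k w)\<^sup>2) = path_mean n x (\<lambda>w. (1 / real n) *
      ((output_sum k w - path_mean n x (output_sum k)) * (output_sum k w - path_mean n x (output_sum k))))"
    by (rule path_mean_cong) (simp add: rescaled_def power_divide power2_eq_square)
  then show ?thesis unfolding path_mean_mult_left path_cov_def by simp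
qed

lemma second_moment_rescaled_law:
  "(LINT z|rescaled_law n x k l. (norm z)\<^sup>2) =
    path_cov n x (output_sum k) (output_sum k) / real n + path_cov n x (output_sum l) (output_sum l) / real n"
proof -
  have "(LINT z|rescaled_law n x k l. (norm z)\<^sup>2) =
      path_mean n x (\<lambda>w. (norm (rescaled n x k w, rescaled n x l w))\<^sup>2)"
    unfolding rescaled_law_def by (subst integral_distr[OF measurable_path_dist])
      (simp_all add: integral_path_dist)
  also have "\<dots> = path_mean n x (\<lambda>w. (rescaled n x k w)\<^sup>2 + (rescaled n x l w)\<^sup>2)"
    by (simp add: norm_prod_def)
  finally show ?thesis unfolding path_mean_add path_mean_rescaled_square .
qed

end

context ergodic_digraph
begin

lemma abs_output_sum_deviation_le:
  assumes c: "centered (corrected k h)" and x: "x \<in> verts G" and w: "w \<in> paths n x"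
  shows "\<bar>(output_sum k w - path_mean n x (output_sum k)) - output_sum (corrected k h) w\<bar> \<le> oscillation h"
proof -
  have "path_mean n x (\<lambda>w'. h (awlast x w) - h (awlast x w')) =
      h (awlast x w) - path_mean n x (\<lambda>w. h (awlast x w))"
    by (simp add: path_mean_diff path_mean_const[OF x])
  moreover have "norm (path_mean n x (\<lambda>w'. h (awlast x w) - h (awlast x w'))) \<le> oscillation h"
    using w by (intro norm_path_mean_le[OF x]) (auto intro!: abs_diff_le_oscillation awlast_in_verts_if_path)
  ultimately show ?thesis unfolding output_sum_deviation[OF c x w] by simp
qed

lemma path_mean_iexp_rescaled_approx:
  assumes c: "centered (corrected k h)" "centered (corrected l j)" and x: "x \<in> verts G"
  shows "norm (path_mean n x (\<lambda>w. iexp (s * rescaled n x k w + t * rescaled n x l w)) -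
    path_mean n x (\<lambda>w. iexp (output_sum (\<lambda>e. s * corrected k h e + t * corrected l j e) w / sqrt (real n))))
    \<le> (\<bar>s\<bar> * oscillation h + \<bar>t\<bar> * oscillation j) / sqrt (real n)"
  unfolding path_mean_diff[symmetric]
proof (rule norm_path_mean_le[OF x])
  fix w assume w: "w \<in> paths n x"
  define d where "d k h = (output_sum k w - path_mean n x (output_sum k)) - output_sum (corrected k h) w"
      for k h
  let ?g = "\<lambda>e. s * corrected k h e + t * corrected l j e"
  have "\<bar>(s * rescaled n x k w + t * rescaled n x l w) - output_sum ?g w / sqrt (real n)\<bar> =
      \<bar>s * d k h + t * d l j\<bar> / sqrt (real n)"
  proof -
    have "(s * rescaled n x k w + t * rescaled n x l w) - output_sum ?g w / sqrt (real n) =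
        (s * d k h + t * d l j) / sqrt (real n)"
      unfolding rescaled_def d_def output_sum_linear
      by (simp add: add_divide_distrib diff_divide_distrib algebra_simps)
    then show ?thesis by (simp add: abs_divide)
  qed
  also have "\<dots> \<le> (\<bar>s\<bar> * oscillation h + \<bar>t\<bar> * oscillation j) / sqrt (real n)"
  proof (rule divide_right_mono)
    have "\<bar>s * d k h\<bar> \<le> \<bar>s\<bar> * oscillation h" "\<bar>t * d l j\<bar> \<le> \<bar>t\<bar> * oscillation j"
      unfolding abs_mult d_def
      using abs_output_sum_deviation_le[OF c(1) x w] abs_output_sum_deviation_le[OF c(2) x w]
      by (simp_all add: mult_left_mono)
    then show "\<bar>s * d k h + t * d l j\<bar> \<le> \<bar>s\<bar> * oscillation h + \<bar>t\<bar> * oscillation j" by linarith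
  qed simp
  finally show "norm (iexp (s * rescaled n x k w + t * rescaled n x l w)
      - iexp (output_sum ?g w / sqrt (real n)))
      \<le> (\<bar>s\<bar> * oscillation h + \<bar>t\<bar> * oscillation j) / sqrt (real n)"
    by (rule order_trans[OF norm_iexp_diff_le])
qed

theorem char_vec_rescaled_law_limit:
  assumes x: "x \<in> verts G"
  shows "(\<lambda>n. char_vec (rescaled_law n x k l) (s, t)) \<longlonglongrightarrow> complex_of_real
    (exp (- (s\<^sup>2 * asymptotic_cov k k + 2 * s * t * asymptotic_cov k l + t\<^sup>2 * asymptotic_cov l l) / 2))"
proof -
  obtain h where h: "centered (corrected k h)" by (rule ex_centered_corrected)
  obtain j where j: "centered (corrected l j)" by (rule ex_centered_corrected)
  let ?k = "corrected k h" and ?l = "corrected l j"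
  let ?g = "\<lambda>e. s * ?k e + t * ?l e"
  have "asymptotic_mean (\<lambda>e. (?g e)\<^sup>2) =
      asymptotic_mean (\<lambda>e. s\<^sup>2 * (?k e * ?k e) + 1 * (2 * s * t * (?k e * ?l e) + t\<^sup>2 * (?l e * ?l e)))"
    by (rule arg_cong[of _ _ asymptotic_mean]) (simp add: fun_eq_iff power2_eq_square algebra_simps)
  also have "\<dots> = s\<^sup>2 * asymptotic_cov k k + 2 * s * t * asymptotic_cov k l + t\<^sup>2 * asymptotic_cov l l"
    unfolding asymptotic_mean_linear asymptotic_cov_eq_mean_corrected[OF h j]
      asymptotic_cov_eq_mean_corrected[OF h h] asymptotic_cov_eq_mean_corrected[OF j j] by simp
  finally have variance: "asymptotic_mean (\<lambda>e. (?g e)\<^sup>2) = \<dots>" .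
  have "(\<lambda>n. B / sqrt (real n)) \<longlonglongrightarrow> 0" for B :: real by real_asymp
  then have "(\<lambda>n. char_vec (rescaled_law n x k l) (s, t) -
      path_mean n x (\<lambda>w. iexp (output_sum ?g w / sqrt (real n)))) \<longlonglongrightarrow> 0"
    unfolding char_vec_rescaled_law
    by (rule Lim_null_comparison[OF always_eventually[OF allI[OF path_mean_iexp_rescaled_approx[OF h j x]]]])
  with characteristic_function_limit[OF centered_linear[OF h j] x, of s t]
  show ?thesis unfolding variance by (rule Lim_transform)
qed

lemma second_moment_rescaled_law_bigo:
  assumes x: "x \<in> verts G"
  shows "(\<lambda>n. LINT z|rescaled_law n x k l. (norm z)\<^sup>2) \<in> O(\<lambda>_. 1)"
proof -
  have "(\<lambda>n. path_cov n x (output_sum k) (output_sum k) / real n) \<in> O(\<lambda>_. 1)" for k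
  proof -
    let ?v = "asymptotic_cov k k"
    have "(\<lambda>n. path_cov n x (output_sum k) (output_sum k) - ?v * real n) \<in> O(\<lambda>n. real n)"
      by (rule landau_o.big_trans[OF path_cov_output_sum_asymptotics[OF x]]) real_asymp
    moreover have "(\<lambda>n. ?v * real n) \<in> O(\<lambda>n. real n)" by simp
    ultimately have "(\<lambda>n. path_cov n x (output_sum k) (output_sum k)) \<in> O(\<lambda>n. real n)"
      using sum_in_bigo(1) by fastforce
    from landau_o.big.mult[OF this landau_o.big_refl[of "\<lambda>n. 1 / real n"]]
    have "(\<lambda>n. path_cov n x (output_sum k) (output_sum k) / real n) \<in> O(\<lambda>n. real n * (1 / real n))" by simp
    then show ?thesis by (rule landau_o.big_trans) real_asymp
  qed
  then show ?thesis unfolding second_moment_rescaled_law by (intro sum_in_bigo)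
qed

lemma rescaled_law_weakly_converges:
  assumes x: "x \<in> verts G" and uncorrelated: "asymptotic_cov k l = 0"
  shows "weakly_converges (\<lambda>n. rescaled_law n x k l)
      (gaussian (asymptotic_cov k k) \<Otimes>\<^sub>M gaussian (asymptotic_cov l l))"
proof (rule weakly_converges_if_char_vec_tendsto)
  let ?L = "gaussian (asymptotic_cov k k) \<Otimes>\<^sub>M gaussian (asymptotic_cov l l)"
  note gaussians = real_distribution_gaussian[of "asymptotic_cov k k"]
      real_distribution_gaussian[of "asymptotic_cov l l"]
  show "euclidean_distribution ?L" by (rule euclidean_distribution_pair_measure[OF gaussians])
  show "integrable ?L (\<lambda>z. (norm z)\<^sup>2)"
    by (rule integrable_pair_measure_norm_square[OF gaussians
      integrable_gaussian_square integrable_gaussian_square])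
  show "integrable (rescaled_law n x k l) (\<lambda>z. (norm z)\<^sup>2)" for n by (rule integrable_rescaled_law) simp
  show "(\<lambda>n. char_vec (rescaled_law n x k l) z) \<longlonglongrightarrow> char_vec ?L z" for z
  proof (cases z)
    case (Pair s t)
    have "char_vec ?L (s, t) = complex_of_real
        (exp (- (s\<^sup>2 * asymptotic_cov k k + 2 * s * t * asymptotic_cov k l + t\<^sup>2 * asymptotic_cov l l) / 2))"
      unfolding char_vec_pair_measure[OF gaussians] char_gaussian[OF asymptotic_cov_nonneg]
        of_real_mult[symmetric] exp_add[symmetric] uncorrelated
      by (simp add: add_divide_distrib diff_divide_distrib)
    then show ?thesis unfolding Pair using char_vec_rescaled_law_limit[OF x] by simp
  qed
qed (use x in \<open>simp_all add: euclidean_distribution_rescaled_law second_moment_rescaled_law_bigo\<close>)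

lemma asymptotic_cov_eq_0_if_weakly_converges:
  assumes x: "x \<in> verts G" and \<mu>: "real_distribution \<mu>" and \<nu>: "real_distribution \<nu>"
    and conv: "weakly_converges (\<lambda>n. rescaled_law n x k l) (\<mu> \<Otimes>\<^sub>M \<nu>)"
  shows "asymptotic_cov k l = 0"
proof -
  let ?q = "\<lambda>s t. s\<^sup>2 * asymptotic_cov k k + 2 * s * t * asymptotic_cov k l + t\<^sup>2 * asymptotic_cov l l"
  have limit: "char \<mu> s * char \<nu> t = complex_of_real (exp (- ?q s t / 2))" for s t
  proof -
    have "(\<lambda>n. char_vec (rescaled_law n x k l) (s, t)) \<longlonglongrightarrow> char_vec (\<mu> \<Otimes>\<^sub>M \<nu>) (s, t)"
      by (rule char_vec_tendsto_if_weakly_converges[OF euclidean_distribution_rescaled_law[OF x]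
            euclidean_distribution_pair_measure[OF \<mu> \<nu>] conv])
    from LIMSEQ_unique[OF this char_vec_rescaled_law_limit[OF x]]
    show ?thesis unfolding char_vec_pair_measure[OF \<mu> \<nu>] .
  qed
  have "char \<mu> 1 * char \<nu> 1 = (char \<mu> 1 * char \<nu> 0) * (char \<mu> 0 * char \<nu> 1)"
    using real_distribution.char_zero[OF \<mu>] real_distribution.char_zero[OF \<nu>] by simp
  then have "exp (- ?q 1 1 / 2) = exp (- ?q 1 0 / 2) * exp (- ?q 0 1 / 2)"
    unfolding limit of_real_mult[symmetric] of_real_eq_iff .
  then have "- ?q 1 1 / 2 = - ?q 1 0 / 2 + - ?q 0 1 / 2"
    unfolding exp_add[symmetric] by (simp only: exp_inj_iff)
  then show ?thesis by simp
qed

theorem asymptotically_independent_iff_asymptotic_cov: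
  assumes x: "x \<in> verts G"
  shows "asymptotically_independent (\<lambda>n. path_dist n x) (\<lambda>_. output_sum k) (\<lambda>_. output_sum l) \<longleftrightarrow>
    asymptotic_cov k l = 0"
proof -
  have "(\<lambda>n. distr (path_dist n x) borel
      (\<lambda>w. ((output_sum k w - path_mean n x (output_sum k)) / sqrt (real n),
            (output_sum l w - path_mean n x (output_sum l)) / sqrt (real n)))) = (\<lambda>n. rescaled_law n x k l)"
    unfolding rescaled_law_def rescaled_def ..
  then show ?thesis
    unfolding asymptotically_independent_def integral_path_dist weak_conv_2d_eq
    using rescaled_law_weakly_converges[OF x]
      asymptotic_cov_eq_0_if_weakly_converges[OF x] real_distribution_gaussian
    by metis
qed

lemma asymptotic_cov_eq_0_iff:
  "asymptotic_cov k l = 0 \<longleftrightarrow>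
    D1_pair (G \<restriction> final_verts) p (\<lambda>e. k e - asymptotic_mean k) (\<lambda>e. l e - asymptotic_mean l) =
    D2_pair (G \<restriction> final_verts) p (\<lambda>e. k e - asymptotic_mean k) (\<lambda>e. l e - asymptotic_mean l)"
  unfolding asymptotic_cov_def using D1_sum_final_one_pos by simp

end

theorem theorem3p6:
  fixes G :: "(nat, 'e) pre_digraph" and M :: nat and p :: "'e \<Rightarrow> real"
    and k1 k2 :: "'e \<Rightarrow> real"
  assumes "finite_markov_chain G M p"
    and "finally_connected G"
    and "finally_aperiodic G"
  shows "let
      F = final_component G;
      P = path_measure G p;
      one = (\<lambda>_. 1);
      e = (\<lambda>k. D1_sum F p k / D1_sum F p one);
      dev = (\<lambda>k a. k a - e k * one a);
      v = (\<lambda>k. 1 / D1_sum F p one *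
             (D1_pair F p (dev k) (dev k) - D2_pair F p (dev k) (dev k)));
      c = 1 / D1_sum F p one *
             (D1_pair F p (dev k1) (dev k2) - D2_pair F p (dev k1) (dev k2))
    in
      (\<forall>k\<in>{k1, k2}.
        (\<lambda>n. prob_space.expectation (P n) (output_sum k) - e k * real n) \<in> O(\<lambda>_. 1) \<and>
        (\<lambda>n. prob_space.variance (P n) (output_sum k) - v k * real n) \<in> O(\<lambda>_. 1)) \<and>
      (\<lambda>n. covariance (P n) (output_sum k1) (output_sum k2) - c * real n) \<in> O(\<lambda>_. 1) \<and>
      (asymptotically_independent P (\<lambda>_. output_sum k1) (\<lambda>_. output_sum k2) \<longleftrightarrow>
        D1_pair F p (dev k1) (dev k2) = D2_pair F p (dev k1) (dev k2))"
proof -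
  interpret finite_markov_chain G M p by fact
  interpret ergodic_digraph G p by unfold_locales (fact p_pos p_sum assms)+
  have path_measure: "path_measure G p = (\<lambda>n. path_dist n 1)"
    unfolding path_measure_def path_dist_def paths_def ..
  have expectation: "(\<lambda>n. prob_space.expectation (path_dist n 1) (output_sum k) - asymptotic_mean k * real n)
      \<in> O(\<lambda>_. 1)" for k
    unfolding integral_path_dist by (rule path_mean_output_sum_asymptotics[OF initial])
  have covariance: "(\<lambda>n. covariance (path_dist n 1) (output_sum k) (output_sum l) - asymptotic_cov k l * real n)
      \<in> O(\<lambda>_. 1)" for k l
    unfolding covariance_path_dist by (rule path_cov_output_sum_asymptotics[OF initial])
  have variance: "(\<lambda>n. prob_space.variance (path_dist n 1) (output_sum k) - asymptotic_cov k k * real n)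
      \<in> O(\<lambda>_. 1)" for k
    using covariance[of k k] unfolding covariance_def power2_eq_square .
  show ?thesis
    unfolding Let_def final_component_eq path_measure mult_1_right
      asymptotic_mean_def[symmetric] asymptotic_cov_def[symmetric] asymptotic_cov_eq_0_iff[symmetric]
    using expectation variance covariance asymptotically_independent_iff_asymptotic_cov[OF initial] by blast
qed

end
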